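(* Let $\boldsymbol{a}=(a_\ell)_{\ell\in\mathbb{Z}}$ be a complex valued sequence satisfying Assumptions (A1) and (A2) of the context, with associated data $K$, $\underline{\kappa}_k$, $\alpha_k$, $\beta_k$, $\mu_k$ ($k\in\{1,\dots,K\}$), polynomials $P_{k,m}$, and functions $H^{\beta}_{2\mu}$ as defined in the context. Let $\mu:=\max_{1\le k\le K}\mu_k$. For $n\in\mathbb{N}^*$ and $k\in\{1,\dots,K\}$, define the sequences indexed by $\ell\in\mathbb{Z}$ $$ \mathcal{H}^{n}_{k,0}:=\left(\frac{\underline{\kappa}_k^{-\ell}F_{\boldsymbol{a}}(\underline{\kappa}_k)^n}{n^{1/(2\mu_k)}}H^{\beta_k}_{2\mu_k}\!\left(\frac{\ell-\alpha_k n}{n^{1/(2\mu_k)}}\right)\right)_{\ell\in\mathbb{Z}}, $$ $$ \mathcal{H}^{n}_{k,m}:=\left(\frac{\underline{\kappa}_k^{-\ell}F_{\boldsymbol{a}}(\underline{\kappa}_k)^n}{n^{(m+1)/(2\mu_k)}}\Big(P_{k,m}(-\mathrm{d}/\mathrm{d}x)H^{\beta_k}_{2\mu_k}\Big)\!\left(\frac{\ell-\alpha_k n}{n^{1/(2\mu_k)}}\right)\right)_{\ell\in\mathbb{Z}}\quad(m\ge1). $$ Then for any integer $M\in\mathbb{N}$, there exists a constant $C_M>0$ such that for any $p$ with $1\le p\le+\infty$, any sequence $\boldsymbol{u}^0\in\ell^p(\mathbb{Z};\mathbb{C})$ and any $n\in\mathbb{N}^*$, there holds $$ \left\|\boldsymbol{a}^{\star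 n}\star\boldsymbol{u}^0-\sum_{k=1}^K\mathcal{H}^{n}_{k,0}\star\boldsymbol{u}^0-\sum_{m=1}^M\sum_{k=1}^K\mathcal{H}^{n}_{k,m}\star\boldsymbol{u}^0\right\|_{\ell^p}\le\frac{C_M\,\|\boldsymbol{u}^0\|_{\ell^p}}{n^{(M+1)/(2\mu)}}. $$
   Context: Notation: $\mathbb{N}=\{0,1,2,\dots\}$, $\mathbb{N}^*=\{1,2,\dots\}$, $\mathbf{i}$ is the imaginary unit, $\mathbb{S}^1$ is the unit circle in $\mathbb{C}$. Convolution: for complex sequences $\boldsymbol{a},\boldsymbol{b}$ indexed by $\mathbb{Z}$ (when the sums make sense), $(\boldsymbol{a}\star\boldsymbol{b})_\ell=\sum_{\ell'\in\mathbb{Z}}a_{\ell-\ell'}b_{\ell'}$. Set $\boldsymbol{a}^{\star 1}:=\boldsymbol{a}$ and $\boldsymbol{a}^{\star(n+1)}:=\boldsymbol{a}^{\star n}\star\boldsymbol{a}$ for $n\in\mathbb{N}^*$. Assumption (A1): $\boldsymbol{a}\in\ell^1(\mathbb{Z};\mathbb{C})$, the series $F_{\boldsymbol{a}}(\zeta)=\sum_{\ell\in\mathbb{Z}}a_\ell\zeta^\ell$ defines a holomorphic function on an annulus $\{\zeta\in\mathbb{C}\,|\,1-\varepsilon<|\zeta|<1+\varepsilon\}$ for some $\varepsilon>0$, and $\sup_{\kappa\in\mathbb{S}^1}|F_{\boldsymbol{a}}(\kappa)|=1$. Assumption (A2): there is a finite set of pairwise distinct points $\{\underline{\kappa}_1,\dots,\underline{\kappa}_K\}\subset\mathbb{S}^1$,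 $K\ge1$, such that $|F_{\boldsymbol{a}}(\underline{\kappa}_k)|=1$ for all $k$ and $|F_{\boldsymbol{a}}(\kappa)|<1$ for all $\kappa\in\mathbb{S}^1\setminus\{\underline{\kappa}_1,\dots,\underline{\kappa}_K\}$. Moreover, for each $k\in\{1,\dots,K\}$ there exist a real number $\alpha_k$, a complex number $\beta_k$ with positive real part and an integer $\mu_k\in\mathbb{N}^*$ such that, as the complex number $\xi$ tends to $0$, $$F_{\boldsymbol{a}}(\underline{\kappa}_k\mathrm{e}^{\mathbf{i}\xi})=F_{\boldsymbol{a}}(\underline{\kappa}_k)\exp\big(\mathbf{i}\alpha_k\xi-\beta_k\xi^{2\mu_k}+O(\xi^{2\mu_k+1})\big).$$ Cumulants: the complex numbers $\gamma_{k,\nu}$, $\nu\ge2\mu_k+1$, are the coefficients of the convergent power series such that, for all sufficiently small $\xi\in\mathbb{C}$, $$F_{\boldsymbol{a}}(\underline{\kappa}_k\mathrm{e}^{\mathbf{i}\xi})=F_{\boldsymbol{a}}(\underline{\kappa}_k)\exp\Big(\mathbf{i}\alpha_k\xi-\beta_k\xi^{2\mu_k}+\sum_{\nu\ge2\mu_k+1}\frac{\gamma_{k,\nu}}{\nu!}(\mathbf{i}\xi)^\nu\Big).$$ Polynomials $P_{k,m}$, $m\ge1$: defined by the expansion, as a power series in the two variables $(Y,Z)$, $$\exp\Big(\sum_{\nu\ge1}\frac{\gamma_{k,2\mu_k+\nu}}{(2\mu_k+\nu)!}Y^{2\mu_k+\nu}Z^\nu\Big)=1+\sum_{m\ge1}P_{k,m}(Y)Z^m.$$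 For a polynomial $P(Y)=\sum_j p_jY^j$, $P(-\mathrm{d}/\mathrm{d}x)$ denotes the differential operator $f\mapsto\sum_j p_j(-1)^jf^{(j)}$. Functions $H^\beta_{2\mu}$: for $\mu\in\mathbb{N}^*$ and $\beta\in\mathbb{C}$ with positive real part, $$H^\beta_{2\mu}(x)=\frac{1}{2\pi}\int_{\mathbb{R}}\mathrm{e}^{-\mathbf{i}x\theta}\,\mathrm{e}^{-\beta\theta^{2\mu}}\,\mathrm{d}\theta,\qquad x\in\mathbb{R}.$$ *)

theory Defs
  imports
    "HOL-Analysis.Analysis"
    "HOL-Computational_Algebra.Computational_Algebra"
    "HOL-Library.Landau_Symbols"
begin

definition lp :: "ereal \<Rightarrow> (int \<Rightarrow> complex) set" where
  "lp p = {u. if p = \<infinity> then bounded (range u)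
              else (\<lambda>l. norm (u l) powr real_of_ereal p) summable_on UNIV}"

text \<open>The value of \<open>lp_norm p u\<close> is meaningful only for \<open>u \<in> lp p\<close>; outside that set
  it is a junk value, so bounds on it have to be accompanied by a membership claim.\<close>

definition lp_norm :: "ereal \<Rightarrow> (int \<Rightarrow> complex) \<Rightarrow> real" where
  "lp_norm p u = (if p = \<infinity> then (SUP l. norm (u l))
     else (\<Sum>\<^sub>\<infinity>l. norm (u l) powr real_of_ereal p) powr (1 / real_of_ereal p))"

definition conv :: "(int \<Rightarrow> complex) \<Rightarrow> (int \<Rightarrow> complex) \<Rightarrow> int \<Rightarrow> complex" (infixl \<open>\<star>\<close> 70) where
  "a \<star> b = (\<lambda>l. \<Sum>\<^sub>\<infinity>l'. a (l - l') * b l')"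

text \<open>Only exponents \<open>n \<ge> 1\<close> are used; the value at \<open>0\<close> is the neutral element.\<close>

fun conv_pow :: "(int \<Rightarrow> complex) \<Rightarrow> nat \<Rightarrow> int \<Rightarrow> complex" where
  "conv_pow a 0 = (\<lambda>l. if l = 0 then 1 else 0)"
| "conv_pow a (Suc 0) = a"
| "conv_pow a (Suc (Suc n)) = conv_pow a (Suc n) \<star> a"

definition symbol :: "(int \<Rightarrow> complex) \<Rightarrow> complex \<Rightarrow> complex" where
  "symbol a \<zeta> = (\<Sum>\<^sub>\<infinity>l. a l * \<zeta> powi l)"

definition assumption_A1 :: "(int \<Rightarrow> complex) \<Rightarrow> bool" where
  "assumption_A1 a \<longleftrightarrow>
     a \<in> lp 1 \<and>
     (\<exists>\<epsilon>>0. (\<forall>\<zeta>. 1 - \<epsilon> < norm \<zeta> \<and> norm \<zeta> < 1 + \<epsilon> \<longrightarrow> (\<lambda>l. a l * \<zeta> powi l) summable_on UNIV) \<and>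
            symbol a holomorphic_on {\<zeta>. 1 - \<epsilon> < norm \<zeta> \<and> norm \<zeta> < 1 + \<epsilon>}) \<and>
     (SUP \<kappa>\<in>sphere 0 1. norm (symbol a \<kappa>)) = 1"

definition assumption_A2 ::
  "(int \<Rightarrow> complex) \<Rightarrow> nat \<Rightarrow> (nat \<Rightarrow> complex) \<Rightarrow> (nat \<Rightarrow> real) \<Rightarrow> (nat \<Rightarrow> complex) \<Rightarrow> (nat \<Rightarrow> nat) \<Rightarrow> bool"
where
  "assumption_A2 a K \<kappa> \<alpha> \<beta> \<mu> \<longleftrightarrow>
     K \<ge> 1 \<and> inj_on \<kappa> {1..K} \<and> \<kappa> ` {1..K} \<subseteq> sphere 0 1 \<and>
     (\<forall>k\<in>{1..K}. norm (symbol a (\<kappa> k)) = 1) \<and>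
     (\<forall>z\<in>sphere 0 1 - \<kappa> ` {1..K}. norm (symbol a z) < 1) \<and>
     (\<forall>k\<in>{1..K}. Re (\<beta> k) > 0 \<and> \<mu> k \<ge> 1 \<and>
        (\<exists>R \<in> O[at 0](\<lambda>\<xi>. \<xi> ^ (2 * \<mu> k + 1)). \<forall>\<^sub>F \<xi> in at 0.
           symbol a (\<kappa> k * exp (\<i> * \<xi>)) =
             symbol a (\<kappa> k) * exp (\<i> * \<alpha> k * \<xi> - \<beta> k * \<xi> ^ (2 * \<mu> k) + R \<xi>)))"

text \<open>The coefficients \<open>\<gamma> \<nu>\<close> are determined by the expansion only for \<open>\<nu> > 2 * \<mu>\<close>. Setting the
  others to \<open>0\<close> makes the sequence unique and lets the power series start at \<open>\<nu> = 0\<close>.\<close>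

definition cumulants ::
  "(complex \<Rightarrow> complex) \<Rightarrow> complex \<Rightarrow> real \<Rightarrow> complex \<Rightarrow> nat \<Rightarrow> nat \<Rightarrow> complex" where
  "cumulants F \<kappa> \<alpha> \<beta> \<mu> = (THE \<gamma>.
     (\<forall>\<nu>\<le>2 * \<mu>. \<gamma> \<nu> = 0) \<and>
     (\<exists>r>0. \<forall>\<xi>. norm \<xi> < r \<longrightarrow>
        summable (\<lambda>\<nu>. \<gamma> \<nu> / fact \<nu> * (\<i> * \<xi>) ^ \<nu>) \<and>
        F (\<kappa> * exp (\<i> * \<xi>)) =
          F \<kappa> * exp (\<i> * \<alpha> * \<xi> - \<beta> * \<xi> ^ (2 * \<mu>) + (\<Sum>\<nu>. \<gamma> \<nu> / fact \<nu> * (\<i> * \<xi>) ^ \<nu>))))"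

text \<open>A power series in \<open>(Y, Z)\<close> whose coefficient of each power of \<open>Z\<close> is a polynomial in \<open>Y\<close>
  is encoded as a formal power series in \<open>Z\<close> over polynomials in \<open>Y\<close>. Since
  \<^const>\<open>fps_exp\<close> is useful only over fields, the exponential is written as the composition with
  the series that has the constant polynomials \<open>1 / j!\<close> as coefficients.\<close>

definition expansion_poly :: "(nat \<Rightarrow> complex) \<Rightarrow> nat \<Rightarrow> nat \<Rightarrow> complex poly" where
  "expansion_poly \<gamma> \<mu> m =
     fps_nth (fps_compose (Abs_fps (\<lambda>j. [:1 / fact j:]))
       (Abs_fps (\<lambda>\<nu>. if \<nu> = 0 then 0
                     else monom (\<gamma> (2 * \<mu> + \<nu>) / fact (2 * \<mu> + \<nu>)) (2 * \<mu> + \<nu>)))) m"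

definition poly_neg_deriv :: "complex poly \<Rightarrow> (real \<Rightarrow> complex) \<Rightarrow> real \<Rightarrow> complex" where
  "poly_neg_deriv P f x =
     (\<Sum>j\<le>degree P. coeff P j * (-1) ^ j * (((\<lambda>g y. vector_derivative g (at y)) ^^ j) f) x)"

text \<open>The function \<open>H\<^sup>\<beta>\<close> with index \<open>2 * \<mu>\<close> is \<open>H_fun \<beta> \<mu>\<close>.\<close>

definition H_fun :: "complex \<Rightarrow> nat \<Rightarrow> real \<Rightarrow> complex" where
  "H_fun \<beta> \<mu> x =
     1 / (2 * pi) * (LINT \<theta>|lborel. exp (- \<i> * x * \<theta>) * exp (- \<beta> * complex_of_real \<theta> ^ (2 * \<mu>)))"

definition H_seq0 ::
  "(complex \<Rightarrow> complex) \<Rightarrow> complex \<Rightarrow> real \<Rightarrow> complex \<Rightarrow> nat \<Rightarrow> nat \<Rightarrow> int \<Rightarrow> complex" where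
  "H_seq0 F \<kappa> \<alpha> \<beta> \<mu> n = (\<lambda>l.
     \<kappa> powi (- l) * F \<kappa> ^ n / of_real (real n powr (1 / (2 * real \<mu>))) *
     H_fun \<beta> \<mu> ((real_of_int l - \<alpha> * real n) / real n powr (1 / (2 * real \<mu>))))"

definition H_seq ::
  "(complex \<Rightarrow> complex) \<Rightarrow> complex \<Rightarrow> real \<Rightarrow> complex \<Rightarrow> nat \<Rightarrow> nat \<Rightarrow> nat \<Rightarrow> int \<Rightarrow> complex" where
  "H_seq F \<kappa> \<alpha> \<beta> \<mu> m n = (\<lambda>l.
     \<kappa> powi (- l) * F \<kappa> ^ n / of_real (real n powr ((real m + 1) / (2 * real \<mu>))) *
     poly_neg_deriv (expansion_poly (cumulants F \<kappa> \<alpha> \<beta> \<mu>) \<mu> m) (H_fun \<beta> \<mu>)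
       ((real_of_int l - \<alpha> * real n) / real n powr (1 / (2 * real \<mu>))))"

end

theory Submission
  imports Defs "HOL-Complex_Analysis.Complex_Analysis" "HOL-Real_Asymp.Real_Asymp"
begin

text \<open>
  By Young's inequality it suffices to bound the \<open>\<ell>\<^sup>1\<close> norm of the error sequence.
  For \<open>\<bar>l\<bar> \<le> n\<^sup>2\<close> the \<open>l\<close>-th term of the \<open>n\<close>-fold convolution power is an integral of \<open>F(\<zeta>)\<^sup>n * \<zeta>\<^sup>-\<^sup>l\<close>
  over the unit circle. Away from
  small arcs around the points \<open>\<kappa>\<^sub>k\<close> the integrand is exponentially small. On the \<open>k\<close>-th arc,
  with \<open>N = n powr (1 / (2 * \<mu>\<^sub>k))\<close> and the scaled variable \<open>t\<close>, the
  difference between \<open>F\<^sup>n\<close> and its expansion is a Taylor remainder in \<open>1 / N\<close>, which by Cauchy's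
  estimates is \<open>O(N powr - (M + 1)) * exp (- \<bar>Re t\<bar>)\<close> on the strip \<open>\<bar>Im t\<bar> \<le> 1\<close>.
  Shifting the contour by \<open>\<plusminus>\<i>\<close> turns this into a factor \<open>exp (- \<bar>x\<bar>)\<close>,
  \<open>x = (l - \<alpha>\<^sub>k * n) / N\<close>, whose sum over \<open>l\<close> is \<open>O(N)\<close>. For \<open>\<bar>l\<bar> > n\<^sup>2\<close> both parts
  of the error are superpolynomially small: \<open>a\<close> is summable with exponential weights, and the
  \<open>H\<close> functions decay exponentially by the same contour shift.
\<close>

section \<open>Convolution and Young's inequality\<close>

text \<open>The difficulty is uniformity: pointwise errors have to be summed over all integers. The
  bounds \<open>q ^ n\<close> and \<open>exp (- \<delta> * N)\<close> carry no decay in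
  \<open>l\<close> and are affordable only on a window of polynomial length. The radius n^2 is large
  enough that outside it the weight exp (- \<eta> * n^2) beats the growth A^n of weighted norms of
  convolution powers, and that the centres \<alpha> * n of the profiles lie well inside for large n.

  On an arc the scaled variable z reaches size \<delta> * N, so the cumulant series is not a bounded
  perturbation of the Gaussian factor. It is written as \<open>Y ^ (2 * \<mu>) * S (Y * Z)\<close>
  with \<open>S 0 = 0\<close>, Y = \<i> * z and Z = 1 / N. On a short arc its norm is at most
  \<epsilon> * |z|^(2 * \<mu>), which the positive real part of \<beta> absorbs.

  The change of variables on the arc contributes one further factor 1 / N. This is why the pointwise
  error has order M + 2 in 1 / N: the summation over \<open>l\<close> takes one power back. All arcs
  share one radius \<delta>, so every local estimate is proved for all sufficiently small
  \<delta>.\<close>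

no_notation Infinite_Set_Sum.abs_summable_on (infix \<open>abs'_summable'_on\<close> 50)

lemma bij_diff_int: "bij_betw (\<lambda>l::int. l - c) UNIV UNIV" "bij_betw (\<lambda>l::int. c - l) UNIV UNIV"
  by (rule bij_betwI[where g = "\<lambda>l. l + c"]; simp) (rule bij_betwI[where g = "\<lambda>l. c - l"]; simp)

lemma summable_on_shift:
  "(\<lambda>l::int. f (l - c)) summable_on UNIV \<longleftrightarrow> f summable_on UNIV"
  "(\<lambda>l::int. f (c - l)) summable_on UNIV \<longleftrightarrow> f summable_on UNIV"
  using summable_on_reindex_bij_betw[OF bij_diff_int(1), of f c]
    summable_on_reindex_bij_betw[OF bij_diff_int(2), of f c] by auto

lemma infsum_shift:
  "(\<Sum>\<^sub>\<infinity>l::int. f (l - c)) = infsum f UNIV"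
  "(\<Sum>\<^sub>\<infinity>l::int. f (c - l)) = infsum f UNIV"
  using infsum_reindex_bij_betw[OF bij_diff_int(1), of f c]
    infsum_reindex_bij_betw[OF bij_diff_int(2), of f c] by auto

text \<open>Tonelli with \<open>l'\<close> as the outer variable: each inner sum is then a shift of
  the norm sum of \<open>f\<close>, so the iterated sum factorises. This justifies the later
  interchanges of summation.\<close>

lemma summable_on_convolution_pairs:
  fixes f g :: "int \<Rightarrow> 'a::{real_normed_div_algebra,banach}"
  assumes f: "f abs_summable_on UNIV" and g: "g abs_summable_on UNIV"
  shows "(\<lambda>(l', l). f (l - l') * g l') abs_summable_on UNIV \<times> UNIV"
proof -
  have 1: "(\<lambda>l. norm (f (l - l') * g l')) summable_on UNIV" for l'
    unfolding norm_mult
    by (rule summable_on_cmult_left)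
      (use f summable_on_shift(1)[of "\<lambda>l. norm (f l)" l'] in simp)
  have 2: "(\<Sum>\<^sub>\<infinity>l. norm (f (l - l') * g l')) = (\<Sum>\<^sub>\<infinity>l. norm (f l)) * norm (g l')" for l'
    unfolding norm_mult
    using infsum_cmult_left[of "norm (g l')" "\<lambda>l. norm (f (l - l'))" UNIV] f
      summable_on_shift(1)[of "\<lambda>l. norm (f l)" l'] infsum_shift(1)[of "\<lambda>l. norm (f l)" l'] by simp
  have 3: "(\<lambda>l'. (\<Sum>\<^sub>\<infinity>l. norm (f (l - l') * g l'))) summable_on UNIV"
    unfolding 2 by (rule summable_on_cmult_right) (use g in simp)
  have 4: "(\<lambda>l'. \<Sum>\<^sub>\<infinity>l. norm (f (l - l') * g l')) abs_summable_on UNIV"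
    using 3 by (subst (asm) summable_on_iff_abs_summable_on_real)
  have "(\<forall>l'\<in>UNIV. (\<lambda>l. (\<lambda>(l', l). f (l - l') * g l') (l', l)) abs_summable_on UNIV) \<and>
     (\<lambda>l'. \<Sum>\<^sub>\<infinity>l. norm ((\<lambda>(l', l). f (l - l') * g l') (l', l))) abs_summable_on UNIV"
    using 1 4 by (simp only: prod.case) blast
  then show ?thesis
    by (rule iffD2[OF Infinite_Sum.abs_summable_on_Sigma_iff])
qed

text \<open>Stated for a general division algebra because it serves twice: for complex sequences,
  where the total sum gives the symbol of a convolution, and for real sequences of norms, where it
  gives estimates.\<close>

lemma convolution_has_sum:
  fixes f g :: "int \<Rightarrow> 'a::{real_normed_div_algebra,banach}"
  assumes f: "f abs_summable_on UNIV" and g: "g abs_summable_on UNIV"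
  shows "(\<lambda>l'. f (l - l') * g l') summable_on UNIV"
    and "(\<lambda>l. \<Sum>\<^sub>\<infinity>l'. f (l - l') * g l') summable_on UNIV"
    and "(\<Sum>\<^sub>\<infinity>l. \<Sum>\<^sub>\<infinity>l'. f (l - l') * g l') = infsum f UNIV * infsum g UNIV"
proof -
  have s: "(\<lambda>(l', l). f (l - l') * g l') summable_on UNIV \<times> UNIV"
    by (rule abs_summable_summable[OF summable_on_convolution_pairs[OF assms]])
  have s': "(\<lambda>(l, l'). f (l - l') * g l') summable_on UNIV \<times> UNIV"
    using s summable_on_swap[of "\<lambda>(l', l). f (l - l') * g l'" UNIV UNIV] by (simp add: case_prod_unfold)
  show "(\<lambda>l'. f (l - l') * g l') summable_on UNIV"
  proof (rule abs_summable_summable)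
    have "(\<lambda>(l, l'). norm (f (l - l') * g l')) summable_on UNIV \<times> UNIV"
      using summable_on_convolution_pairs[OF assms]
        summable_on_swap[of "\<lambda>(l', l). norm (f (l - l') * g l')" UNIV UNIV] by (simp add: case_prod_unfold)
    then show "(\<lambda>l'. f (l - l') * g l') abs_summable_on UNIV"
      by (rule summable_on_SigmaD1) simp
  qed
  show "(\<lambda>l. \<Sum>\<^sub>\<infinity>l'. f (l - l') * g l') summable_on UNIV"
    using summable_on_Sigma_banach[OF s'] by simp
  have "(\<Sum>\<^sub>\<infinity>l. \<Sum>\<^sub>\<infinity>l'. f (l - l') * g l') = (\<Sum>\<^sub>\<infinity>l'. \<Sum>\<^sub>\<infinity>l. f (l - l') * g l')"
    by (rule infsum_swap_banach[OF s'])
  also have "\<dots> = (\<Sum>\<^sub>\<infinity>l'. infsum f UNIV * g l')"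
    using infsum_cmult_left[of _ "\<lambda>l. f (l - _)" UNIV] abs_summable_summable[OF f]
      summable_on_shift(1)[of f] infsum_shift(1)[of f] by simp
  also have "\<dots> = infsum f UNIV * infsum g UNIV"
    by (rule infsum_cmult_right) (use abs_summable_summable[OF g] in simp)
  finally show "(\<Sum>\<^sub>\<infinity>l. \<Sum>\<^sub>\<infinity>l'. f (l - l') * g l') = infsum f UNIV * infsum g UNIV" .
qed

lemma conv_abs_summable:
  assumes f: "f abs_summable_on UNIV" and g: "g abs_summable_on UNIV"
  shows "(f \<star> g) abs_summable_on UNIV"
    and "(\<Sum>\<^sub>\<infinity>l. norm ((f \<star> g) l)) \<le> (\<Sum>\<^sub>\<infinity>l. norm (f l)) * (\<Sum>\<^sub>\<infinity>l. norm (g l))"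
    and "infsum (f \<star> g) UNIV = infsum f UNIV * infsum g UNIV"
proof -
  let ?f = "\<lambda>l. norm (f l)" and ?g = "\<lambda>l. norm (g l)"
  have f': "?f abs_summable_on UNIV" and g': "?g abs_summable_on UNIV"
    using f g by auto
  note C = convolution_has_sum[OF f' g']
  have le: "norm ((f \<star> g) l) \<le> (\<Sum>\<^sub>\<infinity>l'. ?f (l - l') * ?g l')" for l
  proof -
    have "(\<lambda>l'. f (l - l') * g l') abs_summable_on UNIV"
      using C(1)[of l] by (simp add: norm_mult)
    from norm_infsum_bound[OF this] show ?thesis
      by (simp add: conv_def norm_mult)
  qed
  show s: "(f \<star> g) abs_summable_on UNIV"
    by (rule summable_on_comparison_test[OF C(2)]) (use le in auto)
  show "(\<Sum>\<^sub>\<infinity>l. norm ((f \<star> g) l)) \<le> (\<Sum>\<^sub>\<infinity>l. norm (f l)) * (\<Sum>\<^sub>\<infinity>l. norm (g l))"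
    unfolding C(3)[symmetric] by (rule infsum_mono[OF s C(2)]) (use le in auto)
  show "infsum (f \<star> g) UNIV = infsum f UNIV * infsum g UNIV"
    using convolution_has_sum(3)[OF f g] by (simp add: conv_def)
qed

text \<open>The map from \<open>l\<close> to \<open>r powi l\<close> is a character of the additive
  group of integers, so multiplying by it commutes with convolution. On the unit circle this yields
  symbols, off it exponential weights.\<close>

lemma conv_weighted:
  assumes "r \<noteq> 0"
  shows "(\<lambda>l. (f \<star> g) l * r powi l) = (\<lambda>l. f l * r powi l) \<star> (\<lambda>l. g l * r powi l)"
proof
  fix l
  have "(f \<star> g) l * r powi l = (\<Sum>\<^sub>\<infinity>l'. (f (l - l') * g l') * r powi l)"
    unfolding conv_def using assms by (intro infsum_cmult_left'[symmetric])
  also have "\<dots> = (\<Sum>\<^sub>\<infinity>l'. (f (l - l') * r powi (l - l')) * (g l' * r powi l'))"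
    using assms by (intro infsum_cong) (simp add: power_int_diff)
  finally show "(f \<star> g) l * r powi l = ((\<lambda>l. f l * r powi l) \<star> (\<lambda>l. g l * r powi l)) l"
    by (simp add: conv_def)
qed

section \<open>Convolution powers under exponential weights\<close>

lemma conv_pow_Suc: "n \<ge> 1 \<Longrightarrow> conv_pow a (Suc n) = conv_pow a n \<star> a"
  by (cases n) auto

text \<open>One induction carries all three claims, since the norm bound and the symbol identity
  need the summability of the previous power. Unimodular \<open>r\<close> is used for Fourier
  inversion, real \<open>r\<close> close to 1 for the tails.\<close>

lemma conv_pow_weighted:
  assumes r: "r \<noteq> 0" and a: "(\<lambda>l. a l * r powi l) abs_summable_on UNIV" and n: "n \<ge> 1"
  shows "(\<lambda>l. conv_pow a n l * r powi l) abs_summable_on UNIV"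
    and "(\<Sum>\<^sub>\<infinity>l. norm (conv_pow a n l * r powi l)) \<le> (\<Sum>\<^sub>\<infinity>l. norm (a l * r powi l)) ^ n"
    and "symbol (conv_pow a n) r = symbol a r ^ n"
proof -
  have "(\<lambda>l. conv_pow a n l * r powi l) abs_summable_on UNIV
    \<and> (\<Sum>\<^sub>\<infinity>l. norm (conv_pow a n l * r powi l)) \<le> (\<Sum>\<^sub>\<infinity>l. norm (a l * r powi l)) ^ n
    \<and> symbol (conv_pow a n) r = symbol a r ^ n"
    using n
  proof (induction n rule: nat_induct_at_least)
    case base
    then show ?case using a by (auto simp: symbol_def)
  next
    case (Suc n)
    have eq: "(\<lambda>l. conv_pow a (Suc n) l * r powi l) =
       (\<lambda>l. conv_pow a n l * r powi l) \<star> (\<lambda>l. a l * r powi l)"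
      unfolding conv_pow_Suc[OF Suc(1)] by (rule conv_weighted[OF r])
    have IH: "(\<lambda>l. conv_pow a n l * r powi l) abs_summable_on UNIV"
      "(\<Sum>\<^sub>\<infinity>l. norm (conv_pow a n l * r powi l)) \<le> (\<Sum>\<^sub>\<infinity>l. norm (a l * r powi l)) ^ n"
      "symbol (conv_pow a n) r = symbol a r ^ n"
      using Suc by simp_all
    have "(\<Sum>\<^sub>\<infinity>l. norm (conv_pow a (Suc n) l * r powi l)) \<le>
      (\<Sum>\<^sub>\<infinity>l. norm (conv_pow a n l * r powi l)) * (\<Sum>\<^sub>\<infinity>l. norm (a l * r powi l))"
      by (rule conv_abs_summable(2)[OF IH(1) a, folded eq])
    also have "\<dots> \<le> (\<Sum>\<^sub>\<infinity>l. norm (a l * r powi l)) ^ n * (\<Sum>\<^sub>\<infinity>l. norm (a l * r powi l))"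
      by (intro mult_right_mono IH(2) infsum_nonneg) auto
    finally have "(\<Sum>\<^sub>\<infinity>l. norm (conv_pow a (Suc n) l * r powi l)) \<le> (\<Sum>\<^sub>\<infinity>l. norm (a l * r powi l)) ^ Suc n"
      by (simp add: mult.commute)
    moreover have "(\<lambda>l. conv_pow a (Suc n) l * r powi l) abs_summable_on UNIV"
      by (rule conv_abs_summable(1)[OF IH(1) a, folded eq])
    moreover have "symbol (conv_pow a (Suc n)) r = infsum (\<lambda>l. conv_pow a n l * r powi l) UNIV
        * infsum (\<lambda>l. a l * r powi l) UNIV"
      unfolding symbol_def eq by (rule conv_abs_summable(3)[OF IH(1) a])
    then have "symbol (conv_pow a (Suc n)) r = symbol a r ^ Suc n"
      using IH(3) by (simp add: symbol_def mult.commute)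
    ultimately show ?case by blast
  qed
  then show "(\<lambda>l. conv_pow a n l * r powi l) abs_summable_on UNIV"
    "(\<Sum>\<^sub>\<infinity>l. norm (conv_pow a n l * r powi l)) \<le> (\<Sum>\<^sub>\<infinity>l. norm (a l * r powi l)) ^ n"
    "symbol (conv_pow a n) r = symbol a r ^ n" by blast+
qed

text \<open>Convexity of the power gives the tangent inequality on the open half-line; the boundary
  cases are separate. For \<open>x = 0\<close> the left side is (1 - p) * y^p, and for
  \<open>y = 0\<close> it vanishes, also at \<open>p = 1\<close>, because \<open>0 powr 0\<close> is
  0.\<close>

lemma powr_above_tangent:
  fixes p x y :: real
  assumes p: "1 \<le> p" and "0 \<le> x" "0 \<le> y"
  shows "y powr p + p * y powr (p - 1) * (x - y) \<le> x powr p"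
proof -
  consider "y = 0" | "y > 0" "x = 0" | "y > 0" "x > 0"
    using assms by linarith
  then show ?thesis
  proof cases
    case 2
    have "y powr (p - 1) * y = y powr p" using 2 by (simp add: powr_diff)
    then have "y powr p + p * y powr (p - 1) * (x - y) = (1 - p) * y powr p"
      using 2 by (simp add: algebra_simps)
    also have "\<dots> \<le> 0" using p by (simp add: mult_nonpos_nonneg)
    finally show ?thesis using 2 by simp
  next
    case 3
    have "(p * y powr (p - 1)) * (x - y) \<le> x powr p - y powr p"
    proof (rule convex_on_imp_above_tangent[of "{0<..}" "\<lambda>x. x powr p"])
      show "convex_on {0<..} (\<lambda>x. x powr p)" by (rule powr_convex[OF p])
      show "((\<lambda>x. x powr p) has_real_derivative p * y powr (p - 1)) (at y within {0<..})"
        by (rule has_field_derivative_at_within[OF has_real_derivative_powr]) (use 3 in auto)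
    qed (use 3 in \<open>auto simp: interior_open\<close>)
    then show ?thesis by simp
  qed simp
qed

text \<open>This gives pointwise meaning to the convolution for every exponent, since each l^p
  sequence is bounded. It is also the case of Young's inequality with infinite exponent.\<close>

lemma bounded_imp_conv_summable:
  assumes b: "b abs_summable_on UNIV" and u: "\<And>l. norm (u l :: complex) \<le> U"
  shows "(\<lambda>l'. b (l - l') * u l') abs_summable_on UNIV"
    and "norm ((b \<star> u) l) \<le> (\<Sum>\<^sub>\<infinity>l. norm (b l)) * U"
proof -
  have s: "(\<lambda>l'. norm (b (l - l')) * U) summable_on UNIV"
    by (rule summable_on_cmult_left) (use b summable_on_shift(2)[of "\<lambda>l. norm (b l)"] in simp)
  show s1: "(\<lambda>l'. b (l - l') * u l') abs_summable_on UNIV"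
    by (rule summable_on_comparison_test[OF s]) (auto simp: norm_mult intro!: mult_left_mono u)
  have "norm ((b \<star> u) l) \<le> (\<Sum>\<^sub>\<infinity>l'. norm (b (l - l') * u l'))"
    unfolding conv_def by (rule norm_infsum_bound[OF s1])
  also have "\<dots> \<le> (\<Sum>\<^sub>\<infinity>l'. norm (b (l - l')) * U)"
    by (rule infsum_mono[OF s1 s]) (auto simp: norm_mult intro!: mult_left_mono u)
  also have "\<dots> = (\<Sum>\<^sub>\<infinity>l. norm (b l)) * U"
    using infsum_cmult_left'[of "\<lambda>l'. norm (b (l - l'))" U UNIV] infsum_shift(2)[of "\<lambda>l. norm (b l)" l]
    by simp
  finally show "norm ((b \<star> u) l) \<le> (\<Sum>\<^sub>\<infinity>l. norm (b l)) * U" .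
qed

lemma powr_summable_imp_bounded:
  fixes u :: "int \<Rightarrow> complex" and p :: real
  assumes p: "1 \<le> p" and u: "(\<lambda>l. norm (u l) powr p) summable_on UNIV"
  shows "norm (u l) \<le> (\<Sum>\<^sub>\<infinity>l. norm (u l) powr p) powr (1 / p)"
proof -
  have "(\<Sum>l\<in>{l}. norm (u l) powr p) \<le> (\<Sum>\<^sub>\<infinity>l. norm (u l) powr p)"
    by (rule finite_sum_le_infsum[OF u]) auto
  then have "(norm (u l) powr p) powr (1 / p) \<le> (\<Sum>\<^sub>\<infinity>l. norm (u l) powr p) powr (1 / p)"
    using p by (intro powr_mono2) auto
  then show ?thesis using p by (simp add: powr_powr)
qed

text \<open>Jensen's inequality for the weights \<open>norm (b (l - l')) / B\<close> is obtained by summing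
  the tangent inequality of \<open>x powr p\<close> at the weighted mean.\<close>

lemma young_powr:
  fixes p :: real
  assumes b: "b abs_summable_on UNIV" and p: "1 \<le> p"
    and u: "(\<lambda>l. norm (u l :: complex) powr p) summable_on UNIV"
  defines "B \<equiv> \<Sum>\<^sub>\<infinity>l. norm (b l)"
  shows "(\<lambda>l. norm ((b \<star> u) l) powr p) summable_on UNIV"
    and "(\<Sum>\<^sub>\<infinity>l. norm ((b \<star> u) l) powr p) \<le> B powr p * (\<Sum>\<^sub>\<infinity>l. norm (u l) powr p)"
proof -
  define U where "U = (\<Sum>\<^sub>\<infinity>l. norm (u l) powr p) powr (1 / p)"
  have U: "norm (u l) \<le> U" for l
    unfolding U_def by (rule powr_summable_imp_bounded[OF p u])
  have B0: "B \<ge> 0" unfolding B_def by (rule infsum_nonneg) auto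
  define G where "G = (\<lambda>l. \<Sum>\<^sub>\<infinity>l'. norm (b (l - l')) * norm (u l') powr p)"
  have b': "(\<lambda>l. norm (b l)) abs_summable_on UNIV" using b by simp
  have u': "(\<lambda>l. norm (u l) powr p) abs_summable_on UNIV" using u by simp
  note C = convolution_has_sum[OF b' u']
  have sw: "(\<lambda>l'. norm (b (l - l'))) summable_on UNIV" for l
    using b summable_on_shift(2)[of "\<lambda>l. norm (b l)" l] by simp
  have iw: "(\<Sum>\<^sub>\<infinity>l'. norm (b (l - l'))) = B" for l
    unfolding B_def by (rule infsum_shift(2))
  have key: "norm ((b \<star> u) l) powr p \<le> B powr (p - 1) * G l" for l
  proof (cases "B = 0")
    case True
    have "norm ((b \<star> u) l) \<le> B * U"
      unfolding B_def by (rule bounded_imp_conv_summable(2)[OF b U])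
    then show ?thesis using True by simp
  next
    case False
    then have Bp: "B > 0" using B0 by simp
    define y where "y = (\<Sum>\<^sub>\<infinity>l'. norm (b (l - l') * u l'))"
    have sy: "(\<lambda>l'. norm (b (l - l')) * norm (u l')) summable_on UNIV"
      using bounded_imp_conv_summable(1)[OF b U, of l] by (simp add: norm_mult)
    have y0: "y \<ge> 0" unfolding y_def by (rule infsum_nonneg) auto
    \<comment> \<open>The tangent point is the weighted mean of \<open>norm (u l')\<close>. There
      the linear terms cancel after summation, which leaves \<open>B * m powr p\<close>.\<close>
    define m where "m = y / B"
    have m0: "m \<ge> 0" using y0 Bp by (simp add: m_def)
    have s1: "(\<lambda>l'. norm (b (l - l')) * (m powr p - p * m powr (p - 1) * m)) summable_on UNIV"
      by (intro summable_on_cmult_left sw)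
    have s2: "(\<lambda>l'. (norm (b (l - l')) * norm (u l')) * (p * m powr (p - 1))) summable_on UNIV"
      by (intro summable_on_cmult_left sy)
    have s3: "(\<lambda>l'. norm (b (l - l')) * norm (u l') powr p) summable_on UNIV"
      using C(1)[of l] by simp
    have "(\<Sum>\<^sub>\<infinity>l'. norm (b (l - l')) * (m powr p - p * m powr (p - 1) * m)
        + (norm (b (l - l')) * norm (u l')) * (p * m powr (p - 1))) \<le> G l"
      unfolding G_def
    proof (rule infsum_mono[OF summable_on_add[OF s1 s2] s3])
      fix l'
      have "norm (b (l - l')) * (m powr p + p * m powr (p - 1) * (norm (u l') - m))
        \<le> norm (b (l - l')) * norm (u l') powr p"
        by (intro mult_left_mono powr_above_tangent p m0) auto
      then show "norm (b (l - l')) * (m powr p - p * m powr (p - 1) * m)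
        + (norm (b (l - l')) * norm (u l')) * (p * m powr (p - 1))
        \<le> norm (b (l - l')) * norm (u l') powr p" by (simp add: algebra_simps)
    qed
    also have "(\<Sum>\<^sub>\<infinity>l'. norm (b (l - l')) * (m powr p - p * m powr (p - 1) * m)
        + (norm (b (l - l')) * norm (u l')) * (p * m powr (p - 1)))
        = B * (m powr p - p * m powr (p - 1) * m) + y * (p * m powr (p - 1))"
      using infsum_add[OF s1 s2] infsum_cmult_left'[of "\<lambda>l'. norm (b (l - l'))" _ UNIV]
        infsum_cmult_left'[of "\<lambda>l'. norm (b (l - l')) * norm (u l')" _ UNIV]
      by (simp add: iw y_def norm_mult)
    also have "\<dots> = B * m powr p" using Bp by (simp add: m_def algebra_simps)
    finally have 1: "B * m powr p \<le> G l" .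
    have "norm ((b \<star> u) l) \<le> y"
      unfolding conv_def y_def by (rule norm_infsum_bound) (use bounded_imp_conv_summable(1)[OF b U, of l] in simp)
    then have "norm ((b \<star> u) l) powr p \<le> (B * m) powr p"
      using p Bp by (intro powr_mono2) (auto simp: m_def)
    also have "\<dots> = B powr (p - 1) * (B * m powr p)"
      using Bp m0 by (simp add: powr_mult powr_diff)
    also have "\<dots> \<le> B powr (p - 1) * G l"
      by (intro mult_left_mono 1) auto
    finally show ?thesis .
  qed
  have sG: "(\<lambda>l. B powr (p - 1) * G l) summable_on UNIV"
    by (intro summable_on_cmult_right) (use C(2) in \<open>simp add: G_def\<close>)
  show s: "(\<lambda>l. norm ((b \<star> u) l) powr p) summable_on UNIV"
    by (rule summable_on_comparison_test[OF sG]) (use key in auto)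
  have "(\<Sum>\<^sub>\<infinity>l. norm ((b \<star> u) l) powr p) \<le> (\<Sum>\<^sub>\<infinity>l. B powr (p - 1) * G l)"
    by (rule infsum_mono[OF s sG]) (use key in auto)
  also have "\<dots> = B powr (p - 1) * (B * (\<Sum>\<^sub>\<infinity>l. norm (u l) powr p))"
    using C(3) infsum_cmult_right'[of _ G UNIV] by (simp add: G_def B_def)
  also have "\<dots> = B powr p * (\<Sum>\<^sub>\<infinity>l. norm (u l) powr p)"
    using B0 p by (cases "B = 0") (auto simp: powr_diff)
  finally show "(\<Sum>\<^sub>\<infinity>l. norm ((b \<star> u) l) powr p) \<le> B powr p * (\<Sum>\<^sub>\<infinity>l. norm (u l) powr p)" .
qed

section \<open>Young's inequality for all exponents, including infinity\<close>

lemma lp_bounded: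
  assumes "1 \<le> p" and "u \<in> lp p"
  obtains U where "\<And>l. norm (u l) \<le> U"
proof (cases "p = \<infinity>")
  case True
  then show ?thesis using assms that by (auto simp: lp_def bounded_iff)
next
  case False
  then have "1 \<le> real_of_ereal p" using assms(1) by (cases p) auto
  then show ?thesis using powr_summable_imp_bounded[of "real_of_ereal p" u] assms that False
    by (auto simp: lp_def)
qed

lemma young_lp:
  assumes b: "b abs_summable_on UNIV" and p: "1 \<le> p" and u: "u \<in> lp p"
  shows "b \<star> u \<in> lp p"
    and "lp_norm p (b \<star> u) \<le> (\<Sum>\<^sub>\<infinity>l. norm (b l)) * lp_norm p u"
proof -
  have B0: "(\<Sum>\<^sub>\<infinity>l. norm (b l)) \<ge> 0" by (rule infsum_nonneg) auto
  have "b \<star> u \<in> lp p \<and> lp_norm p (b \<star> u) \<le> (\<Sum>\<^sub>\<infinity>l. norm (b l)) * lp_norm p u"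
  proof (cases "p = \<infinity>")
    case True
    have bd: "bdd_above (range (\<lambda>l. norm (u l)))"
      using u True by (auto simp: lp_def bounded_iff bdd_above_def)
    have "norm (u l) \<le> (SUP l. norm (u l))" for l
      by (rule cSUP_upper[OF _ bd]) auto
    note B = bounded_imp_conv_summable(2)[OF b, of u, OF this]
    have "\<exists>a. \<forall>x. cmod ((b \<star> u) x) \<le> a" using B by blast
    then show ?thesis using True B
      by (auto simp: lp_def lp_norm_def bounded_iff intro!: cSUP_least)
  next
    case False
    then obtain q where q: "p = ereal q" "1 \<le> q" using p by (cases p) auto
    have uq: "(\<lambda>l. norm (u l) powr q) summable_on UNIV" using u q by (simp add: lp_def)
    note Y = young_powr[OF b q(2) uq]
    have U0: "(\<Sum>\<^sub>\<infinity>l. norm (u l) powr q) \<ge> 0" by (rule infsum_nonneg) auto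
    have "(\<Sum>\<^sub>\<infinity>l. norm ((b \<star> u) l) powr q) powr (1 / q)
      \<le> ((\<Sum>\<^sub>\<infinity>l. norm (b l)) powr q * (\<Sum>\<^sub>\<infinity>l. norm (u l) powr q)) powr (1 / q)"
      using Y(2) q by (intro powr_mono2 infsum_nonneg) auto
    also have "\<dots> = (\<Sum>\<^sub>\<infinity>l. norm (b l)) * (\<Sum>\<^sub>\<infinity>l. norm (u l) powr q) powr (1 / q)"
      using q B0 U0 by (simp add: powr_mult powr_powr)
    finally show ?thesis using q Y(1) by (simp add: lp_def lp_norm_def)
  qed
  then show "b \<star> u \<in> lp p" "lp_norm p (b \<star> u) \<le> (\<Sum>\<^sub>\<infinity>l. norm (b l)) * lp_norm p u" by auto
qed

lemma symbol_norm_le: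
  assumes b: "b abs_summable_on UNIV" and z: "norm z = 1"
  shows "norm (symbol b z) \<le> (\<Sum>\<^sub>\<infinity>l. norm (b l))"
    and "(\<lambda>l. b l * z powi l) abs_summable_on UNIV"
proof -
  show s: "(\<lambda>l. b l * z powi l) abs_summable_on UNIV"
    using b z by (simp add: norm_mult norm_power_int)
  show "norm (symbol b z) \<le> (\<Sum>\<^sub>\<infinity>l. norm (b l))"
    unfolding symbol_def using norm_infsum_bound[OF s] z by (simp add: norm_mult norm_power_int)
qed

section \<open>Fourier coefficients\<close>

lemma integral_cis_int:
  "((\<lambda>t. cis (of_int j * t)) has_integral (if j = 0 then 2 * pi else 0)) {c..c + 2 * pi}"
proof (cases "j = 0")
  case True
  then show ?thesis
    using has_integral_const_real[of "1::complex" c "c + 2 * pi"] by (simp add: scaleR_conv_of_real)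
next
  case False
  let ?F = "\<lambda>t. cis (of_int j * t) / (\<i> * of_int j)"
  have "((\<lambda>t. cis (of_int j * t)) has_integral ?F (c + 2 * pi) - ?F c) {c..c + 2 * pi}"
  proof (rule fundamental_theorem_of_calculus)
    fix t assume "t \<in> {c..c + 2 * pi}"
    have "((\<lambda>x. exp (\<i> * of_int j * of_real x) / (\<i> * of_int j)) has_vector_derivative
       exp (\<i> * of_int j * of_real t) * (\<i> * of_int j) / (\<i> * of_int j)) (at t within {c..c + 2 * pi})"
      by (rule has_vector_derivative_real_field) (auto intro!: derivative_eq_intros)
    then show "(?F has_vector_derivative cis (of_int j * t)) (at t within {c..c + 2 * pi})"
      using False by (simp add: cis_conv_exp mult_ac)
  qed simp
  moreover have "cis (of_int j * (c + 2 * pi)) = cis (of_int j * c)"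
    using cis_multiple_2pi[of "of_int j"] by (simp add: ring_distribs mult_ac flip: cis_mult)
  ultimately show ?thesis using False by simp
qed

text \<open>Orthogonality is exact for a finite partial sum, and the symbol of the remaining tail is
  uniformly small because the tail has small l^1 norm. The start \<open>c\<close> of the period is
  left free, as the circle is later cut at a point that is not a maximum point.\<close>

lemma fourier_coefficient:
  fixes b :: "int \<Rightarrow> complex"
  assumes b: "b abs_summable_on UNIV" and cont: "continuous_on UNIV (\<lambda>t. symbol b (cis t))"
  shows "((\<lambda>t. symbol b (cis t) * cis (- of_int l * t)) has_integral 2 * pi * b l) {c..c + 2 * pi}"
proof -
  let ?f = "\<lambda>t. symbol b (cis t) * cis (- of_int l * t)"
  have int: "?f integrable_on {c..c + 2 * pi}"
    by (intro integrable_continuous_real continuous_intros continuous_on_subset[OF cont]) auto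
  have "norm (integral {c..c + 2 * pi} ?f - 2 * pi * b l) \<le> 0 + \<epsilon>" if "\<epsilon> > 0" for \<epsilon>
  proof -
    \<comment> \<open>The integral runs over an interval of length 2 * pi, so a uniform error
      \<delta> integrates to \<epsilon>.\<close>
    define \<delta> where "\<delta> = \<epsilon> / (2 * pi)"
    have \<delta>: "\<delta> > 0" using that by (simp add: \<delta>_def)
    from tendstoD[OF has_sum_infsum[OF b, unfolded has_sum_def] \<delta>]
    obtain A where A: "finite A"
      and A2: "\<And>B. finite B \<Longrightarrow> A \<subseteq> B \<Longrightarrow> dist (\<Sum>l\<in>B. norm (b l)) (\<Sum>\<^sub>\<infinity>l. norm (b l)) < \<delta>"
      unfolding eventually_finite_subsets_at_top by auto
    \<comment> \<open>Including \<open>l\<close> makes the finite part contain the coefficient that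
      is to be extracted.\<close>
    let ?B = "insert l A"
    have B: "finite ?B" using A by simp
    define tail where "tail = (\<lambda>j. if j \<in> ?B then 0 else b j)"
    have tail: "tail abs_summable_on UNIV"
      by (rule summable_on_comparison_test[OF b]) (auto simp: tail_def)
    have "(\<Sum>\<^sub>\<infinity>j. norm (tail j)) = (\<Sum>\<^sub>\<infinity>j\<in>UNIV - ?B. norm (b j))"
      by (rule infsum_cong_neutral) (auto simp: tail_def)
    also have "\<dots> = (\<Sum>\<^sub>\<infinity>j. norm (b j)) - (\<Sum>\<^sub>\<infinity>j\<in>?B. norm (b j))"
      by (rule infsum_Diff[OF b summable_on_subset_banach[OF b]]) auto
    also have "\<dots> \<le> \<delta>" using A2[OF B subset_insertI] B unfolding dist_real_def by (simp only: infsum_finite)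
    finally have tail_le: "(\<Sum>\<^sub>\<infinity>j. norm (tail j)) \<le> \<delta>" .
    have split: "symbol b z = (\<Sum>j\<in>?B. b j * z powi j) + symbol tail z" if z: "norm z = 1" for z
    proof -
      note s = abs_summable_summable[OF symbol_norm_le(2)[OF b z]]
      have "symbol tail z = (\<Sum>\<^sub>\<infinity>j\<in>UNIV - ?B. b j * z powi j)"
        unfolding symbol_def by (rule infsum_cong_neutral) (auto simp: tail_def)
      also have "\<dots> = symbol b z - (\<Sum>\<^sub>\<infinity>j\<in>?B. b j * z powi j)"
        unfolding symbol_def by (rule infsum_Diff[OF s summable_on_subset_banach[OF s]]) auto
      finally show ?thesis using B by simp
    qed
    let ?g = "\<lambda>t. (\<Sum>j\<in>?B. b j * cis (of_int (j - l) * t))"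
    have "(?g has_integral (\<Sum>j\<in>?B. b j * (if j - l = 0 then 2 * pi else 0))) {c..c + 2 * pi}"
      by (intro has_integral_sum B has_integral_mult_right integral_cis_int)
    also have "(\<Sum>j\<in>?B. b j * (if j - l = 0 then 2 * pi else 0)) = (\<Sum>j\<in>?B. if j = l then 2 * pi * b l else 0)"
      by (intro sum.cong) auto
    also have "\<dots> = 2 * pi * b l"
      using B by (subst sum.delta) auto
    finally have g: "(?g has_integral 2 * pi * b l) {c..c + 2 * pi}" .
    have "((\<lambda>t. ?f t - ?g t) has_integral integral {c..c + 2 * pi} ?f - 2 * pi * b l) (cbox c (c + 2 * pi))"
      using has_integral_diff[OF integrable_integral[OF int] g] by simp
    then have "norm (integral {c..c + 2 * pi} ?f - 2 * pi * b l) \<le> \<delta> * measure lborel (cbox c (c + 2 * pi))"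
    proof (rule has_integral_bound[rotated])
      fix t
      have "?f t - ?g t = symbol tail (cis t) * cis (- of_int l * t)"
        by (simp add: split cis_power_int ring_distribs sum_distrib_right mult.assoc cis_mult del: sum.insert)
      then show "norm (?f t - ?g t) \<le> \<delta>"
        using symbol_norm_le(1)[OF tail, of "cis t"] tail_le by (simp add: norm_mult)
    qed (use \<delta> in auto)
    then show ?thesis by (simp add: \<delta>_def)
  qed
  then have "norm (integral {c..c + 2 * pi} ?f - 2 * pi * b l) \<le> 0" by (rule field_le_epsilon)
  then have "integral {c..c + 2 * pi} ?f = 2 * pi * b l" by simp
  with integrable_integral[OF int] show ?thesis by simp
qed

text \<open>Comparison with the two-sided geometric series of ratio exp (- 1 / N). The constant is
  uniform in \<open>y\<close>: the series is at most 2 / (1 - q), hence at most 2 * (N + 1) and at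
  most 4 * N, and recentring costs the factor \<open>exp 1\<close>, which is at most 3.\<close>

lemma exp_abs_int_has_sum:
  fixes y N :: real
  assumes N: "N \<ge> 1"
  shows "(\<lambda>l::int. exp (- \<bar>of_int l - y\<bar> / N)) summable_on UNIV"
    and "(\<Sum>\<^sub>\<infinity>l::int. exp (- \<bar>of_int l - y\<bar> / N)) \<le> 12 * N"
proof -
  define q where "q = exp (- 1 / N)"
  have q: "0 < q" "q < 1" using N by (auto simp: q_def)
  let ?g = "\<lambda>l::int. q powr \<bar>of_int l\<bar>"
  have geo: "((\<lambda>n. q ^ n) has_sum 1 / (1 - q)) UNIV"
    using q by (intro norm_summable_imp_has_sum geometric_sums) (auto simp: norm_power intro!: summable_geometric)
  have "(?g has_sum 1 / (1 - q)) (range int)"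
    using geo q by (subst has_sum_reindex) (auto simp: o_def powr_realpow)
  moreover have "((\<lambda>n. q * q ^ n) has_sum q * (1 / (1 - q))) UNIV"
    by (rule has_sum_cmult_right[OF geo])
  then have "(?g has_sum q * (1 / (1 - q))) ((\<lambda>n. - int (Suc n)) ` UNIV)"
    using q by (subst has_sum_reindex) (auto simp: o_def inj_on_def powr_add powr_realpow mult.commute)
  ultimately have "(?g has_sum 1 / (1 - q) + q * (1 / (1 - q))) (range int \<union> range (\<lambda>n. - int (Suc n)))"
    by (rule has_sum_Un_disjoint) auto
  also have "range int \<union> range (\<lambda>n. - int (Suc n)) = UNIV"
  proof -
    have "l \<in> range int \<union> range (\<lambda>n. - int (Suc n))" for l
      by (cases l rule: int_cases) auto
    then show ?thesis by blast
  qed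
  finally have g: "(?g has_sum 1 / (1 - q) + q * (1 / (1 - q))) UNIV" .
  let ?h = "\<lambda>l::int. exp 1 * ?g (l - \<lfloor>y\<rfloor>)"
  have sh: "?h summable_on UNIV"
    using has_sum_imp_summable[OF g] summable_on_shift(1)[of ?g] by (intro summable_on_cmult_right) auto
  \<comment> \<open>Replacing \<open>y\<close> by its floor changes the distance by at most 1, and
    \<open>1 / N\<close> is at most 1; this is the origin of \<open>exp 1\<close>.\<close>
  have le: "exp (- \<bar>of_int l - y\<bar> / N) \<le> ?h l" for l
  proof -
    have "\<bar>real_of_int (l - \<lfloor>y\<rfloor>)\<bar> \<le> \<bar>of_int l - y\<bar> + 1" by linarith
    then have "\<bar>real_of_int (l - \<lfloor>y\<rfloor>)\<bar> / N \<le> (\<bar>of_int l - y\<bar> + 1) / N"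
      using N by (intro divide_right_mono) auto
    moreover have "1 / N \<le> 1" using N by simp
    ultimately have "- \<bar>of_int l - y\<bar> / N \<le> 1 - \<bar>real_of_int (l - \<lfloor>y\<rfloor>)\<bar> / N"
      by (simp add: add_divide_distrib)
    then show ?thesis
      by (simp add: q_def powr_def flip: exp_add)
  qed
  show s: "(\<lambda>l::int. exp (- \<bar>of_int l - y\<bar> / N)) summable_on UNIV"
    by (rule summable_on_comparison_test[OF sh]) (use le in auto)
  have "(\<Sum>\<^sub>\<infinity>l::int. exp (- \<bar>of_int l - y\<bar> / N)) \<le> infsum ?h UNIV"
    by (rule infsum_mono[OF s sh le])
  also have "infsum ?h UNIV = exp 1 * infsum ?g UNIV"
    using infsum_shift(1)[of ?g] by (subst infsum_cmult_right') auto
  also have "infsum ?g UNIV = (1 + q) / (1 - q)"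
    using infsumI[OF g] by (simp add: add_divide_distrib)
  also have "\<dots> \<le> 2 / (1 - q)" using q by (intro divide_right_mono) auto
  also have "\<dots> \<le> 4 * N"
  proof -
    have "1 + 1 / N \<le> exp (1 / N)" by (rule exp_ge_add_one_self)
    then have "q \<le> 1 / (1 + 1 / N)"
      using N by (simp add: q_def exp_minus inverse_eq_divide divide_left_mono add_pos_pos)
    also have "\<dots> = 1 - 1 / (N + 1)" using N by (simp add: field_simps)
    finally have "1 / (N + 1) \<le> 1 - q" by simp
    then have "2 / (1 - q) \<le> 2 / (1 / (N + 1))" using N q by (intro divide_left_mono) auto
    then show ?thesis using N by simp
  qed
  also have "exp 1 * (4 * N) \<le> 3 * (4 * N)"
    using N by (intro mult_right_mono exp_le) simp
  finally show "(\<Sum>\<^sub>\<infinity>l::int. exp (- \<bar>of_int l - y\<bar> / N)) \<le> 12 * N" by simp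
qed

section \<open>Cumulants\<close>

text \<open>If the lowest nonzero term had degree d < N, then f would be asymptotic to a multiple of
  z^d, so z^d would be O(z^N) and thus o(z^d), which is absurd.\<close>

lemma bigo_imp_fps_nth_eq_0:
  fixes f :: "complex \<Rightarrow> complex"
  assumes f: "f has_fps_expansion C" and O: "f \<in> O[at 0](\<lambda>z. z ^ N)" and "\<nu> < N"
  shows "fps_nth C \<nu> = 0"
proof (rule ccontr)
  assume nz: "fps_nth C \<nu> \<noteq> 0"
  define d where "d = subdegree C"
  have "d < N" using subdegree_leI[OF nz] \<open>\<nu> < N\<close> by (simp add: d_def)
  have c: "fps_nth C d \<noteq> 0" using nz by (auto simp: d_def)
  have "f \<sim>[at 0] (\<lambda>z. fps_nth C d * z ^ d)"
    using has_laurent_expansion_imp_asymp_equiv_0[OF has_laurent_expansion_fps[OF f]]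
    by (simp add: fls_subdegree_fls_to_fps d_def)
  then have "(\<lambda>z. fps_nth C d * z ^ d) \<in> O[at 0](f)"
    by (rule asymp_equiv_imp_bigo[OF asymp_equiv_symI])
  then have "(\<lambda>z::complex. z ^ d) \<in> O[at 0](\<lambda>z. z ^ N)"
    using c landau_o.big_trans[OF _ O] by simp
  also have "(\<lambda>z::complex. z ^ N) \<in> o[at 0](\<lambda>z. z ^ d)"
  proof (rule smalloI_tendsto)
    have "((\<lambda>z::complex. z ^ (N - d)) \<longlongrightarrow> 0 ^ (N - d)) (at 0)" by (intro tendsto_intros)
    then have "((\<lambda>z::complex. z ^ (N - d)) \<longlongrightarrow> 0) (at 0)" using \<open>d < N\<close> by (simp only: zero_power zero_less_diff)
    moreover have "\<forall>\<^sub>F z::complex in at 0. z ^ (N - d) = z ^ N / z ^ d"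
      using \<open>d < N\<close> by (auto simp: eventually_at_filter power_diff)
    ultimately show "((\<lambda>z::complex. z ^ N / z ^ d) \<longlongrightarrow> 0) (at 0)"
      by (rule Lim_transform_eventually)
    show "\<forall>\<^sub>F z::complex in at 0. z ^ d \<noteq> 0"
      by (rule eventually_mono[OF eventually_neq_at_within[of 0]]) simp
  qed
  finally have "\<forall>\<^sub>F z::complex in at 0. z ^ d = 0" by (simp only: landau_o.small_refl_iff)
  moreover have "\<forall>\<^sub>F z::complex in at 0. z ^ d \<noteq> 0"
    by (rule eventually_mono[OF eventually_neq_at_within[of 0]]) simp
  ultimately have "\<forall>\<^sub>F z::complex in at 0. False" by eventually_elim simp
  then show False by simp
qed

text \<open>Since \<open>cumulants\<close> is a definite description, its defining property becomes
  available only after existence and uniqueness. Existence comes from a logarithm of the normalised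
  symbol; uniqueness holds because the exponents vanish at 0, which excludes jumps by multiples of 2
  * pi * \<i>.\<close>

lemma cumulants_expansion:
  fixes F :: "complex \<Rightarrow> complex" and \<alpha> :: real and \<mu> :: nat
  assumes \<mu>: "\<mu> \<ge> 1" and hol: "F holomorphic_on U" "open U" "\<kappa> \<in> U" and nz: "F \<kappa> \<noteq> 0"
    and R: "R \<in> O[at 0](\<lambda>\<xi>. \<xi> ^ (2 * \<mu> + 1))"
    and ev: "\<forall>\<^sub>F \<xi> in at 0. F (\<kappa> * exp (\<i> * \<xi>)) =
        F \<kappa> * exp (\<i> * \<alpha> * \<xi> - \<beta> * \<xi> ^ (2 * \<mu>) + R \<xi>)"
  defines "\<gamma> \<equiv> cumulants F \<kappa> \<alpha> \<beta> \<mu>"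
  shows "\<forall>\<nu>\<le>2 * \<mu>. \<gamma> \<nu> = 0"
    and "\<exists>r>0. \<forall>\<xi>. norm \<xi> < r \<longrightarrow>
        summable (\<lambda>\<nu>. \<gamma> \<nu> / fact \<nu> * (\<i> * \<xi>) ^ \<nu>) \<and>
        F (\<kappa> * exp (\<i> * \<xi>)) =
          F \<kappa> * exp (\<i> * \<alpha> * \<xi> - \<beta> * \<xi> ^ (2 * \<mu>) + (\<Sum>\<nu>. \<gamma> \<nu> / fact \<nu> * (\<i> * \<xi>) ^ \<nu>))"
proof -
  let ?E = "\<lambda>\<xi>. \<i> * \<alpha> * \<xi> - \<beta> * \<xi> ^ (2 * \<mu>)"
  define Q where "Q = (\<lambda>\<gamma> r. \<forall>\<xi>. norm \<xi> < r \<longrightarrow>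
        summable (\<lambda>\<nu>. \<gamma> \<nu> / fact \<nu> * (\<i> * \<xi>) ^ \<nu>) \<and>
        F (\<kappa> * exp (\<i> * \<xi>)) = F \<kappa> * exp (?E \<xi> + (\<Sum>\<nu>. \<gamma> \<nu> / fact \<nu> * (\<i> * \<xi>) ^ \<nu>)))"
  have QD: "summable (\<lambda>\<nu>. g \<nu> / fact \<nu> * (\<i> * \<xi>) ^ \<nu>)"
    "F (\<kappa> * exp (\<i> * \<xi>)) = F \<kappa> * exp (?E \<xi> + (\<Sum>\<nu>. g \<nu> / fact \<nu> * (\<i> * \<xi>) ^ \<nu>))"
    if "Q g r" "norm \<xi> < r" for g r \<xi>
    using that unfolding Q_def by blast+
  let ?P = "\<lambda>\<gamma>. (\<forall>\<nu>\<le>2 * \<mu>. \<gamma> \<nu> = 0) \<and> (\<exists>r>0. Q \<gamma> r)"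
  \<comment> \<open>Two exponents of the same function that both vanish at \<open>0\<close> agree near \<open>0\<close>.\<close>
  have exp_eqD: "\<forall>\<^sub>F \<xi> in at 0. A \<xi> = B \<xi>"
    if "\<forall>\<^sub>F \<xi> in at 0. exp (A \<xi>) = exp (B \<xi>)" "(A \<longlongrightarrow> 0) (at 0)" "(B \<longlongrightarrow> 0) (at 0)"
    for A B :: "complex \<Rightarrow> complex"
  proof -
    have "\<forall>\<^sub>F \<xi> in at 0. norm (A \<xi>) < 1" "\<forall>\<^sub>F \<xi> in at 0. norm (B \<xi>) < 1"
      using that(2,3) by (auto dest!: tendstoD[where e = 1] simp: dist_norm)
    with that(1) show ?thesis
    proof eventually_elim
      case (elim \<xi>)
      have "\<bar>Im (A \<xi>)\<bar> < 1" "\<bar>Im (B \<xi>)\<bar> < 1"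
        using abs_Im_le_cmod[of "A \<xi>"] abs_Im_le_cmod[of "B \<xi>"] elim by linarith+
      then have "Ln (exp (A \<xi>)) = A \<xi>" "Ln (exp (B \<xi>)) = B \<xi>"
        using pi_gt3 by (intro Ln_exp; linarith)+
      then show ?case using elim by metis
    qed
  qed
  \<comment> \<open>After normalisation the value at 0 is 1, so near 0 the values avoid the branch
    cut of \<open>Ln\<close>.\<close>
  define G where "G = (\<lambda>\<xi>. F (\<kappa> * exp (\<i> * \<xi>)) / F \<kappa>)"
  have "open ((\<lambda>\<xi>. \<kappa> * exp (\<i> * \<xi>)) -` U)" 
    by (intro open_vimage hol continuous_intros)
  moreover have "0 \<in> (\<lambda>\<xi>. \<kappa> * exp (\<i> * \<xi>)) -` U" using hol by simp
  ultimately obtain r1 where r1: "r1 > 0" "ball 0 r1 \<subseteq> (\<lambda>\<xi>. \<kappa> * exp (\<i> * \<xi>)) -` U"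
    by (meson open_contains_ball)
  have holG: "G holomorphic_on ball 0 r1"
    unfolding G_def using r1 nz
    by (intro holomorphic_intros holomorphic_on_compose_gen[OF _ hol(1), unfolded o_def]) auto
  have "isCont G 0"
    using holG r1 by (meson centre_in_ball continuous_on_eq_continuous_at holomorphic_on_imp_continuous_on open_ball)
  then obtain r2 where r2: "r2 > 0" "\<And>\<xi>. norm \<xi> < r2 \<Longrightarrow> norm (G \<xi> - 1) < 1"
    unfolding continuous_at_eps_delta using nz by (metis G_def dist_0_norm dist_norm exp_zero mult.right_neutral mult_zero_right right_inverse_eq zero_less_one dist_commute)
  define r where "r = min r1 r2"
  have r: "r > 0" using r1 r2 by (simp add: r_def)
  have pos: "G \<xi> \<notin> \<real>\<^sub>\<le>\<^sub>0" if "norm \<xi> < r" for \<xi>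
  proof
    assume "G \<xi> \<in> \<real>\<^sub>\<le>\<^sub>0"
    then have "Re (1 - G \<xi>) \<ge> 1" by (auto simp: complex_nonpos_Reals_iff)
    then have "norm (1 - G \<xi>) \<ge> 1" using complex_Re_le_cmod order_trans by blast
    with r2(2)[of \<xi>] that show False by (simp add: r_def norm_minus_commute)
  qed
  define D where "D = (\<lambda>\<xi>. Ln (G \<xi>) - ?E \<xi>)"
  have holD: "D holomorphic_on ball 0 r"
    unfolding D_def
    by (intro holomorphic_intros holomorphic_on_subset[OF holG]) (auto simp: r_def pos)
  have E0: "?E 0 = 0" using \<mu> by simp
  have G0: "G 0 = 1" using nz by (simp add: G_def)
  have D0: "D 0 = 0" using E0 by (simp add: D_def G0)
  have expD: "exp (?E \<xi> + D \<xi>) = G \<xi>" if "norm \<xi> < r" for \<xi>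
  proof -
    have "G \<xi> \<noteq> 0" using pos[OF that] by auto
    then show ?thesis by (simp add: D_def)
  qed
  have near: "\<forall>\<^sub>F \<xi>::complex in at 0. norm \<xi> < r"
    using r by (auto simp: eventually_at intro!: exI[of _ r])
  have tD: "(D \<longlongrightarrow> 0) (at 0)"
  proof -
    have "isCont D 0"
      using holD r by (meson centre_in_ball continuous_on_eq_continuous_at holomorphic_on_imp_continuous_on open_ball)
    then show ?thesis using D0 by (simp add: isCont_def)
  qed
  have "((\<lambda>z::complex. z ^ (2 * \<mu> + 1)) \<longlongrightarrow> 0 ^ (2 * \<mu> + 1)) (at 0)" by (intro tendsto_intros)
  then have "(\<lambda>z::complex. z ^ (2 * \<mu> + 1)) \<in> o[at 0](\<lambda>_. 1)"
    by (intro smalloI_tendsto) auto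
  then have "R \<in> o[at 0](\<lambda>_. 1)" by (rule landau_o.big_small_trans[OF R])
  then have tR: "(R \<longlongrightarrow> 0) (at 0)" by (auto dest: smalloD_tendsto)
  have "\<forall>\<^sub>F \<xi> in at 0. exp (D \<xi>) = exp (R \<xi>)"
    using ev near
  proof eventually_elim
    case (elim \<xi>)
    then have "exp (?E \<xi> + D \<xi>) = exp (?E \<xi> + R \<xi>)"
      using expD nz by (simp add: G_def)
    then show ?case by (simp add: exp_add)
  qed
  \<comment> \<open>The remainder \<open>R\<close> is only known through its order, but near 0 it
    coincides with the holomorphic \<open>D\<close>. The order therefore forces the Taylor
    coefficients of \<open>D\<close> up to degree \<open>2 * \<mu>\<close> to vanish.\<close>
  then have "\<forall>\<^sub>F \<xi> in at 0. D \<xi> = R \<xi>" by (rule exp_eqD[OF _ tD tR])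
  then have OD: "D \<in> O[at 0](\<lambda>\<xi>. \<xi> ^ (2 * \<mu> + 1))"
    using R by (simp add: landau_o.big.in_cong)
  have fpsD: "D has_fps_expansion fps_expansion D 0"
    using r holD by (intro has_fps_expansion_fps_expansion[of "ball 0 r"]) auto
  \<comment> \<open>Solved from the requirement that
    \<open>\<gamma>0 \<nu> / fact \<nu> * \<i> ^ \<nu>\<close> be the Taylor coefficient of
    \<open>D\<close>.\<close>
  define \<gamma>0 where "\<gamma>0 = (\<lambda>\<nu>. fact \<nu> * fps_nth (fps_expansion D 0) \<nu> / \<i> ^ \<nu>)"
  have zero: "\<forall>\<nu>\<le>2 * \<mu>. \<gamma>0 \<nu> = 0"
    using bigo_imp_fps_nth_eq_0[OF fpsD OD] by (auto simp: \<gamma>0_def)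
  have sums: "(\<lambda>\<nu>. \<gamma>0 \<nu> / fact \<nu> * (\<i> * \<xi>) ^ \<nu>) sums D \<xi>" if "norm \<xi> < r" for \<xi>
  proof -
    have "(\<lambda>n. (deriv ^^ n) D 0 / fact n * (\<xi> - 0) ^ n) sums D \<xi>"
      by (rule holomorphic_power_series[OF holD]) (use that in auto)
    then show ?thesis by (simp add: \<gamma>0_def fps_expansion_def power_mult_distrib)
  qed
  have "Q \<gamma>0 r"
    unfolding Q_def
  proof (intro allI impI conjI)
    fix \<xi> :: complex assume \<xi>: "norm \<xi> < r"
    show "summable (\<lambda>\<nu>. \<gamma>0 \<nu> / fact \<nu> * (\<i> * \<xi>) ^ \<nu>)" using sums[OF \<xi>] by (rule sums_summable)
    show "F (\<kappa> * exp (\<i> * \<xi>)) = F \<kappa> * exp (?E \<xi> + (\<Sum>\<nu>. \<gamma>0 \<nu> / fact \<nu> * (\<i> * \<xi>) ^ \<nu>))"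
      unfolding sums_unique[OF sums[OF \<xi>], symmetric] expD[OF \<xi>] using nz by (simp add: G_def)
  qed
  with r zero have ex: "?P \<gamma>0" by blast
  have fps: "(\<lambda>\<xi>. \<Sum>\<nu>. g \<nu> / fact \<nu> * (\<i> * \<xi>) ^ \<nu>) has_fps_expansion Abs_fps (\<lambda>\<nu>. g \<nu> / fact \<nu> * \<i> ^ \<nu>)"
    if "?P g" for g
  proof (rule has_fps_expansionI)
    from that obtain s where s: "s > 0" "Q g s" by blast
    show "\<forall>\<^sub>F u in nhds 0. (\<lambda>n. fps_nth (Abs_fps (\<lambda>\<nu>. g \<nu> / fact \<nu> * \<i> ^ \<nu>)) n * u ^ n) sums
         (\<Sum>\<nu>. g \<nu> / fact \<nu> * (\<i> * u) ^ \<nu>)"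
      unfolding eventually_nhds_metric
      using s(1) summable_sums[OF QD(1)[OF s(2)]]
      by (intro exI[of _ s]) (auto simp: power_mult_distrib mult.assoc)
  qed
  have uniq: "g = g'" if g: "?P g" and g': "?P g'" for g g'
  proof -
    let ?S = "\<lambda>g \<xi>. (\<Sum>\<nu>. g \<nu> / fact \<nu> * (\<i> * \<xi>) ^ \<nu>) :: complex"
    have tend: "(?S g \<longlongrightarrow> 0) (at 0)" if "?P g" for g
    proof -
      have "?S g 0 = 0"
        using has_fps_expansion_imp_0_eq_fps_nth_0[OF fps[OF that]] that by simp
      moreover have "isCont (?S g) 0"
        using has_fps_expansion_imp_continuous[OF fps[OF that], of UNIV] by simp
      ultimately show ?thesis by (simp add: isCont_def)
    qed
    from g obtain s where s: "s > 0" "Q g s" by blast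
    from g' obtain s' where s': "s' > 0" "Q g' s'" by blast
    have "exp (?S g \<xi>) = exp (?S g' \<xi>)" if "norm \<xi> < min s s'" for \<xi>
    proof -
      have "F \<kappa> * exp (?E \<xi> + ?S g \<xi>) = F \<kappa> * exp (?E \<xi> + ?S g' \<xi>)"
        using that by (intro trans[OF QD(2)[OF s(2), symmetric] QD(2)[OF s'(2)]]) auto
      then show ?thesis using nz by (simp add: exp_add)
    qed
    then have "\<forall>\<^sub>F \<xi> in at 0. exp (?S g \<xi>) = exp (?S g' \<xi>)"
      using s(1) s'(1) unfolding eventually_at by (intro exI[of _ "min s s'"]) auto
    then have "\<forall>\<^sub>F \<xi> in at 0. ?S g \<xi> = ?S g' \<xi>" by (rule exp_eqD[OF _ tend[OF g] tend[OF g']])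
    \<comment> \<open>The comparison of exponents covers a punctured neighbourhood only; the centre
      is added to compare power series expansions.\<close>
    moreover have "?S g 0 = ?S g' 0"
      using has_fps_expansion_imp_0_eq_fps_nth_0[OF fps[OF g]] has_fps_expansion_imp_0_eq_fps_nth_0[OF fps[OF g']] g g'
      by simp
    ultimately have "\<forall>\<^sub>F \<xi> in nhds 0. ?S g \<xi> = ?S g' \<xi>"
      by (simp add: eventually_nhds_conv_at)
    note iffD2[OF has_fps_expansion_cong[OF this refl] fps[OF g']]
    from fps_expansion_unique_complex[OF fps[OF g] this] show "g = g'"
      by (simp add: fps_eq_iff fun_eq_iff)
  qed
  have "\<gamma> = (THE g. ?P g)"
    unfolding \<gamma>_def cumulants_def Q_def ..
  also have "\<dots> = \<gamma>0"
    by (rule the_equality[where P = ?P]) (use ex in blast, rule uniq[OF _ ex], blast)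
  finally have "\<gamma> = \<gamma>0" .
  with ex have "?P \<gamma>" by simp
  then show "\<forall>\<nu>\<le>2 * \<mu>. \<gamma> \<nu> = 0"
    "\<exists>r>0. \<forall>\<xi>. norm \<xi> < r \<longrightarrow>
        summable (\<lambda>\<nu>. \<gamma> \<nu> / fact \<nu> * (\<i> * \<xi>) ^ \<nu>) \<and>
        F (\<kappa> * exp (\<i> * \<xi>)) =
          F \<kappa> * exp (\<i> * \<alpha> * \<xi> - \<beta> * \<xi> ^ (2 * \<mu>) + (\<Sum>\<nu>. \<gamma> \<nu> / fact \<nu> * (\<i> * \<xi>) ^ \<nu>))"
    unfolding Q_def by (rule conjunct1, rule conjunct2)
qed

section \<open>Expansion polynomials\<close>

lemma poly_fps_power_nth:
  fixes B :: "complex poly fps"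
  shows "poly (fps_nth (B ^ i) n) y = fps_nth (Abs_fps (\<lambda>k. poly (fps_nth B k) y) ^ i) n"
proof (induction i arbitrary: n)
  case 0
  then show ?case by (auto simp: fps_one_def)
next
  case (Suc i)
  then show ?case by (simp add: fps_mult_nth poly_sum)
qed

text \<open>Evaluation at \<open>y\<close> turns the composition over the polynomial ring into one
  over the complex numbers, where \<open>fps_exp\<close> is the expansion of an actual holomorphic
  function.\<close>

lemma poly_expansion_poly:
  "poly (expansion_poly \<gamma> \<mu> m) y = fps_nth (fps_exp 1 oo
     Abs_fps (\<lambda>\<nu>. if \<nu> = 0 then 0 else \<gamma> (2 * \<mu> + \<nu>) / fact (2 * \<mu> + \<nu>) * y ^ (2 * \<mu> + \<nu>))) m"
proof -
  have eq: "(\<lambda>k. poly (if k = 0 then 0 else monom (\<gamma> (2 * \<mu> + k) / fact (2 * \<mu> + k)) (2 * \<mu> + k)) y)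
     = (\<lambda>\<nu>. if \<nu> = 0 then 0 else \<gamma> (2 * \<mu> + \<nu>) / fact (2 * \<mu> + \<nu>) * y ^ (2 * \<mu> + \<nu>))"
    by (auto simp: poly_monom)
  show ?thesis
    unfolding expansion_poly_def fps_compose_nth
    by (simp add: poly_sum poly_fps_power_nth eq)
qed

lemma expansion_poly_0: "expansion_poly \<gamma> \<mu> 0 = 1"
  by (simp add: expansion_poly_def fps_compose_nth one_pCons)

text \<open>Cauchy's estimates on the circle of radius \<open>r\<close> bound the tail by a
  geometric series of ratio at most 1 / 2; its sum accounts for the factor 2.\<close>

lemma power_series_remainder_le:
  fixes f :: "complex \<Rightarrow> complex"
  assumes hol: "f holomorphic_on ball 0 R" and r: "0 < r" "r < R"
    and B: "\<And>z. norm z = r \<Longrightarrow> norm (f z) \<le> B" and z: "norm z \<le> r / 2"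
    and F: "f has_fps_expansion F"
  shows "norm (f z - (\<Sum>m\<le>M. fps_nth F m * z ^ m)) \<le> 2 * B * (norm z / r) ^ (M + 1)"
proof -
  define p where "p = fps_nth F"
  have p: "p m = (deriv ^^ m) f 0 / fact m" for m
    unfolding p_def by (rule fps_nth_fps_expansion[OF F])
  have "norm (f (of_real r)) \<le> B" using r by (intro B) simp
  then have B0: "B \<ge> 0" using norm_ge_zero order_trans by blast
  define q where "q = norm z / r"
  have q: "0 \<le> q" "q \<le> 1 / 2" using r z by (auto simp: q_def field_simps)
  have pm: "norm (p m) \<le> B / r ^ m" for m
  proof -
    have "norm ((deriv ^^ m) f 0) \<le> fact m * B / r ^ m"
    proof (rule Cauchy_inequality)
      show "f holomorphic_on ball 0 r" by (rule holomorphic_on_subset[OF hol]) (use r in auto)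
      show "continuous_on (cball 0 r) f"
        by (rule continuous_on_subset[OF holomorphic_on_imp_continuous_on[OF hol]]) (use r in auto)
    qed (use r B in auto)
    then show ?thesis by (simp add: p norm_divide pos_divide_le_eq mult.commute)
  qed
  have trm: "norm (p m * z ^ m) \<le> B * q ^ m" for m
  proof -
    have "norm (p m * z ^ m) \<le> B / r ^ m * norm z ^ m"
      unfolding norm_mult norm_power by (intro mult_right_mono pm) auto
    then show ?thesis by (simp add: q_def power_divide)
  qed
  have sums: "(\<lambda>m. p m * z ^ m) sums f z"
    using holomorphic_power_series[OF hol, of z] z r by (simp add: p)
  have tail: "(\<lambda>m. p (m + (M + 1)) * z ^ (m + (M + 1))) sums (f z - (\<Sum>m<M + 1. p m * z ^ m))"
    using sums_split_initial_segment[OF sums, of "M + 1"] by simp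
  have geo: "(\<lambda>m. B * q ^ (M + 1) * q ^ m) sums (B * q ^ (M + 1) * (1 / (1 - q)))"
    using q by (intro sums_mult geometric_sums) auto
  have "norm (f z - (\<Sum>m<M + 1. p m * z ^ m)) \<le> (\<Sum>m. B * q ^ (M + 1) * q ^ m)"
    unfolding sums_unique[OF tail]
  proof (rule norm_suminf_le)
    show "norm (p (m + (M + 1)) * z ^ (m + (M + 1))) \<le> B * q ^ (M + 1) * q ^ m" for m
      using trm[of "m + (M + 1)"] by (simp only: power_add mult_ac)
  qed (rule sums_summable[OF geo])
  also have "\<dots> = B * q ^ (M + 1) * (1 / (1 - q))"
    by (rule sums_unique[OF geo, symmetric])
  also have "\<dots> \<le> B * q ^ (M + 1) * 2"
    using q B0 by (intro mult_left_mono) (auto simp: field_simps)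
  finally show ?thesis by (simp add: p_def q_def lessThan_Suc_atMost mult_ac)
qed

text \<open>For fixed \<open>Y\<close> the exponential is holomorphic in \<open>Z\<close>, and on
  the circle of radius \<open>\<delta> / max 1 (norm Y)\<close> the argument of \<open>S\<close>
  stays in the disc where \<open>S\<close> is at most \<epsilon>. The price is a factor polynomial
  in \<open>norm Y\<close> and the growth exp (\<epsilon> * |Y|^(2 * \<mu>)), both affordable
  against the Gaussian factor. The maximum with 1 keeps the radius meaningful when \<open>Y\<close>
  is small or zero.\<close>

lemma expansion_poly_remainder:
  fixes S :: "complex \<Rightarrow> complex" and Y Z :: complex
  assumes S: "S holomorphic_on ball 0 \<rho>"
    and fps: "S has_fps_expansion Abs_fps (\<lambda>\<nu>. \<gamma> (2 * \<mu> + \<nu>) / fact (2 * \<mu> + \<nu>))" and \<gamma>: "\<gamma> (2 * \<mu>) = 0"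
    and \<delta>: "0 < \<delta>" "\<delta> < \<rho>" and \<epsilon>: "\<And>w. norm w \<le> \<delta> \<Longrightarrow> norm (S w) \<le> \<epsilon>"
    and YZ: "norm Z * max 1 (norm Y) \<le> \<delta> / 2"
  shows "norm (exp (Y ^ (2 * \<mu>) * S (Y * Z)) - (\<Sum>m\<le>M. poly (expansion_poly \<gamma> \<mu> m) Y * Z ^ m))
     \<le> 2 * exp (\<epsilon> * norm Y ^ (2 * \<mu>)) * (norm Z * max 1 (norm Y) / \<delta>) ^ (M + 1)"
proof -
  define y where "y = max 1 (norm Y)"
  have y: "y \<ge> 1" "norm Y \<le> y" by (auto simp: y_def)
  define f where "f = (\<lambda>Z. exp (Y ^ (2 * \<mu>) * S (Y * Z)))"
  let ?C = "Abs_fps (\<lambda>\<nu>. \<gamma> (2 * \<mu> + \<nu>) / fact (2 * \<mu> + \<nu>))"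
  let ?G = "fps_const (Y ^ (2 * \<mu>)) * (?C oo (fps_const Y * fps_X))"
  have "(\<lambda>Z. Y * Z) has_fps_expansion fps_const Y * fps_X"
    by (intro fps_expansion_intros)
  then have "(\<lambda>Z. Y ^ (2 * \<mu>) * (S \<circ> (\<lambda>Z. Y * Z)) Z) has_fps_expansion ?G"
    by (intro fps_expansion_intros has_fps_expansion_compose fps) auto
  then have "(exp \<circ> (\<lambda>Z. Y ^ (2 * \<mu>) * (S \<circ> (\<lambda>Z. Y * Z)) Z)) has_fps_expansion (fps_exp 1 oo ?G)"
    by (intro has_fps_expansion_compose has_fps_expansion_exp1) (auto simp: \<gamma>)
  then have F: "f has_fps_expansion (fps_exp 1 oo ?G)"
    by (simp add: f_def o_def)
  have G: "?G = Abs_fps (\<lambda>\<nu>. if \<nu> = 0 then 0 else \<gamma> (2 * \<mu> + \<nu>) / fact (2 * \<mu> + \<nu>) * Y ^ (2 * \<mu> + \<nu>))"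
    by (rule fps_ext) (auto simp: \<gamma> power_add)
  have in_ball: "norm (Y * w) < \<rho>" if "norm w < \<rho> / y" for w :: complex
  proof -
    have "norm (Y * w) \<le> y * norm w" unfolding norm_mult using y by (intro mult_right_mono) auto
    also have "\<dots> < \<rho>" using that y by (simp add: field_simps)
    finally show ?thesis .
  qed
  have hol: "f holomorphic_on ball 0 (\<rho> / y)"
    unfolding f_def using in_ball
    by (intro holomorphic_intros holomorphic_on_compose_gen[OF _ S, unfolded o_def]) auto
  have "norm (f Z - (\<Sum>m\<le>M. fps_nth (fps_exp 1 oo ?G) m * Z ^ m))
     \<le> 2 * exp (\<epsilon> * norm Y ^ (2 * \<mu>)) * (norm Z / (\<delta> / y)) ^ (M + 1)"
  proof (rule power_series_remainder_le[OF hol _ _ _ _ F])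
    show "0 < \<delta> / y" "\<delta> / y < \<rho> / y" using \<delta> y by (auto simp: divide_strict_right_mono)
    show "norm Z \<le> \<delta> / y / 2" using YZ y by (simp add: y_def[symmetric] field_simps)
    fix w :: complex assume w: "norm w = \<delta> / y"
    have "norm (Y * w) \<le> y * norm w" unfolding norm_mult using y by (intro mult_right_mono) auto
    also have "\<dots> = \<delta>" using w y by simp
    finally have "norm (S (Y * w)) \<le> \<epsilon>" by (rule \<epsilon>)
    then have "norm (Y ^ (2 * \<mu>) * S (Y * w)) \<le> \<epsilon> * norm Y ^ (2 * \<mu>)"
      by (simp add: norm_mult norm_power mult.commute mult_right_mono)
    then have "Re (Y ^ (2 * \<mu>) * S (Y * w)) \<le> \<epsilon> * norm Y ^ (2 * \<mu>)"
      using complex_Re_le_cmod order_trans by blast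
    then show "norm (f w) \<le> exp (\<epsilon> * norm Y ^ (2 * \<mu>))" by (simp add: f_def)
  qed
  then show ?thesis
    unfolding G poly_expansion_poly by (simp add: f_def y_def)
qed

text \<open>With \<open>Y = \<i> * \<theta>\<close> and \<open>Z = n powr (- 1 / (2 * \<mu>))\<close> the factor below is the scaled
  \<open>n\<close>-th power of the symbol.\<close>

lemma cumulants_factor:
  assumes \<gamma>0: "\<forall>\<nu>\<le>2 * \<mu>. \<gamma> \<nu> = (0::complex)" and r: "r > 0"
    and sm: "\<And>\<xi>. norm \<xi> < r \<Longrightarrow> summable (\<lambda>\<nu>. \<gamma> \<nu> / fact \<nu> * (\<i> * \<xi>) ^ \<nu>)"
  obtains S where "S holomorphic_on ball 0 r"
    and "S has_fps_expansion Abs_fps (\<lambda>\<nu>. \<gamma> (2 * \<mu> + \<nu>) / fact (2 * \<mu> + \<nu>))" and "S 0 = 0"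
    and "\<And>\<xi>. norm \<xi> < r \<Longrightarrow> (\<Sum>\<nu>. \<gamma> \<nu> / fact \<nu> * (\<i> * \<xi>) ^ \<nu>) = (\<i> * \<xi>) ^ (2 * \<mu>) * S (\<i> * \<xi>)"
proof
  define c where "c = (\<lambda>\<nu>. \<gamma> (2 * \<mu> + \<nu>) / fact (2 * \<mu> + \<nu>))"
  define S where "S = (\<lambda>w. \<Sum>\<nu>. c \<nu> * w ^ \<nu>)"
  have g: "summable (\<lambda>\<nu>. \<gamma> \<nu> / fact \<nu> * w ^ \<nu>)" if "norm w < r" for w
    using sm[of "- \<i> * w"] that by (simp add: norm_mult flip: mult.assoc)
  have s: "summable (\<lambda>\<nu>. c \<nu> * w ^ \<nu>)" and eq: "(\<Sum>\<nu>. \<gamma> \<nu> / fact \<nu> * w ^ \<nu>) = w ^ (2 * \<mu>) * S w" if w: "norm w < r" for w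
  proof -
    have *: "(\<lambda>\<nu>. w ^ (2 * \<mu>) * (c \<nu> * w ^ \<nu>)) = (\<lambda>\<nu>. \<gamma> (\<nu> + 2 * \<mu>) / fact (\<nu> + 2 * \<mu>) * w ^ (\<nu> + 2 * \<mu>))"
      by (auto simp: c_def power_add add.commute)
    have s1: "summable (\<lambda>\<nu>. w ^ (2 * \<mu>) * (c \<nu> * w ^ \<nu>))"
      unfolding * using g[OF w] by (subst summable_iff_shift)
    show s2: "summable (\<lambda>\<nu>. c \<nu> * w ^ \<nu>)"
    \<comment> \<open>The power of \<open>w\<close> can be cancelled only for nonzero
      \<open>w\<close>; at 0 the series has at most one nonzero term.\<close>
    proof (cases "w = 0")
      case False
      then show ?thesis using s1 summable_cmult_iff[of "w ^ (2 * \<mu>)"] by simp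
    qed (use summable_finite[of "{0}" "\<lambda>\<nu>. c \<nu> * w ^ \<nu>"] in \<open>auto simp: power_0_left\<close>)
    have "(\<Sum>\<nu>. \<gamma> \<nu> / fact \<nu> * w ^ \<nu>) = (\<Sum>\<nu>. w ^ (2 * \<mu>) * (c \<nu> * w ^ \<nu>)) + (\<Sum>\<nu><2 * \<mu>. \<gamma> \<nu> / fact \<nu> * w ^ \<nu>)"
      unfolding * by (rule suminf_split_initial_segment[OF g[OF w]])
    also have "(\<Sum>\<nu><2 * \<mu>. \<gamma> \<nu> / fact \<nu> * w ^ \<nu>) = 0" using \<gamma>0 by (intro sum.neutral) auto
    finally show "(\<Sum>\<nu>. \<gamma> \<nu> / fact \<nu> * w ^ \<nu>) = w ^ (2 * \<mu>) * S w"
      using suminf_mult[OF s2] by (simp add: S_def)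
  qed
  show "S holomorphic_on ball 0 r"
    by (rule power_series_holomorphic[of _ _ c]) (use s in \<open>auto simp: S_def summable_sums\<close>)
  show "S has_fps_expansion Abs_fps (\<lambda>\<nu>. \<gamma> (2 * \<mu> + \<nu>) / fact (2 * \<mu> + \<nu>))"
    by (rule has_fps_expansionI)
      (use s r in \<open>auto simp: S_def c_def[symmetric] eventually_nhds_metric summable_sums intro!: exI[of _ r]\<close>)
  from has_fps_expansion_imp_0_eq_fps_nth_0[OF this] show "S 0 = 0" using \<gamma>0 by simp
  show "(\<Sum>\<nu>. \<gamma> \<nu> / fact \<nu> * (\<i> * \<xi>) ^ \<nu>) = (\<i> * \<xi>) ^ (2 * \<mu>) * S (\<i> * \<xi>)" if "norm \<xi> < r" for \<xi>
    using eq[of "\<i> * \<xi>"] that by (simp add: norm_mult)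
qed

section \<open>Decay on the strip and contour shift\<close>

lemma exp_neg_Ici:
  fixes T :: real
  defines "h \<equiv> \<lambda>t. if T \<le> t then exp (- t) else 0"
  shows "integrable lborel h" and "integral\<^sup>L lborel h = exp (- T)"
proof -
  have meas: "h \<in> borel_measurable borel" unfolding h_def by measurable
  have "((\<lambda>t. exp (- 1 * t)) has_integral exp (- 1 * T) / 1) {T..}"
    by (rule has_integral_exp_minus_to_infinity) simp
  then have "((\<lambda>t. if t \<in> {T..} then exp (- t) else 0) has_integral exp (- T)) UNIV"
    by (subst has_integral_restrict_UNIV) simp
  then have hi: "(h has_integral exp (- T)) UNIV" by (simp add: h_def)
  have nn: "integral\<^sup>N lborel h = exp (- T)"
    by (rule nn_integral_has_integral_lborel[OF meas _ hi]) (simp add: h_def)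
  show int: "integrable lborel h"
    by (rule integrableI_nonneg) (use meas nn in \<open>auto simp: h_def\<close>)
  show "integral\<^sup>L lborel h = exp (- T)"
    using meas nn by (intro integral_eq_nn_integral[THEN trans]) (auto simp: h_def)
qed

lemma exp_neg_abs_tail:
  fixes T :: real
  assumes T: "T \<ge> 0"
  defines "g \<equiv> \<lambda>t. if T \<le> \<bar>t\<bar> then exp (- \<bar>t\<bar>) else 0"
  shows "integrable lborel g" and "integral\<^sup>L lborel g \<le> 2 * exp (- T)"
proof -
  let ?h = "\<lambda>t. if T \<le> t then exp (- t) else (0::real)"
  note h = exp_neg_Ici[of T]
  have refl: "integrable lborel (\<lambda>t. ?h (- t))" "(LINT t|lborel. ?h (- t)) = exp (- T)"
    using lborel_integrable_real_affine[OF h(1), of "-1" 0]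
      lborel_integral_real_affine[of "-1" ?h 0] h(2) by (simp_all cong: if_cong)
  have le: "g t \<le> ?h t + ?h (- t)" "0 \<le> g t" for t
    using exp_ge_zero[of t] exp_ge_zero[of "- t"] by (auto simp: g_def abs_if simp del: exp_ge_zero)
  show i: "integrable lborel g"
  proof (rule Bochner_Integration.integrable_bound[OF Bochner_Integration.integrable_add[OF h(1) refl(1)]])
    show "g \<in> borel_measurable lborel" unfolding g_def by measurable
    show "AE t in lborel. norm (g t) \<le> norm (?h t + ?h (- t))" using le by (auto simp: g_def)
  qed
  have "integral\<^sup>L lborel g \<le> (LINT t|lborel. ?h t + ?h (- t))"
    by (rule integral_mono[OF i Bochner_Integration.integrable_add[OF h(1) refl(1)]]) (rule le)
  also have "\<dots> = exp (- T) + exp (- T)"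
    by (simp only: Bochner_Integration.integral_add[OF h(1) refl(1)] h(2) refl(2))
  finally show "integral\<^sup>L lborel g \<le> 2 * exp (- T)" by simp
qed

lemma integrable_exp_neg_abs: "integrable lborel (\<lambda>t::real. exp (- \<bar>t\<bar>))"
  using exp_neg_abs_tail(1)[of 0] by simp

lemma integrable_exp_decay:
  fixes f :: "real \<Rightarrow> complex"
  assumes f: "f \<in> borel_measurable borel" and le: "\<And>t. norm (f t) \<le> C * exp (- \<bar>t\<bar>)"
  shows "integrable lborel f"
proof (rule Bochner_Integration.integrable_bound)
  show "integrable lborel (\<lambda>t::real. C * exp (- \<bar>t\<bar>))"
    using integrable_exp_neg_abs by simp
  show "AE t in lborel. norm (f t) \<le> norm (C * exp (- \<bar>t\<bar>))"
    by (intro AE_I2) (use order_trans[OF le abs_ge_self] in simp)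
qed (use f in simp)

text \<open>The \<open>H\<close> functions integrate over the whole line, whereas a scaled arc
  covers only \<open>{-T..T}\<close>. With T = \<delta> * N the difference is negligible.\<close>

lemma exp_decay_truncation:
  fixes f :: "real \<Rightarrow> complex"
  assumes f: "continuous_on UNIV f" and le: "\<And>t. norm (f t) \<le> C * exp (- \<bar>t\<bar>)" and T: "T \<ge> 0"
  shows "norm ((LINT t|lborel. f t) - integral {-T..T} f) \<le> 2 * C * exp (- T)"
proof -
  have meas: "f \<in> borel_measurable borel" by (rule borel_measurable_continuous_onI[OF f])
  have int: "integrable lborel f" by (rule integrable_exp_decay[OF meas le])
  have si: "set_integrable lborel {-T..T} f"
    by (rule borel_integrable_atLeastAtMost') (rule continuous_on_subset[OF f], simp)
  have eq: "integral {-T..T} f = (LINT t|lborel. indicator {-T..T} t *\<^sub>R f t)"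
    using set_borel_integral_eq_integral(2)[OF si] by (simp add: set_lebesgue_integral_def)
  have C: "C \<ge> 0" using order_trans[OF norm_ge_zero le[of 0]] by simp
  have i2: "integrable lborel (\<lambda>t. indicator {-T..T} t *\<^sub>R f t)"
    using si by (simp add: set_integrable_def)
  have i3: "integrable lborel (\<lambda>t. C * (if T \<le> \<bar>t\<bar> then exp (- \<bar>t\<bar>) else 0))"
    by (intro integrable_mult_right exp_neg_abs_tail(1) T)
  have "norm ((LINT t|lborel. f t) - integral {-T..T} f) = norm (LINT t|lborel. f t - indicator {-T..T} t *\<^sub>R f t)"
    unfolding eq by (simp only: Bochner_Integration.integral_diff[OF int i2])
  also have "\<dots> \<le> (LINT t|lborel. C * (if T \<le> \<bar>t\<bar> then exp (- \<bar>t\<bar>) else 0))"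
    by (rule Bochner_Integration.integral_norm_bound_integral[OF Bochner_Integration.integrable_diff[OF int i2] i3])
      (use le T C in \<open>auto simp: indicator_def\<close>)
  also have "\<dots> \<le> C * (2 * exp (- T))"
    by (simp only: integral_mult_right_zero) (intro mult_left_mono exp_neg_abs_tail(2) T C)
  finally show ?thesis by simp
qed

lemma integral_exp_neg_abs_le:
  fixes T :: real
  assumes "T \<ge> 0"
  shows "integral {-T..T} (\<lambda>t. exp (- \<bar>t\<bar>)) \<le> 2"
proof -
  have s: "set_integrable lborel {-T..T} (\<lambda>t. exp (- \<bar>t\<bar>))"
    by (intro borel_integrable_atLeastAtMost' continuous_intros)
  have "integral {-T..T} (\<lambda>t. exp (- \<bar>t\<bar>)) = (LINT t|lborel. indicator {-T..T} t *\<^sub>R exp (- \<bar>t\<bar>))"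
    using set_borel_integral_eq_integral(2)[OF s] by (simp add: set_lebesgue_integral_def)
  also have "\<dots> \<le> (LINT t|lborel. exp (- \<bar>t\<bar>))"
    by (rule integral_mono) (use s integrable_exp_neg_abs in \<open>auto simp: set_integrable_def indicator_def\<close>)
  also have "\<dots> \<le> 2" using exp_neg_abs_tail(2)[of 0] by simp
  finally show ?thesis .
qed

text \<open>The contour is moved to the line on which \<open>exp (- \<i> * x * z)\<close> decays.\<close>

lemma contour_shift_bound:
  fixes f :: "complex \<Rightarrow> complex" and x T :: real
  assumes hol: "f holomorphic_on U" and U: "convex U" "open U" and T: "T \<ge> 0"
    and sub: "\<And>z. \<bar>Re z\<bar> \<le> T \<Longrightarrow> \<bar>Im z\<bar> \<le> 1 \<Longrightarrow> z \<in> U"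
    and le: "\<And>z. \<bar>Re z\<bar> \<le> T \<Longrightarrow> \<bar>Im z\<bar> \<le> 1 \<Longrightarrow> norm (f z) \<le> C * exp (- \<bar>Re z\<bar>)"
  shows "norm (integral {-T..T} (\<lambda>t. f (of_real t) * exp (- \<i> * x * t))) \<le> 2 * C * (exp (- \<bar>x\<bar>) + exp (- T))"
proof -
  \<comment> \<open>The norm of \<open>exp (- \<i> * x * z)\<close> is
    \<open>exp (x * Im z)\<close>, which equals \<open>exp (- \<bar>x\<bar>)\<close> at height
    \<open>s\<close>. For \<open>x = 0\<close> there is no shift.\<close>
  define s where "s = - sgn x"
  have s: "\<bar>s\<bar> \<le> 1" "x * s = - \<bar>x\<bar>" by (auto simp: s_def sgn_real_def)
  have "norm (f 0) \<le> C * exp (- \<bar>Re 0\<bar>)" using T by (intro le) auto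
  from order_trans[OF norm_ge_zero this] have C: "C \<ge> 0" by simp
  define g where "g = (\<lambda>z. f z * exp (- \<i> * x * z))"
  have "g holomorphic_on U" unfolding g_def by (intro holomorphic_intros hol)
  \<comment> \<open>A primitive takes the place of Cauchy's theorem on the rectangle: integrals
    along horizontal lines become differences of \<open>\<Phi>\<close>, and the vertical sides are
    bounded by the mean value inequality.\<close>
  then obtain \<Phi> where \<Phi>: "\<And>z. z \<in> U \<Longrightarrow> (\<Phi> has_field_derivative g z) (at z within U)"
    using holomorphic_convex_primitive'[OF U] by blast
  then have \<Phi>': "(\<Phi> has_field_derivative g z) (at z)" if "z \<in> U" for z
    using that U by (metis at_within_open)
  have gle: "norm (g z) \<le> C * exp (- \<bar>Re z\<bar>) * exp (x * Im z)" if "\<bar>Re z\<bar> \<le> T" "\<bar>Im z\<bar> \<le> 1" for z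
    unfolding g_def norm_mult using le[OF that] C by (intro mult_mono) auto
  have ftc: "((\<lambda>t. g (of_real t + \<i> * c)) has_integral \<Phi> (of_real T + \<i> * c) - \<Phi> (of_real (- T) + \<i> * c)) {-T..T}"
    if "\<bar>c\<bar> \<le> 1" for c :: real
  proof (rule fundamental_theorem_of_calculus)
    fix t assume t: "t \<in> {-T..T}"
    have "((\<lambda>z. \<Phi> (z + \<i> * c)) has_field_derivative g (of_real t + \<i> * c) * 1) (at (of_real t))"
      by (rule DERIV_chain2[OF \<Phi>']) (use t that in \<open>auto intro!: sub derivative_eq_intros\<close>)
    then have "((\<lambda>t. \<Phi> (of_real t + \<i> * c)) has_vector_derivative g (of_real t + \<i> * c) * 1) (at t within {-T..T})"
      by (rule has_vector_derivative_real_field)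
    then show "((\<lambda>t. \<Phi> (of_real t + \<i> * c)) has_vector_derivative g (of_real t + \<i> * c)) (at t within {-T..T})"
      by simp
  qed (use T in simp)
  \<comment> \<open>Between heights 0 and \<open>s\<close> the product \<open>x * Im z\<close> is
    nonpositive, so the oscillating factor is at most 1; the side has length at most 1 and lies at
    \<open>\<bar>Re z\<bar> = T\<close>.\<close>
  have side: "norm (\<Phi> (of_real t + \<i> * s) - \<Phi> (of_real t)) \<le> C * exp (- T)" if t: "\<bar>t\<bar> = T" for t :: real
  proof -
    let ?S = "closed_segment (complex_of_real t) (of_real t + \<i> * s)"
    have S: "Re z = t \<and> \<bar>Im z\<bar> \<le> 1 \<and> x * Im z \<le> 0" if zS: "z \<in> ?S" for z
    proof -
      obtain u where u: "0 \<le> u" "u \<le> 1" "z = (1 - u) *\<^sub>R complex_of_real t + u *\<^sub>R (of_real t + \<i> * s)"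
        using zS by (auto simp: in_segment)
      then have z: "Re z = t" "Im z = u * s" by (auto simp: algebra_simps)
      have "u * \<bar>s\<bar> \<le> 1 * 1" using u s by (intro mult_mono) auto
      moreover have "x * Im z = u * (x * s)" using z by simp
      then have "x * Im z = - (u * \<bar>x\<bar>)" by (simp only: s(2) mult_minus_right)
      ultimately show ?thesis using z u by (simp add: abs_mult)
    qed
    have "norm (\<Phi> (of_real t + \<i> * s) - \<Phi> (of_real t)) \<le> C * exp (- T) * norm (of_real t + \<i> * s - complex_of_real t)"
    proof (rule field_differentiable_bound[of ?S _ g])
      fix z assume z: "z \<in> ?S"
      show "(\<Phi> has_field_derivative g z) (at z within ?S)"
        using S[OF z] t by (intro has_field_derivative_at_within[OF \<Phi>'] sub) auto
      have "norm (g z) \<le> C * exp (- T) * exp (x * Im z)" using gle[of z] S[OF z] t by simp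
      also have "\<dots> \<le> C * exp (- T) * 1" using S[OF z] C by (intro mult_left_mono) auto
      finally show "norm (g z) \<le> C * exp (- T)" by simp
    qed auto
    also have "\<dots> \<le> C * exp (- T) * 1" using s C by (intro mult_left_mono) (auto simp: norm_mult)
    finally show ?thesis by simp
  qed
  let ?I = "\<lambda>c::real. integral {-T..T} (\<lambda>t. g (of_real t + \<i> * c))"
  have "norm (?I s) \<le> integral {-T..T} (\<lambda>t. C * exp (- \<bar>x\<bar>) * exp (- \<bar>t\<bar>))"
  proof (rule Henstock_Kurzweil_Integration.integral_norm_bound_integral)
    show "(\<lambda>t. g (of_real t + \<i> * s)) integrable_on {-T..T}" using ftc[OF s(1)] by blast
    show "(\<lambda>t. C * exp (- \<bar>x\<bar>) * exp (- \<bar>t\<bar>)) integrable_on {-T..T}"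
      by (intro integrable_continuous_real continuous_intros)
    show "norm (g (of_real t + \<i> * s)) \<le> C * exp (- \<bar>x\<bar>) * exp (- \<bar>t\<bar>)" if "t \<in> {-T..T}" for t
      using gle[of "of_real t + \<i> * s"] that s by (auto simp: mult_ac)
  qed
  also have "\<dots> \<le> C * exp (- \<bar>x\<bar>) * 2"
    using C by (simp only: integral_mult_right) (intro mult_left_mono integral_exp_neg_abs_le T, simp)
  finally have 1: "norm (?I s) \<le> 2 * C * exp (- \<bar>x\<bar>)" by simp
  define X where "X = (\<lambda>t::real. \<Phi> (of_real t + \<i> * s) - \<Phi> (of_real t))"
  have "?I 0 = ?I s - X T + X (- T)"
    using integral_unique[OF ftc[of 0]] integral_unique[OF ftc[OF s(1)]] by (simp add: X_def)
  also have "norm \<dots> \<le> norm (?I s) + norm (X T) + norm (X (- T))"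
    using norm_triangle_ineq[of "?I s - X T" "X (- T)"] norm_triangle_ineq4[of "?I s" "X T"] by linarith
  also have "\<dots> \<le> 2 * C * exp (- \<bar>x\<bar>) + C * exp (- T) + C * exp (- T)"
    unfolding X_def by (intro add_mono 1 side) (use T in auto)
  finally show ?thesis by (simp add: g_def algebra_simps)
qed

text \<open>On the strip z = Re z * (1 + w) with w = \<i> * Im z / Re z, and w is small when |Re z|
  is large. Then Re (\<beta> * z^(2 * \<mu>)) is close to Re \<beta> * (Re z)^(2 * \<mu>), which
  dominates the \<epsilon> term, any polynomial and exp |Re z|. The remaining rectangle is compact.
  The choice of \<epsilon> precedes that of \<open>d\<close>, so one \<epsilon> serves all
  degrees.\<close>

lemma strip_decay:
  fixes \<beta> :: complex and \<mu> :: nat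
  assumes \<beta>: "Re \<beta> > 0" and \<mu>: "\<mu> \<ge> 1"
  obtains \<epsilon> where "\<epsilon> > 0" and
    "\<And>d. \<exists>C>0. \<forall>z. \<bar>Im z\<bar> \<le> 1 \<longrightarrow>
       (1 + norm z) ^ d * exp (\<epsilon> * norm z ^ (2 * \<mu>)) * norm (exp (- \<beta> * z ^ (2 * \<mu>))) \<le> C * exp (- \<bar>Re z\<bar>)"
proof -
  define b where "b = Re \<beta>"
  \<comment> \<open>A quarter of \<open>b\<close> leaves \<open>\<phi> 0 = 3 * b / 4\<close>, hence
    still more than \<open>b / 2\<close> for small \<open>w\<close> by continuity.\<close>
  define \<epsilon> where "\<epsilon> = b / 4"
  have b: "b > 0" "\<epsilon> > 0" using \<beta> by (auto simp: b_def \<epsilon>_def)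
  define \<phi> where "\<phi> = (\<lambda>w. Re (\<beta> * (1 + w) ^ (2 * \<mu>)) - \<epsilon> * norm (1 + w) ^ (2 * \<mu>))"
  have "continuous_on UNIV \<phi>" unfolding \<phi>_def by (intro continuous_intros)
  then have "isCont \<phi> 0" by (simp add: continuous_on_eq_continuous_at)
  moreover have "\<phi> 0 > b / 2" using b by (simp add: \<phi>_def \<epsilon>_def flip: b_def)
  ultimately have "\<forall>\<^sub>F w in at 0. \<phi> w > b / 2"
    unfolding isCont_def by (intro order_tendstoD(1))
  then obtain \<eta> where \<eta>: "\<eta> > 0" "\<And>w. w \<noteq> 0 \<Longrightarrow> norm w < \<eta> \<Longrightarrow> \<phi> w > b / 2"
    unfolding eventually_at by auto
  have \<eta>': "\<phi> w > b / 2" if "norm w < \<eta>" for w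
    using \<eta>(2)[of w] that \<open>\<phi> 0 > b / 2\<close> by (cases "w = 0") auto
  have "\<exists>C>0. \<forall>z. \<bar>Im z\<bar> \<le> 1 \<longrightarrow>
       (1 + norm z) ^ d * exp (\<epsilon> * norm z ^ (2 * \<mu>)) * norm (exp (- \<beta> * z ^ (2 * \<mu>))) \<le> C * exp (- \<bar>Re z\<bar>)" for d
  proof -
    let ?f = "\<lambda>z. (1 + norm z) ^ d * exp (\<epsilon> * norm z ^ (2 * \<mu>)) * norm (exp (- \<beta> * z ^ (2 * \<mu>)))"
    have "((\<lambda>t. (2 + t) ^ d * exp (- (b / 2) * t ^ 2) * exp t) \<longlongrightarrow> 0) at_top"
      using b(1) by real_asymp
    then have "\<forall>\<^sub>F t in at_top. (2 + t) ^ d * exp (- (b / 2) * t ^ 2) * exp t < 1"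
      by (rule order_tendstoD(2)) simp
    then obtain T0 where T0: "\<And>t. t \<ge> T0 \<Longrightarrow> (2 + t) ^ d * exp (- (b / 2) * t ^ 2) * exp t < 1"
      unfolding eventually_at_top_linorder by blast
    \<comment> \<open>Beyond \<open>T\<close> three things hold: \<open>t ^ 2\<close> is at most
      \<open>t ^ (2 * \<mu>)\<close>, the asymptotic bound from \<open>T0\<close> applies, and the
      norm of \<open>w\<close>, at most \<open>1 / T\<close>, is below
      \<open>\<eta>\<close>.\<close>
    define T where "T = max (max 1 T0) (1 / \<eta> + 1)"
    have T: "T \<ge> 1" "T \<ge> T0" "1 / T < \<eta>"
    proof -
      have "1 / \<eta> < T" "T > 0" by (auto simp: T_def)
      then show "1 / T < \<eta>" using \<eta>(1) by (simp add: field_simps)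
    qed (auto simp: T_def)
    have large: "?f z \<le> 1 * exp (- \<bar>Re z\<bar>)" if z: "\<bar>Im z\<bar> \<le> 1" "T \<le> \<bar>Re z\<bar>" for z
    proof -
      define t where "t = \<bar>Re z\<bar>"
      have t: "t \<ge> T" "t \<ge> 1" using z T by (auto simp: t_def)
      define w where "w = \<i> * Im z / Re z"
      have "norm w = \<bar>Im z\<bar> / t" by (simp add: w_def norm_mult norm_divide t_def)
      also have "\<dots> \<le> 1 / T" using z t T by (intro frac_le) auto
      finally have w: "norm w < \<eta>" using T by simp
      have zw: "z = of_real (Re z) * (1 + w)"
        using z T by (auto simp: w_def complex_eq_iff)
      have pw: "complex_of_real (Re z) ^ (2 * \<mu>) = of_real (t ^ (2 * \<mu>))"
        by (simp add: t_def power_mult)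
      have zp: "z ^ (2 * \<mu>) = of_real (t ^ (2 * \<mu>)) * (1 + w) ^ (2 * \<mu>)"
        by (subst zw) (simp only: power_mult_distrib pw)
      have "Re (\<beta> * z ^ (2 * \<mu>)) = Re (of_real (t ^ (2 * \<mu>)) * (\<beta> * (1 + w) ^ (2 * \<mu>)))"
        by (simp only: zp mult.left_commute)
      also have "\<dots> = t ^ (2 * \<mu>) * Re (\<beta> * (1 + w) ^ (2 * \<mu>))" by (simp only: Re_complex_of_real Im_complex_of_real times_complex.sel)
      finally have 1: "Re (\<beta> * z ^ (2 * \<mu>)) = t ^ (2 * \<mu>) * Re (\<beta> * (1 + w) ^ (2 * \<mu>))" .
      have 2: "norm z ^ (2 * \<mu>) = t ^ (2 * \<mu>) * norm (1 + w) ^ (2 * \<mu>)"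
        by (subst zw) (simp add: norm_mult power_mult_distrib t_def)
      have "t ^ 2 \<le> t ^ (2 * \<mu>)" using t \<mu> by (intro power_increasing) auto
      then have "t ^ 2 * (b / 2) \<le> t ^ (2 * \<mu>) * \<phi> w"
        using \<eta>'[OF w] b t by (intro mult_mono) auto
      also have "\<dots> = Re (\<beta> * z ^ (2 * \<mu>)) - \<epsilon> * norm z ^ (2 * \<mu>)"
        unfolding 1 2 \<phi>_def by (simp add: algebra_simps)
      finally have "\<epsilon> * norm z ^ (2 * \<mu>) - Re (\<beta> * z ^ (2 * \<mu>)) \<le> - (t ^ 2 * (b / 2))" by linarith
      also have "\<dots> = - (b / 2) * t ^ 2" by simp
      finally have 3: "\<epsilon> * norm z ^ (2 * \<mu>) - Re (\<beta> * z ^ (2 * \<mu>)) \<le> - (b / 2) * t ^ 2" .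
      have "norm z \<le> t + 1" using cmod_le[of z] z by (simp add: t_def)
      then have "(1 + norm z) ^ d \<le> (2 + t) ^ d" by (intro power_mono) auto
      then have "(1 + norm z) ^ d * exp (\<epsilon> * norm z ^ (2 * \<mu>) - Re (\<beta> * z ^ (2 * \<mu>)))
          \<le> (2 + t) ^ d * exp (- (b / 2) * t ^ 2)"
        using 3 t by (intro mult_mono) auto
      also have "\<dots> = (2 + t) ^ d * exp (- (b / 2) * t ^ 2) * exp t * exp (- t)"
        by (simp add: exp_minus)
      also have "\<dots> \<le> 1 * exp (- t)" using T0[of t] t T by (intro mult_right_mono) auto
      finally show ?thesis
        by (simp only: norm_exp_eq_Re mult_minus_left uminus_complex.sel diff_conv_add_uminus exp_add
          mult.assoc mult_1 t_def)
    qed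
    let ?K = "cbox (Complex (- T) (- 1)) (Complex T 1)"
    have "continuous_on ?K (\<lambda>z. ?f z * exp \<bar>Re z\<bar>)" by (intro continuous_intros)
    then have "bounded ((\<lambda>z. ?f z * exp \<bar>Re z\<bar>) ` ?K)"
      by (intro compact_imp_bounded compact_continuous_image) auto
    then obtain B where B: "B > 0" "\<And>z. z \<in> ?K \<Longrightarrow> norm (?f z * exp \<bar>Re z\<bar>) \<le> B"
      unfolding bounded_pos by blast
    have "?f z \<le> max 1 B * exp (- \<bar>Re z\<bar>)" if z: "\<bar>Im z\<bar> \<le> 1" for z
    proof (cases "\<bar>Re z\<bar> \<le> T")
      case True
      then have "z \<in> ?K" using z by (auto simp: in_cbox_complex_iff)
      then have "?f z * exp \<bar>Re z\<bar> \<le> max 1 B" using B(2)[of z] by auto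
      then show ?thesis by (simp add: exp_minus field_simps)
    next
      case False
      then have "?f z \<le> 1 * exp (- \<bar>Re z\<bar>)" using large z by simp
      also have "\<dots> \<le> max 1 B * exp (- \<bar>Re z\<bar>)" by (intro mult_right_mono) auto
      finally show ?thesis .
    qed
    then show ?thesis by (intro exI[of _ "max 1 B"]) auto
  qed
  with b(2) that show ?thesis by blast
qed

section \<open>The functions \<open>H\<close>\<close>

text \<open>The Fourier side of \<open>P(- d/dx) H\<close>: differentiating
  \<open>exp (- \<i> * x * \<theta>)\<close> brings down - \<i> * \<theta>, so - d/dx acts as
  multiplication by \<i> * \<theta>. The argument is complex because the contour is moved off the
  real line.\<close>

definition gauss_poly :: "complex \<Rightarrow> nat \<Rightarrow> complex poly \<Rightarrow> complex \<Rightarrow> complex" where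
  "gauss_poly \<beta> \<mu> P z = poly P (\<i> * z) * exp (- \<beta> * z ^ (2 * \<mu>))"

definition H_int :: "complex \<Rightarrow> nat \<Rightarrow> complex poly \<Rightarrow> real \<Rightarrow> complex" where
  "H_int \<beta> \<mu> P x = 1 / (2 * pi) * (LINT \<theta>|lborel. gauss_poly \<beta> \<mu> P (of_real \<theta>) * exp (- \<i> * x * \<theta>))"

lemma poly_norm_le:
  fixes P :: "complex poly"
  shows "norm (poly P z) \<le> (\<Sum>j\<le>degree P. norm (coeff P j)) * (1 + norm z) ^ degree P"
proof -
  have "norm (poly P z) \<le> (\<Sum>j\<le>degree P. norm (coeff P j) * norm z ^ j)"
    unfolding poly_altdef by (rule sum_norm_le) (simp add: norm_mult norm_power)
  also have "\<dots> \<le> (\<Sum>j\<le>degree P. norm (coeff P j) * (1 + norm z) ^ degree P)"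
  proof (intro sum_mono mult_left_mono)
    fix j assume "j \<in> {..degree P}"
    have "norm z ^ j \<le> (1 + norm z) ^ j" by (intro power_mono) auto
    also have "\<dots> \<le> (1 + norm z) ^ degree P" using \<open>j \<in> _\<close> by (intro power_increasing) auto
    finally show "norm z ^ j \<le> (1 + norm z) ^ degree P" .
  qed auto
  finally show ?thesis by (simp add: sum_distrib_right)
qed

lemma continuous_gauss_poly: "continuous_on A (gauss_poly \<beta> \<mu> P)"
  unfolding gauss_poly_def by (intro continuous_intros)

lemma holomorphic_gauss_poly: "gauss_poly \<beta> \<mu> P holomorphic_on A"
  unfolding gauss_poly_def by (intro holomorphic_intros)

lemma gauss_poly_pCons: "gauss_poly \<beta> \<mu> (pCons 0 P) z = \<i> * z * gauss_poly \<beta> \<mu> P z"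
  by (simp add: gauss_poly_def)

lemma inverse_2pi_le_1: "1 / (2 * pi) \<le> 1"
  using pi_gt3 by simp

locale gauss =
  fixes \<beta> :: complex and \<mu> :: nat
  assumes \<beta>: "Re \<beta> > 0" and \<mu>: "\<mu> \<ge> 1"
begin

text \<open>This is \<open>strip_decay\<close> for the degree of \<open>P\<close>, with the growth
  factor involving \<epsilon> dropped.\<close>

lemma gauss_poly_decay:
  "\<exists>C>0. \<forall>z. \<bar>Im z\<bar> \<le> 1 \<longrightarrow> norm (gauss_poly \<beta> \<mu> P z) \<le> C * exp (- \<bar>Re z\<bar>)"
proof -
  obtain \<epsilon> where \<epsilon>: "\<epsilon> > 0" and
    *: "\<And>d. \<exists>C>0. \<forall>z. \<bar>Im z\<bar> \<le> 1 \<longrightarrow>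
       (1 + norm z) ^ d * exp (\<epsilon> * norm z ^ (2 * \<mu>)) * norm (exp (- \<beta> * z ^ (2 * \<mu>))) \<le> C * exp (- \<bar>Re z\<bar>)"
    using strip_decay[OF \<beta> \<mu>] by blast
  define K where "K = (\<Sum>j\<le>degree P. norm (coeff P j))"
  have K: "K \<ge> 0" unfolding K_def by (intro sum_nonneg) auto
  obtain C where C: "C > 0" "\<And>z. \<bar>Im z\<bar> \<le> 1 \<Longrightarrow>
       (1 + norm z) ^ degree P * exp (\<epsilon> * norm z ^ (2 * \<mu>)) * norm (exp (- \<beta> * z ^ (2 * \<mu>))) \<le> C * exp (- \<bar>Re z\<bar>)"
    using *[of "degree P"] by blast
  have "norm (gauss_poly \<beta> \<mu> P z) \<le> ((K + 1) * C) * exp (- \<bar>Re z\<bar>)" if z: "\<bar>Im z\<bar> \<le> 1" for z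
  proof -
    have "norm (gauss_poly \<beta> \<mu> P z) \<le> (K * (1 + norm z) ^ degree P) * norm (exp (- \<beta> * z ^ (2 * \<mu>)))"
      unfolding gauss_poly_def norm_mult K_def
      using poly_norm_le[of P "\<i> * z"] by (intro mult_right_mono) (auto simp: norm_mult)
    also have "\<dots> = K * ((1 + norm z) ^ degree P * 1 * norm (exp (- \<beta> * z ^ (2 * \<mu>))))" by simp
    also have "\<dots> \<le> (K + 1) * ((1 + norm z) ^ degree P * exp (\<epsilon> * norm z ^ (2 * \<mu>)) * norm (exp (- \<beta> * z ^ (2 * \<mu>))))"
      using K \<epsilon> by (intro mult_mono mult_nonneg_nonneg) auto
    also have "\<dots> \<le> (K + 1) * (C * exp (- \<bar>Re z\<bar>))"
      using K by (intro mult_left_mono C(2) z) auto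
    finally show ?thesis by (simp add: mult.assoc)
  qed
  with K C(1) show ?thesis by (intro exI[of _ "(K + 1) * C"]) auto
qed

lemma integrable_gauss_poly:
  fixes x :: real
  shows
  "integrable lborel (\<lambda>\<theta>::real. gauss_poly \<beta> \<mu> P (of_real \<theta>) * exp (- \<i> * x * \<theta>))"
proof -
  obtain C where C: "\<And>z. \<bar>Im z\<bar> \<le> 1 \<Longrightarrow> norm (gauss_poly \<beta> \<mu> P z) \<le> C * exp (- \<bar>Re z\<bar>)"
    using gauss_poly_decay by blast
  have "continuous_on UNIV (\<lambda>\<theta>::real. gauss_poly \<beta> \<mu> P (of_real \<theta>) * exp (- \<i> * x * \<theta>))"
    by (intro continuous_intros continuous_on_compose2[OF continuous_gauss_poly[of UNIV]]) auto
  then show ?thesis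
    using C[of "of_real _"]
    by (intro integrable_exp_decay[of _ C] borel_measurable_continuous_onI) (auto simp: norm_mult)
qed

text \<open>Differentiation under the integral with an explicit quadratic error: the first-order
  Taylor remainder of the exponential is O((y - x)^2 * \<theta>^2), and the Gaussian factor
  integrates \<theta>^2. Prepending 0 to \<open>P\<close> is multiplication by \<i> *
  \<theta>.\<close>

lemma H_int_has_vector_derivative:
  "(H_int \<beta> \<mu> P has_vector_derivative - H_int \<beta> \<mu> (pCons 0 P) x) (at x)"
proof -
  let ?c = "\<lambda>\<theta>::real. gauss_poly \<beta> \<mu> P (of_real \<theta>)"
  define L where "L = (LINT \<theta>|lborel. norm (gauss_poly \<beta> \<mu> (pCons 0 (pCons 0 P)) (of_real \<theta>)))"
  have iL: "integrable lborel (\<lambda>\<theta>::real. norm (gauss_poly \<beta> \<mu> (pCons 0 (pCons 0 P)) (of_real \<theta>)))"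
    using integrable_norm[OF integrable_gauss_poly[of "pCons 0 (pCons 0 P)" 0]] by simp
  have bound: "norm (H_int \<beta> \<mu> P y - H_int \<beta> \<mu> P x - (y - x) *\<^sub>R (- H_int \<beta> \<mu> (pCons 0 P) x))
      \<le> L * norm (y - x) * norm (y - x)" for y
  proof -
    let ?d = "\<lambda>\<theta>::real. ?c \<theta> * exp (- \<i> * y * \<theta>) - ?c \<theta> * exp (- \<i> * x * \<theta>)
       + of_real (y - x) * (gauss_poly \<beta> \<mu> (pCons 0 P) (of_real \<theta>) * exp (- \<i> * x * \<theta>))"
    have id: "integrable lborel ?d"
      by (intro Bochner_Integration.integrable_add Bochner_Integration.integrable_diff
        integrable_mult_right integrable_gauss_poly)
    note i = integrable_gauss_poly
    have d: "(LINT \<theta>|lborel. ?d \<theta>) = (LINT \<theta>|lborel. ?c \<theta> * exp (- \<i> * y * \<theta>))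
       - (LINT \<theta>|lborel. ?c \<theta> * exp (- \<i> * x * \<theta>))
       + of_real (y - x) * (LINT \<theta>|lborel. gauss_poly \<beta> \<mu> (pCons 0 P) (of_real \<theta>) * exp (- \<i> * x * \<theta>))"
      by (simp only: Bochner_Integration.integral_add[OF Bochner_Integration.integrable_diff[OF i i] integrable_mult_right[OF i]]
        Bochner_Integration.integral_diff[OF i i] integral_mult_right_zero)
    have alg: "c * A - c * B - h * - (c * D) = c * (A - B + h * D)" for A B D c h :: complex
      by (simp add: algebra_simps)
    have eq: "H_int \<beta> \<mu> P y - H_int \<beta> \<mu> P x - (y - x) *\<^sub>R (- H_int \<beta> \<mu> (pCons 0 P) x) = of_real (1 / (2 * pi)) * (LINT \<theta>|lborel. ?d \<theta>)"
      unfolding H_int_def scaleR_conv_of_real d by (simp only: of_real_divide of_real_mult of_real_1 of_real_numeral alg)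
    have J: "norm (LINT \<theta>|lborel. ?d \<theta>) \<le> (LINT \<theta>|lborel. (y - x)\<^sup>2 * norm (gauss_poly \<beta> \<mu> (pCons 0 (pCons 0 P)) (of_real \<theta>)))"
    proof (rule Bochner_Integration.integral_norm_bound_integral[OF id])
      show "integrable lborel (\<lambda>\<theta>::real. (y - x)\<^sup>2 * norm (gauss_poly \<beta> \<mu> (pCons 0 (pCons 0 P)) (of_real \<theta>)))"
        by (rule integrable_mult_right[OF iL])
      fix \<theta> :: real
      let ?w = "- \<i> * of_real (y - x) * of_real \<theta>"
      have "?d \<theta> = ?c \<theta> * exp (- \<i> * x * \<theta>) * (exp ?w - (\<Sum>k\<le>1. ?w ^ k / fact k))"
      proof -
        have "- \<i> * y * \<theta> = - \<i> * x * \<theta> + ?w" by (simp add: algebra_simps)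
        then have e: "exp (- \<i> * y * \<theta>) = exp (- \<i> * x * \<theta>) * exp ?w" by (simp only: exp_add)
        have w: "(\<Sum>k\<le>1. ?w ^ k / fact k) = 1 + ?w" by simp
        have alg: "c * (E * e) - c * E + h * (\<i> * t * c * E) = c * E * (e - (1 + (- \<i> * h * t)))"
          for c E e h t :: complex by (simp add: algebra_simps)
        show ?thesis unfolding e w gauss_poly_pCons by (rule alg)
      qed
      also have "norm \<dots> \<le> norm (?c \<theta>) * norm (exp ?w - (\<Sum>k\<le>1. ?w ^ k / fact k))"
        by (simp add: norm_mult)
      also have "\<dots> \<le> norm (?c \<theta>) * (exp \<bar>Re ?w\<bar> * norm ?w ^ Suc 1 / fact 1)"
        by (intro mult_left_mono Taylor_exp) auto
      also have "\<dots> = (y - x)\<^sup>2 * norm (gauss_poly \<beta> \<mu> (pCons 0 (pCons 0 P)) (of_real \<theta>))"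
      proof -
        \<comment> \<open>The exponent is purely imaginary, so the exponential factor in the Taylor
          bound is 1 and does not spoil integrability in \<open>\<theta>\<close>.\<close>
        have nw: "norm ?w = \<bar>y - x\<bar> * \<bar>\<theta>\<bar>" "Re ?w = 0"
          by (simp_all only: norm_mult norm_minus_cancel norm_ii norm_of_real mult_1) simp
        have "norm (gauss_poly \<beta> \<mu> (pCons 0 (pCons 0 P)) (of_real \<theta>)) = \<bar>\<theta>\<bar> ^ 2 * norm (?c \<theta>)"
          by (simp add: gauss_poly_pCons norm_mult power2_eq_square)
        then show ?thesis
          unfolding nw by (simp add: power_mult_distrib flip: power2_eq_square)
      qed
      finally show "norm (?d \<theta>) \<le> (y - x)\<^sup>2 * norm (gauss_poly \<beta> \<mu> (pCons 0 (pCons 0 P)) (of_real \<theta>))" .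
    qed
    also have "\<dots> = L * norm (y - x) * norm (y - x)"
      by (simp add: L_def power2_eq_square mult_ac)
    finally have "1 / (2 * pi) * norm (LINT \<theta>|lborel. ?d \<theta>) \<le> 1 * (L * norm (y - x) * norm (y - x))"
      by (intro mult_mono inverse_2pi_le_1) auto
    then show ?thesis unfolding eq norm_mult norm_of_real by simp
  qed
  have "((\<lambda>y. L * norm (y - x)) \<longlongrightarrow> L * norm (x - x)) (at x)" by (intro tendsto_intros)
  then have lim: "((\<lambda>y. L * norm (y - x)) \<longlongrightarrow> 0) (at x)" by simp
  show ?thesis
    unfolding has_vector_derivative_def
  proof (rule has_derivativeI_sandwich[OF zero_less_one _ _ lim])
    show "bounded_linear (\<lambda>h. h *\<^sub>R (- H_int \<beta> \<mu> (pCons 0 P) x))" by (rule bounded_linear_scaleR_left)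
    fix y assume "y \<noteq> x"
    then show "norm (H_int \<beta> \<mu> P y - H_int \<beta> \<mu> P x - (y - x) *\<^sub>R (- H_int \<beta> \<mu> (pCons 0 P) x)) / norm (y - x)
        \<le> L * norm (y - x)"
      using bound[of y] by (simp add: pos_divide_le_eq)
  qed
qed

lemma H_fun_eq: "H_fun \<beta> \<mu> = H_int \<beta> \<mu> 1"
  by (rule ext) (simp add: H_fun_def H_int_def gauss_poly_def mult.commute)

section \<open>Derivatives of \<open>H\<close> as Fourier integrals, and their decay\<close>

lemma higher_vector_derivative_H_fun:
  "((\<lambda>g y. vector_derivative g (at y)) ^^ j) (H_fun \<beta> \<mu>) = (\<lambda>x. (- 1) ^ j * H_int \<beta> \<mu> (monom 1 j) x)"
proof (induction j)
  case 0
  then show ?case by (simp add: H_fun_eq monom_0 one_pCons)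
next
  case (Suc j)
  have "vector_derivative (\<lambda>x. (- 1) ^ j * H_int \<beta> \<mu> (monom 1 j) x) (at y) = (- 1) ^ Suc j * H_int \<beta> \<mu> (monom 1 (Suc j)) y" for y
  proof (rule vector_derivative_at)
    have "((\<lambda>x. (- 1) ^ j * H_int \<beta> \<mu> (monom 1 j) x) has_vector_derivative (- 1) ^ j * - H_int \<beta> \<mu> (pCons 0 (monom 1 j)) y) (at y)"
      by (intro derivative_intros H_int_has_vector_derivative)
    then show "((\<lambda>x. (- 1) ^ j * H_int \<beta> \<mu> (monom 1 j) x) has_vector_derivative (- 1) ^ Suc j * H_int \<beta> \<mu> (monom 1 (Suc j)) y) (at y)"
      by (simp add: monom_Suc)
  qed
  with Suc show ?case by simp
qed

text \<open>The sign from each differentiation cancels the sign in \<open>poly_neg_deriv\<close>, so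
  only the multiplier \<open>P\<close> evaluated at \<i> * \<theta> remains.\<close>

lemma poly_neg_deriv_H_fun: "poly_neg_deriv P (H_fun \<beta> \<mu>) = H_int \<beta> \<mu> P"
proof
  fix x
  have "poly_neg_deriv P (H_fun \<beta> \<mu>) x = (\<Sum>j\<le>degree P. coeff P j * H_int \<beta> \<mu> (monom 1 j) x)"
    unfolding poly_neg_deriv_def higher_vector_derivative_H_fun
    by (intro sum.cong) (simp_all add: mult.assoc flip: power_mult_distrib)
  also have "\<dots> = 1 / (2 * pi) * (\<Sum>j\<le>degree P. LINT \<theta>|lborel. coeff P j * (gauss_poly \<beta> \<mu> (monom 1 j) (of_real \<theta>) * exp (- \<i> * x * \<theta>)))"
    by (simp add: H_int_def sum_distrib_left mult_ac)
  also have "(\<Sum>j\<le>degree P. LINT \<theta>|lborel. coeff P j * (gauss_poly \<beta> \<mu> (monom 1 j) (of_real \<theta>) * exp (- \<i> * x * \<theta>)))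
     = (LINT \<theta>|lborel. (\<Sum>j\<le>degree P. coeff P j * (gauss_poly \<beta> \<mu> (monom 1 j) (of_real \<theta>) * exp (- \<i> * x * \<theta>))))"
    by (rule Bochner_Integration.integral_sum[symmetric]) (intro integrable_mult_right integrable_gauss_poly)
  also have "(\<lambda>\<theta>::real. \<Sum>j\<le>degree P. coeff P j * (gauss_poly \<beta> \<mu> (monom 1 j) (of_real \<theta>) * exp (- \<i> * x * \<theta>)))
      = (\<lambda>\<theta>. gauss_poly \<beta> \<mu> P (of_real \<theta>) * exp (- \<i> * x * \<theta>))"
    by (simp add: gauss_poly_def poly_altdef[of P] poly_monom sum_distrib_right mult.assoc)
  finally show "poly_neg_deriv P (H_fun \<beta> \<mu>) x = H_int \<beta> \<mu> P x" by (simp add: H_int_def)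
qed

text \<open>Truncate to \<open>{-T..T}\<close>, shift the contour there and let \<open>T\<close>
  tend to infinity. Truncation and vertical sides contribute \<open>2 * C * exp (- T)\<close> each
  and disappear in the limit.\<close>

lemma H_int_decay: "\<exists>C>0. \<forall>x. norm (H_int \<beta> \<mu> P x) \<le> C * exp (- \<bar>x\<bar>)"
proof -
  obtain C where C: "C > 0" "\<And>z. \<bar>Im z\<bar> \<le> 1 \<Longrightarrow> norm (gauss_poly \<beta> \<mu> P z) \<le> C * exp (- \<bar>Re z\<bar>)"
    using gauss_poly_decay by blast
  have "norm (H_int \<beta> \<mu> P x) \<le> 2 * C * exp (- \<bar>x\<bar>)" for x
  proof -
    let ?f = "\<lambda>\<theta>::real. gauss_poly \<beta> \<mu> P (of_real \<theta>) * exp (- \<i> * x * \<theta>)"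
    have "norm (LINT \<theta>|lborel. ?f \<theta>) \<le> 2 * C * exp (- \<bar>x\<bar>) + 4 * C * exp (- T)" if T: "T \<ge> 0" for T
    proof -
      have "norm ((LINT \<theta>|lborel. ?f \<theta>) - integral {-T..T} ?f) \<le> 2 * C * exp (- T)"
      proof (rule exp_decay_truncation[OF _ _ T])
        show "continuous_on UNIV ?f"
          by (intro continuous_intros continuous_on_compose2[OF continuous_gauss_poly[of UNIV]]) auto
        show "norm (?f t) \<le> C * exp (- \<bar>t\<bar>)" for t
          using C(2)[of "of_real t"] by (simp add: norm_mult)
      qed
      moreover have "norm (integral {-T..T} ?f) \<le> 2 * C * (exp (- \<bar>x\<bar>) + exp (- T))"
        by (rule contour_shift_bound[OF holomorphic_gauss_poly[of _ _ _ UNIV] _ _ T]) (use C in auto)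
      ultimately show ?thesis
        using norm_triangle_sub[of "LINT \<theta>|lborel. ?f \<theta>" "integral {-T..T} ?f"] by (simp add: algebra_simps)
    qed
    then have "\<forall>\<^sub>F T in at_top. norm (LINT \<theta>|lborel. ?f \<theta>) \<le> 2 * C * exp (- \<bar>x\<bar>) + 4 * C * exp (- T)"
      by (intro eventually_mono[OF eventually_ge_at_top[of 0]])
    moreover have "((\<lambda>T::real. 2 * C * exp (- \<bar>x\<bar>) + 4 * C * exp (- T)) \<longlongrightarrow> 2 * C * exp (- \<bar>x\<bar>)) at_top"
      by real_asymp
    ultimately have le: "norm (LINT \<theta>|lborel. ?f \<theta>) \<le> 2 * C * exp (- \<bar>x\<bar>)"
      by (intro tendsto_lowerbound) auto
    have "norm (H_int \<beta> \<mu> P x) = 1 / (2 * pi) * norm (LINT \<theta>|lborel. ?f \<theta>)"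
      by (simp add: H_int_def norm_mult norm_divide)
    also have "\<dots> \<le> 1 * norm (LINT \<theta>|lborel. ?f \<theta>)"
      by (rule mult_right_mono[OF inverse_2pi_le_1 norm_ge_zero])
    finally show ?thesis using le by simp
  qed
  with C(1) show ?thesis by (intro exI[of _ "2 * C"]) auto
qed

end

section \<open>The kernel near one maximum point\<close>

text \<open>The constant term of the generating series is 1, so the leading profile is the term
  \<open>m = 0\<close> and all orders can be treated alike.\<close>

lemma H_seq0_eq: "H_seq0 F \<kappa> \<alpha> \<beta> \<mu> n = H_seq F \<kappa> \<alpha> \<beta> \<mu> 0 n"
  by (rule ext) (simp add: H_seq0_def H_seq_def expansion_poly_0 poly_neg_deriv_def)

lemma powr_div_eq_power:
  assumes "n \<ge> 1"
  shows "real n powr ((real m + 1) / (2 * real \<mu>)) = (real n powr (1 / (2 * real \<mu>))) ^ (m + 1)"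
  using assms by (simp add: powr_powr add_divide_distrib powr_add mult.commute flip: powr_realpow)

context gauss
begin

lemma root_power: "n \<ge> 1 \<Longrightarrow> (real n powr (1 / (2 * real \<mu>))) ^ (2 * \<mu>) = real n"
  using \<mu> by (simp add: powr_powr flip: powr_realpow)

lemma root_ge_1: "n \<ge> 1 \<Longrightarrow> real n powr (1 / (2 * real \<mu>)) \<ge> 1"
  by (intro ge_one_powr_ge_zero) auto

lemma H_seq_eq:
  assumes "n \<ge> 1"
  defines "N \<equiv> real n powr (1 / (2 * real \<mu>))"
  shows "H_seq F \<kappa> \<alpha> \<beta> \<mu> m n l = \<kappa> powi (- l) * F \<kappa> ^ n / of_real (N ^ (m + 1)) *
     H_int \<beta> \<mu> (expansion_poly (cumulants F \<kappa> \<alpha> \<beta> \<mu>) \<mu> m) ((real_of_int l - \<alpha> * real n) / N)"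
  unfolding H_seq_def poly_neg_deriv_H_fun powr_div_eq_power[OF assms(1)] N_def ..

lemma H_seq_decay:
  assumes "norm \<kappa> = 1" "norm (F \<kappa>) = 1"
  shows "\<exists>C>0. \<forall>n\<ge>1. \<forall>l. norm (H_seq F \<kappa> \<alpha> \<beta> \<mu> m n l)
     \<le> C * exp (- \<bar>real_of_int l - \<alpha> * real n\<bar> / real n powr (1 / (2 * real \<mu>)))"
proof -
  obtain C where C: "C > 0" "\<And>x. norm (H_int \<beta> \<mu> (expansion_poly (cumulants F \<kappa> \<alpha> \<beta> \<mu>) \<mu> m) x) \<le> C * exp (- \<bar>x\<bar>)"
    using H_int_decay by blast
  have "norm (H_seq F \<kappa> \<alpha> \<beta> \<mu> m n l)
     \<le> C * exp (- \<bar>real_of_int l - \<alpha> * real n\<bar> / real n powr (1 / (2 * real \<mu>)))" if n: "n \<ge> 1" for n l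
  proof -
    define N where "N = real n powr (1 / (2 * real \<mu>))"
    have N: "N \<ge> 1" unfolding N_def by (rule root_ge_1[OF n])
    let ?x = "(real_of_int l - \<alpha> * real n) / N"
    have "norm (H_seq F \<kappa> \<alpha> \<beta> \<mu> m n l) = 1 / N ^ (m + 1) * norm (H_int \<beta> \<mu> (expansion_poly (cumulants F \<kappa> \<alpha> \<beta> \<mu>) \<mu> m) ?x)"
      using N assms unfolding H_seq_eq[OF n] N_def[symmetric]
      by (simp add: norm_mult norm_divide norm_power norm_power_int)
    also have "\<dots> \<le> 1 * (C * exp (- \<bar>?x\<bar>))"
      using one_le_power[OF N, of "m + 1"] by (intro mult_mono C) (auto simp del: power_Suc)
    finally show ?thesis using N by (simp add: N_def abs_divide)
  qed
  with C(1) show ?thesis by blast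
qed

text \<open>The first error term is the Taylor remainder after the contour shift: M + 1 powers of 1
  / N from the remainder and one from the change of variables. The second collects the vertical
  sides and the truncation of the \<open>H\<close> integrals. Every small \<delta> is allowed
  because a common radius for all maximum points is fixed only later.\<close>

lemma local_kernel:
  fixes F :: "complex \<Rightarrow> complex" and \<kappa> :: complex and \<alpha> :: real and M :: nat
  defines "\<gamma> \<equiv> cumulants F \<kappa> \<alpha> \<beta> \<mu>"
  assumes \<kappa>: "norm \<kappa> = 1" "norm (F \<kappa>) = 1" and \<gamma>0: "\<gamma> (2 * \<mu>) = 0"
    and \<rho>: "\<rho> > 0" and S: "S holomorphic_on ball 0 \<rho>"
    and fps: "S has_fps_expansion Abs_fps (\<lambda>\<nu>. \<gamma> (2 * \<mu> + \<nu>) / fact (2 * \<mu> + \<nu>))" and S0: "S 0 = 0"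
    and F: "\<And>\<xi>. norm \<xi> < \<rho> \<Longrightarrow> F (\<kappa> * exp (\<i> * \<xi>)) =
       F \<kappa> * exp (\<i> * \<alpha> * \<xi> - \<beta> * \<xi> ^ (2 * \<mu>) + (\<i> * \<xi>) ^ (2 * \<mu>) * S (\<i> * \<xi>))"
  shows "\<exists>\<delta>0>0. \<forall>\<delta>. 0 < \<delta> \<and> \<delta> \<le> \<delta>0 \<longrightarrow> (\<exists>C>0. \<forall>\<^sub>F n in sequentially. \<forall>l.
     norm (\<kappa> powi (- l) / (2 * pi) * integral {-\<delta>..\<delta>} (\<lambda>\<xi>. F (\<kappa> * cis \<xi>) ^ n * cis (- of_int l * \<xi>))
        - (\<Sum>m\<le>M. H_seq F \<kappa> \<alpha> \<beta> \<mu> m n l))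
     \<le> C * (exp (- \<bar>real_of_int l - \<alpha> * real n\<bar> / real n powr (1 / (2 * real \<mu>)))
           / (real n powr (1 / (2 * real \<mu>))) ^ (M + 2)
         + exp (- \<delta> * real n powr (1 / (2 * real \<mu>)))))"
proof -
  define P where "P = expansion_poly \<gamma> \<mu>"
  obtain \<epsilon> where \<epsilon>: "\<epsilon> > 0" and
    sd: "\<And>d. \<exists>C>0. \<forall>z. \<bar>Im z\<bar> \<le> 1 \<longrightarrow>
       (1 + norm z) ^ d * exp (\<epsilon> * norm z ^ (2 * \<mu>)) * norm (exp (- \<beta> * z ^ (2 * \<mu>))) \<le> C * exp (- \<bar>Re z\<bar>)"
    using strip_decay[OF \<beta> \<mu>] by blast
  obtain C0 where C0: "C0 > 0" "\<And>z. \<bar>Im z\<bar> \<le> 1 \<Longrightarrow>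
       (1 + norm z) ^ (M + 1) * exp (\<epsilon> * norm z ^ (2 * \<mu>)) * norm (exp (- \<beta> * z ^ (2 * \<mu>))) \<le> C0 * exp (- \<bar>Re z\<bar>)"
    using sd[of "M + 1"] by blast
  have "isCont S 0"
    using S \<rho> by (meson centre_in_ball continuous_on_eq_continuous_at holomorphic_on_imp_continuous_on open_ball)
  then obtain d where d: "d > 0" "\<And>w. norm w < d \<Longrightarrow> norm (S w) < \<epsilon>"
    using \<epsilon> S0 unfolding continuous_at_eps_delta by (metis dist_0_norm dist_commute)
  \<comment> \<open>Halving places the closed disc inside the domain of \<open>S\<close> and inside
    the region where \<open>S\<close> is below the \<epsilon> supplied by
    \<open>strip_decay\<close>.\<close>
  define \<delta>1 where "\<delta>1 = min d \<rho> / 2"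
  have \<delta>1: "\<delta>1 > 0" "\<delta>1 < \<rho>" "\<And>w. norm w \<le> \<delta>1 \<Longrightarrow> norm (S w) \<le> \<epsilon>"
    using d \<rho> by (auto simp: \<delta>1_def intro!: less_imp_le[OF d(2)])
  have "\<exists>C. \<forall>m. C m > 0 \<and> (\<forall>z. \<bar>Im z\<bar> \<le> 1 \<longrightarrow> norm (gauss_poly \<beta> \<mu> (P m) z) \<le> C m * exp (- \<bar>Re z\<bar>))"
    using gauss_poly_decay by (intro choice) blast
  then obtain C2 where C2: "\<And>m. C2 m > 0"
    "\<And>m z. \<bar>Im z\<bar> \<le> 1 \<Longrightarrow> norm (gauss_poly \<beta> \<mu> (P m) z) \<le> C2 m * exp (- \<bar>Re z\<bar>)" by blast
  define C1 where "C1 = 2 * C0 / \<delta>1 ^ (M + 1)"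
  define CV where "CV = (\<Sum>m\<le>M. C2 m)"
  have pos: "C1 > 0" "CV > 0" using C0(1) C2(1) \<delta>1(1) by (auto simp: C1_def CV_def intro!: sum_pos)
  have main: "norm (\<kappa> powi (- l) / (2 * pi) * integral {-\<delta>..\<delta>} (\<lambda>\<xi>. F (\<kappa> * cis \<xi>) ^ n * cis (- of_int l * \<xi>))
        - (\<Sum>m\<le>M. H_seq F \<kappa> \<alpha> \<beta> \<mu> m n l))
     \<le> (2 * C1 + 2 * CV) * (exp (- \<bar>real_of_int l - \<alpha> * real n\<bar> / N) / N ^ (M + 2) + exp (- \<delta> * N))"
    if \<delta>: "0 < \<delta>" "\<delta> \<le> \<delta>1 / 4" and n: "n \<ge> 1" and N_def: "N = real n powr (1 / (2 * real \<mu>))" and N8: "N \<ge> 8 / \<delta>1"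
    for \<delta> N :: real and n l
  proof -
    have N1: "N \<ge> 1" using root_ge_1[OF n] by (simp add: N_def)
    \<comment> \<open>The endpoint of the arc in the scaled variable t = N * \<xi>.\<close>
    define T where "T = \<delta> * N"
    have T: "T \<ge> 0" using \<delta> N1 by (simp add: T_def)
    define x where "x = (real_of_int l - \<alpha> * real n) / N"
    define Z where "Z = complex_of_real (1 / N)"
    \<comment> \<open>Both terms of \<open>\<delta> * N + 2\<close> are at most
      \<open>\<delta>1 / 4 * N\<close>, the first by the choice of \<open>\<delta>\<close>, the
      second because \<open>N\<close> is at least \<open>8 / \<delta>1\<close>. This puts
      \<open>1 / N\<close> in the range of the remainder estimate.\<close>
    have small: "(1 + norm z) / N \<le> \<delta>1 / 2" if "\<bar>Re z\<bar> \<le> T" "\<bar>Im z\<bar> \<le> 1" for z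
    proof -
      have "1 + norm z \<le> \<delta> * N + 2" using cmod_le[of z] that by (simp add: T_def)
      also have "\<dots> \<le> \<delta>1 / 4 * N + \<delta>1 / 4 * N"
        using \<delta> N1 N8 \<delta>1(1) by (intro add_mono mult_right_mono) (auto simp: field_simps)
      finally show ?thesis using N1 by (simp add: field_simps)
    qed
    \<comment> \<open>\<open>E\<close> is the scaled n-th power of the symbol without its linear
      phase, \<open>V\<close> its truncated expansion in \<open>Z = 1 / N\<close>, and
      \<open>W\<close> the remainder to which the contour shift applies.\<close>
    define E where "E = (\<lambda>z. exp (- \<beta> * z ^ (2 * \<mu>)) * exp ((\<i> * z) ^ (2 * \<mu>) * S (\<i> * z * Z)))"
    define V where "V = (\<lambda>z. \<Sum>m\<le>M. gauss_poly \<beta> \<mu> (P m) z * Z ^ m)"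
    define W where "W = (\<lambda>z. E z - V z)"
    have W: "W z = exp (- \<beta> * z ^ (2 * \<mu>)) *
        (exp ((\<i> * z) ^ (2 * \<mu>) * S (\<i> * z * Z)) - (\<Sum>m\<le>M. poly (P m) (\<i> * z) * Z ^ m))" for z
      by (simp add: W_def E_def V_def gauss_poly_def ring_distribs sum_distrib_left mult_ac)
    have inU: "norm (\<i> * z * Z) < \<rho>" if "norm z < \<rho> * N" for z
      using that N1 by (simp add: Z_def norm_mult norm_divide field_simps)
    have holW: "W holomorphic_on ball 0 (\<rho> * N)"
      unfolding W_def E_def V_def using inU
      by (intro holomorphic_intros holomorphic_gauss_poly holomorphic_on_compose_gen[OF _ S, unfolded o_def]) auto
    have sub: "z \<in> ball 0 (\<rho> * N)" if "\<bar>Re z\<bar> \<le> T" "\<bar>Im z\<bar> \<le> 1" for z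
    proof -
      have "norm z \<le> \<delta>1 / 2 * N" using small[OF that] N1 by (simp add: field_simps)
      also have "\<dots> < \<rho> * N" using \<delta>1 N1 by (intro mult_strict_right_mono) auto
      finally show ?thesis by simp
    qed
    \<comment> \<open>The remainder estimate with Y = \<i> * z costs the growth in \<epsilon> and M
      + 1 powers of \<open>1 + norm z\<close>; \<open>C0\<close> was obtained for exactly this
      combination.\<close>
    have Wle: "norm (W z) \<le> C1 / N ^ (M + 1) * exp (- \<bar>Re z\<bar>)" if z: "\<bar>Re z\<bar> \<le> T" "\<bar>Im z\<bar> \<le> 1" for z
    proof -
      have mx: "norm Z * max 1 (norm (\<i> * z)) \<le> (1 + norm z) / N"
        using N1 by (simp add: Z_def norm_mult norm_divide divide_right_mono)
      have "norm (W z) \<le> norm (exp (- \<beta> * z ^ (2 * \<mu>))) *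
          (2 * exp (\<epsilon> * norm (\<i> * z) ^ (2 * \<mu>)) * (norm Z * max 1 (norm (\<i> * z)) / \<delta>1) ^ (M + 1))"
        unfolding W norm_mult[of "exp (- \<beta> * z ^ (2 * \<mu>))"] P_def
        by (rule mult_left_mono[OF expansion_poly_remainder[OF S fps \<gamma>0 \<delta>1 order_trans[OF mx small[OF z]]] norm_ge_zero])
      also have "\<dots> \<le> norm (exp (- \<beta> * z ^ (2 * \<mu>))) *
          (2 * exp (\<epsilon> * norm (\<i> * z) ^ (2 * \<mu>)) * ((1 + norm z) / N / \<delta>1) ^ (M + 1))"
        using \<delta>1(1) by (intro mult_left_mono power_mono divide_right_mono mx) auto
      also have "\<dots> = 2 / (\<delta>1 * N) ^ (M + 1) *
          ((1 + norm z) ^ (M + 1) * exp (\<epsilon> * norm z ^ (2 * \<mu>)) * norm (exp (- \<beta> * z ^ (2 * \<mu>))))"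
        by (simp only: power_divide power_mult_distrib divide_divide_eq_left norm_mult norm_ii mult_1) (simp add: mult_ac)
      also have "\<dots> \<le> 2 / (\<delta>1 * N) ^ (M + 1) * (C0 * exp (- \<bar>Re z\<bar>))"
        using \<delta>1(1) N1 by (intro mult_left_mono C0(2) z) auto
      finally show ?thesis by (simp add: C1_def power_mult_distrib mult_ac)
    qed
    let ?e = "\<lambda>t::real. exp (- \<i> * x * t)"
    have shift: "norm (integral {-T..T} (\<lambda>t. W (of_real t) * ?e t)) \<le> 2 * (C1 / N ^ (M + 1)) * (exp (- \<bar>x\<bar>) + exp (- T))"
      by (rule contour_shift_bound[OF holW _ _ T sub Wle]) auto
    have contV: "continuous_on UNIV V"
      unfolding V_def by (intro continuous_intros continuous_gauss_poly)
    have Vle: "norm (V (of_real t)) \<le> CV * exp (- \<bar>t\<bar>)" for t :: real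
    proof -
      have "norm (V (of_real t)) \<le> (\<Sum>m\<le>M. C2 m * exp (- \<bar>t\<bar>))"
        unfolding V_def
      proof (rule sum_norm_le)
        fix m
        have "norm (gauss_poly \<beta> \<mu> (P m) (of_real t) * Z ^ m) \<le> (C2 m * exp (- \<bar>t\<bar>)) * 1"
          unfolding norm_mult norm_power using C2(2)[of "of_real t" m] C2(1)[of m] N1
          by (intro mult_mono power_le_one) (auto simp: Z_def norm_divide)
        then show "norm (gauss_poly \<beta> \<mu> (P m) (of_real t) * Z ^ m) \<le> C2 m * exp (- \<bar>t\<bar>)" by simp
      qed
      then show ?thesis by (simp add: CV_def sum_distrib_right)
    qed
    let ?Ve = "\<lambda>t::real. V (of_real t) * ?e t"
    have contVe: "continuous_on UNIV ?Ve"
      by (intro continuous_intros continuous_on_compose2[OF contV]) auto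
    have trunc: "norm ((LINT t|lborel. ?Ve t) - integral {-T..T} ?Ve) \<le> 2 * CV * exp (- T)"
      by (rule exp_decay_truncation[OF contVe _ T]) (use Vle in \<open>simp add: norm_mult\<close>)
    define A where "A = \<kappa> powi (- l) * F \<kappa> ^ n / (2 * pi * N)"
    have nA: "norm A \<le> 1 / N"
    proof -
      have "norm A = 1 / (2 * pi) * (1 / N)"
        using \<kappa> N1 by (simp add: A_def norm_mult norm_divide norm_power norm_power_int)
      also have "\<dots> \<le> 1 * (1 / N)" using N1 by (intro mult_right_mono inverse_2pi_le_1) auto
      finally show ?thesis by simp
    qed
    have H: "(\<Sum>m\<le>M. H_seq F \<kappa> \<alpha> \<beta> \<mu> m n l) = A * (LINT t|lborel. ?Ve t)"
    proof -
      have "(LINT t|lborel. ?Ve t) = (LINT t|lborel. (\<Sum>m\<le>M. Z ^ m * (gauss_poly \<beta> \<mu> (P m) (of_real t) * ?e t)))"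
        by (simp add: V_def sum_distrib_left sum_distrib_right mult_ac)
      also have "\<dots> = (\<Sum>m\<le>M. Z ^ m * (LINT t|lborel. gauss_poly \<beta> \<mu> (P m) (of_real t) * ?e t))"
        by (simp only: Bochner_Integration.integral_sum[OF integrable_mult_right[OF integrable_gauss_poly]] integral_mult_right_zero)
      finally have "A * (LINT t|lborel. ?Ve t) = (\<Sum>m\<le>M. A * (Z ^ m * (LINT t|lborel. gauss_poly \<beta> \<mu> (P m) (of_real t) * ?e t)))"
        by (simp only: sum_distrib_left)
      also have "\<dots> = (\<Sum>m\<le>M. H_seq F \<kappa> \<alpha> \<beta> \<mu> m n l)"
      proof (rule sum.cong[OF refl])
        fix m
        show "A * (Z ^ m * (LINT t|lborel. gauss_poly \<beta> \<mu> (P m) (of_real t) * ?e t)) = H_seq F \<kappa> \<alpha> \<beta> \<mu> m n l"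
          unfolding H_seq_eq[OF n] H_int_def A_def Z_def P_def \<gamma>_def N_def[symmetric] x_def[symmetric]
          by (simp add: power_divide mult_ac)
      qed
      finally show ?thesis by simp
    qed
    have holE: "E holomorphic_on ball 0 (\<rho> * N)"
      unfolding E_def using inU
      by (intro holomorphic_intros holomorphic_on_compose_gen[OF _ S, unfolded o_def]) auto
    have iE: "(\<lambda>t. E (of_real t) * ?e t) integrable_on {-T..T}"
      by (intro integrable_continuous_real continuous_intros
          continuous_on_compose2[OF holomorphic_on_imp_continuous_on[OF holE]])
        (use sub[of "of_real _"] in auto)
    define f where "f = (\<lambda>\<xi>. F (\<kappa> * cis \<xi>) ^ n * cis (- of_int l * \<xi>))"
    have point: "f (1 / N * t) = F \<kappa> ^ n * (E (of_real t) * ?e t)" if t: "t \<in> {-T..T}" for t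
    proof -
      define \<xi> where "\<xi> = complex_of_real (1 / N * t)"
      have "\<bar>t\<bar> / N \<le> \<delta>" using t N1 by (auto simp: T_def field_simps)
      then have "norm \<xi> < \<rho>" using \<delta> \<delta>1 N1 by (simp add: \<xi>_def norm_mult norm_divide)
      from F[OF this] have "F (\<kappa> * cis (1 / N * t)) =
         F \<kappa> * exp (\<i> * \<alpha> * \<xi> - \<beta> * \<xi> ^ (2 * \<mu>) + (\<i> * \<xi>) ^ (2 * \<mu>) * S (\<i> * \<xi>))"
        by (simp only: cis_conv_exp \<xi>_def)
      then have "f (1 / N * t) = F \<kappa> ^ n *
         (exp (of_nat n * (\<i> * \<alpha> * \<xi> - \<beta> * \<xi> ^ (2 * \<mu>) + (\<i> * \<xi>) ^ (2 * \<mu>) * S (\<i> * \<xi>)))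
          * exp (\<i> * of_real (- of_int l * (1 / N * t))))"
        by (simp only: f_def power_mult_distrib exp_of_nat_mult cis_conv_exp mult.assoc)
      also have "exp (of_nat n * (\<i> * \<alpha> * \<xi> - \<beta> * \<xi> ^ (2 * \<mu>) + (\<i> * \<xi>) ^ (2 * \<mu>) * S (\<i> * \<xi>)))
          * exp (\<i> * of_real (- of_int l * (1 / N * t))) = E (of_real t) * ?e t"
      proof -
        \<comment> \<open>The scaling is chosen so that the factor \<open>n\<close> from the n-th
          power is absorbed by the terms of degree \<open>2 * \<mu>\<close>.\<close>
        have nN: "of_nat n = complex_of_real N ^ (2 * \<mu>)"
          using root_power[OF n] by (simp add: N_def flip: of_real_power)
        have N\<xi>: "of_real N * \<xi> = of_real t" using N1 by (simp add: \<xi>_def)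
        have \<xi>Z: "\<i> * \<xi> = \<i> * of_real t * Z" by (simp add: \<xi>_def Z_def)
        have p: "of_nat n * \<xi> ^ (2 * \<mu>) = of_real t ^ (2 * \<mu>)"
          "of_nat n * (\<i> * \<xi>) ^ (2 * \<mu>) = (\<i> * of_real t) ^ (2 * \<mu>)"
          unfolding nN by (simp_all only: power_mult_distrib[symmetric] N\<xi> mult.left_commute[of _ \<i>])
        \<comment> \<open>The drift of the symbol and the Fourier phase combine into a single phase;
          this is where the profile variable \<open>x\<close> comes from.\<close>
        have lin: "of_nat n * (\<i> * \<alpha> * \<xi>) + \<i> * of_real (- of_int l * (1 / N * t)) = - \<i> * x * t"
          using N1 by (simp add: \<xi>_def x_def field_simps)
        have "of_nat n * (\<i> * \<alpha> * \<xi> - \<beta> * \<xi> ^ (2 * \<mu>) + (\<i> * \<xi>) ^ (2 * \<mu>) * S (\<i> * \<xi>))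
            + \<i> * of_real (- of_int l * (1 / N * t))
          = (of_nat n * (\<i> * \<alpha> * \<xi>) + \<i> * of_real (- of_int l * (1 / N * t)))
            - \<beta> * (of_nat n * \<xi> ^ (2 * \<mu>)) + (of_nat n * (\<i> * \<xi>) ^ (2 * \<mu>)) * S (\<i> * \<xi>)"
          by (simp only: ring_distribs mult.assoc mult.left_commute[of _ \<beta>]) simp
        also have "\<dots> = - \<beta> * of_real t ^ (2 * \<mu>) + (\<i> * of_real t) ^ (2 * \<mu>) * S (\<i> * of_real t * Z) + - \<i> * x * t"
          unfolding lin p by (simp only: \<xi>Z) simp
        finally show ?thesis unfolding E_def by (simp only: exp_add[symmetric])
      qed
      finally show ?thesis .
    qed
    have img: "(\<lambda>\<xi>. \<xi> / (1 / N)) ` {-\<delta>..\<delta>} = {-T..T}"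
      using image_mult_atLeastAtMost[of N "-\<delta>" \<delta>] N1 by (simp add: T_def mult.commute)
    have "integral {-T..T} (\<lambda>t. f (1 / N * t)) = (1 / \<bar>1 / N\<bar>) *\<^sub>R integral {-\<delta>..\<delta>} f"
      unfolding img[symmetric] by (rule integral_stretch_real) (use N1 in simp)
    then have "N *\<^sub>R integral {-\<delta>..\<delta>} f = integral {-T..T} (\<lambda>t. f (1 / N * t))" using N1 by simp
    also have "\<dots> = integral {-T..T} (\<lambda>t. F \<kappa> ^ n * (E (of_real t) * ?e t))"
      by (rule Henstock_Kurzweil_Integration.integral_cong) (rule point)
    also have "\<dots> = F \<kappa> ^ n * integral {-T..T} (\<lambda>t. E (of_real t) * ?e t)"
      by (rule integral_mult_right)
    finally have "N *\<^sub>R integral {-\<delta>..\<delta>} f = F \<kappa> ^ n * integral {-T..T} (\<lambda>t. E (of_real t) * ?e t)" .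
    then have "integral {-\<delta>..\<delta>} f = F \<kappa> ^ n * integral {-T..T} (\<lambda>t. E (of_real t) * ?e t) / of_real N"
      using N1 by (simp add: scaleR_conv_of_real field_simps)
    then have arc: "\<kappa> powi (- l) / (2 * pi) * integral {-\<delta>..\<delta>} (\<lambda>\<xi>. F (\<kappa> * cis \<xi>) ^ n * cis (- of_int l * \<xi>))
       = A * integral {-T..T} (\<lambda>t. E (of_real t) * ?e t)"
      unfolding f_def[symmetric] by (simp add: A_def)
    have iV: "?Ve integrable_on {-T..T}"
      by (rule integrable_continuous_real[OF continuous_on_subset[OF contVe]]) simp
    have "integral {-T..T} (\<lambda>t. W (of_real t) * ?e t) = integral {-T..T} (\<lambda>t. E (of_real t) * ?e t) - integral {-T..T} ?Ve"
      unfolding W_def left_diff_distrib by (rule Henstock_Kurzweil_Integration.integral_diff[OF iE iV])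
    then have "\<kappa> powi (- l) / (2 * pi) * integral {-\<delta>..\<delta>} (\<lambda>\<xi>. F (\<kappa> * cis \<xi>) ^ n * cis (- of_int l * \<xi>))
        - (\<Sum>m\<le>M. H_seq F \<kappa> \<alpha> \<beta> \<mu> m n l)
      = A * (integral {-T..T} (\<lambda>t. W (of_real t) * ?e t) - ((LINT t|lborel. ?Ve t) - integral {-T..T} ?Ve))"
      unfolding arc H by (simp only: right_diff_distrib) simp
    then have "norm (\<kappa> powi (- l) / (2 * pi) * integral {-\<delta>..\<delta>} (\<lambda>\<xi>. F (\<kappa> * cis \<xi>) ^ n * cis (- of_int l * \<xi>))
        - (\<Sum>m\<le>M. H_seq F \<kappa> \<alpha> \<beta> \<mu> m n l))
      = norm A * norm (integral {-T..T} (\<lambda>t. W (of_real t) * ?e t) - ((LINT t|lborel. ?Ve t) - integral {-T..T} ?Ve))"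
      by (simp only: norm_mult)
    also have "\<dots> \<le> 1 / N * (2 * (C1 / N ^ (M + 1)) * (exp (- \<bar>x\<bar>) + exp (- T)) + 2 * CV * exp (- T))"
      using order_trans[OF norm_triangle_ineq4 add_mono[OF shift trunc]] N1 by (intro mult_mono nA) auto
    also have "\<dots> = 2 * C1 * (exp (- \<bar>x\<bar>) / N ^ (M + 2)) + (2 * C1 / N ^ (M + 2) + 2 * CV / N) * exp (- T)"
      using N1 by (simp add: field_simps)
    \<comment> \<open>Negative powers of \<open>N\<close> in front of \<open>exp (- T)\<close> are
      given away, since that factor is already smaller than every power of
      \<open>1 / N\<close>.\<close>
    also have "\<dots> \<le> (2 * C1 + 2 * CV) * (exp (- \<bar>x\<bar>) / N ^ (M + 2)) + (2 * C1 / 1 + 2 * CV / 1) * exp (- T)"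
      using pos N1 by (intro add_mono mult_right_mono divide_left_mono one_le_power) (auto simp: zero_less_mult_iff)
    also have "\<dots> = (2 * C1 + 2 * CV) * (exp (- \<bar>real_of_int l - \<alpha> * real n\<bar> / N) / N ^ (M + 2) + exp (- \<delta> * N))"
      using N1 by (simp add: x_def T_def abs_divide distrib_left)
    finally show ?thesis .
  qed
  have "filterlim (\<lambda>n. real n powr (1 / (2 * real \<mu>))) at_top sequentially"
    using \<mu> by real_asymp
  then have "\<forall>\<^sub>F n in sequentially. real n powr (1 / (2 * real \<mu>)) \<ge> 8 / \<delta>1"
    by (simp add: filterlim_at_top)
  then have ev: "\<forall>\<^sub>F n in sequentially. n \<ge> 1 \<and> real n powr (1 / (2 * real \<mu>)) \<ge> 8 / \<delta>1"
    using eventually_ge_at_top[of 1] by eventually_elim simp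
  show ?thesis
    using \<delta>1(1) pos
    by (intro exI[of _ "\<delta>1 / 4"] conjI allI impI exI[of _ "2 * C1 + 2 * CV"] eventually_mono[OF ev] main) auto
qed

end

section \<open>Splitting the circle\<close>

lemma cis_eq_cis_imp:
  assumes "cis s = cis t"
  obtains n :: int where "s = t + 2 * pi * of_int n"
proof -
  have "exp (\<i> * of_real s) = exp (\<i> * of_real t)" using assms by (simp add: cis_conv_exp)
  then obtain n :: int where "\<i> * of_real s = \<i> * of_real t + of_int (2 * n) * pi * \<i>"
    unfolding exp_eq by blast
  then have "Im (\<i> * of_real s) = Im (\<i> * of_real t + of_int (2 * n) * pi * \<i>)" by (rule arg_cong)
  then show ?thesis by (intro that[of n]) simp
qed

lemma circle_representative:
  assumes z: "norm z = 1" and c: "z \<noteq> cis c"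
  obtains t where "c < t" "t < c + 2 * pi" "z = cis t"
proof -
  define m where "m = \<lfloor>(Arg z - c) / (2 * pi)\<rfloor>"
  define t where "t = Arg z - 2 * pi * of_int m"
  have "z \<noteq> 0" using z by auto
  then have "z = cis (Arg z)" using cis_Arg[of z] z by (simp add: sgn_div_norm)
  also have "\<dots> = cis t" by (simp add: t_def flip: cis_divide)
  finally have t: "z = cis t" .
  have "of_int m \<le> (Arg z - c) / (2 * pi)" "(Arg z - c) / (2 * pi) < of_int m + 1"
    unfolding m_def by linarith+
  then have "c \<le> t" "t < c + 2 * pi" by (auto simp: t_def field_simps)
  moreover have "c \<noteq> t" using c t by auto
  ultimately show ?thesis using t that by force
qed

lemma exists_cis_notin_finite:
  assumes "finite A"
  obtains c where "cis c \<notin> A"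
proof -
  have "inj_on cis {0..1}"
  proof (rule inj_onI)
    fix x y :: real assume xy: "x \<in> {0..1}" "y \<in> {0..1}" "cis x = cis y"
    then have "cos x = cos y" by (metis cis.sel(1))
    then show "x = y" using cos_inj_pi[of x y] xy pi_gt3 by auto
  qed
  then have "infinite (cis ` {0..1})" by (subst finite_image_iff) (auto simp: infinite_Icc)
  then have "\<not> cis ` {0..1} \<subseteq> A" using finite_subset[OF _ assms] by blast
  then show ?thesis using that by auto
qed

text \<open>The circle is cut at a point that is not a maximum point, so every maximum point has a
  parameter strictly inside the period and its arc does not wrap around. Off the arcs compactness
  gives a uniform bound below 1.\<close>

lemma circle_split:
  fixes F :: "complex \<Rightarrow> complex" and \<kappa> :: "'i \<Rightarrow> complex" and \<delta>0 :: "'i \<Rightarrow> real"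
  assumes cont: "continuous_on UNIV (\<lambda>t. F (cis t))" and I: "finite I"
    and inj: "inj_on \<kappa> I" and sph: "\<kappa> ` I \<subseteq> sphere 0 1"
    and less: "\<And>z. z \<in> sphere 0 1 - \<kappa> ` I \<Longrightarrow> norm (F z) < 1"
    and \<delta>0: "\<And>k. k \<in> I \<Longrightarrow> \<delta>0 k > 0"
  obtains \<delta> q c where "0 < \<delta>" "\<And>k. k \<in> I \<Longrightarrow> \<delta> \<le> \<delta>0 k" "0 < q" "q < 1"
    "\<And>n (l::int). norm (integral {c..c + 2 * pi} (\<lambda>t. F (cis t) ^ n * cis (- of_int l * t))
       - (\<Sum>k\<in>I. \<kappa> k powi (- l) * integral {-\<delta>..\<delta>} (\<lambda>\<xi>. F (\<kappa> k * cis \<xi>) ^ n * cis (- of_int l * \<xi>))))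
     \<le> 2 * pi * q ^ n"
proof -
  obtain c where c: "cis c \<notin> \<kappa> ` I" by (rule exists_cis_notin_finite[OF finite_imageI[OF I]])
  have "\<exists>t. c < t \<and> t < c + 2 * pi \<and> \<kappa> k = cis t" if "k \<in> I" for k
  proof -
    have "norm (\<kappa> k) = 1" "\<kappa> k \<noteq> cis c" using sph c imageI[OF that, of \<kappa>] by auto
    then show ?thesis by (rule circle_representative) auto
  qed
  then obtain \<theta> where \<theta>: "\<And>k. k \<in> I \<Longrightarrow> c < \<theta> k" "\<And>k. k \<in> I \<Longrightarrow> \<theta> k < c + 2 * pi"
    "\<And>k. k \<in> I \<Longrightarrow> \<kappa> k = cis (\<theta> k)"
    by metis
  have \<theta>_neq: "\<theta> j \<noteq> \<theta> k" if "j \<in> I" "k \<in> I" "j \<noteq> k" for j k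
    using that \<theta>(3) inj by (metis inj_onD)
  have small: "\<forall>\<^sub>F \<delta> in at_right (0::real). \<delta> \<le> x" if "x > 0" for x
    using that by (auto simp: eventually_at_right_field intro!: exI[of _ x])
  have "\<forall>\<^sub>F \<delta> in at_right (0::real). \<delta> > 0 \<and> (\<forall>k\<in>I. \<delta> \<le> \<delta>0 k \<and> \<delta> \<le> \<theta> k - c \<and> \<delta> \<le> c + 2 * pi - \<theta> k
     \<and> (\<forall>j\<in>I - {k}. \<delta> \<le> \<bar>\<theta> j - \<theta> k\<bar> / 3))"
    using \<theta> \<theta>_neq \<delta>0 I
    by (intro eventually_conj eventually_ball_finite ballI small eventually_at_right_less) auto
  from eventually_happens'[OF trivial_limit_at_right_real this]
  obtain \<delta> where D: "\<delta> > 0 \<and> (\<forall>k\<in>I. \<delta> \<le> \<delta>0 k \<and> \<delta> \<le> \<theta> k - c \<and> \<delta> \<le> c + 2 * pi - \<theta> k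
     \<and> (\<forall>j\<in>I - {k}. \<delta> \<le> \<bar>\<theta> j - \<theta> k\<bar> / 3))" ..
  \<comment> \<open>These bounds keep every arc inside the period, and a third of the mutual
    distances makes even the closed arcs disjoint.\<close>
  then have \<delta>: "\<delta> > 0" "\<And>k. k \<in> I \<Longrightarrow> \<delta> \<le> \<delta>0 k" "\<And>k. k \<in> I \<Longrightarrow> \<delta> \<le> \<theta> k - c"
    "\<And>k. k \<in> I \<Longrightarrow> \<delta> \<le> c + 2 * pi - \<theta> k"
    "\<And>j k. j \<in> I \<Longrightarrow> k \<in> I \<Longrightarrow> j \<noteq> k \<Longrightarrow> \<delta> \<le> \<bar>\<theta> j - \<theta> k\<bar> / 3"
    by (simp_all add: Ball_def del: le_divide_eq_numeral1)
  \<comment> \<open>Removing open intervals keeps the remainder compact, so the maximum of the norm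
    over it is attained.\<close>
  define X where "X = {c..c + 2 * pi} - (\<Union>k\<in>I. {\<theta> k - \<delta><..<\<theta> k + \<delta>})"
  have X: "compact X" unfolding X_def by (intro compact_diff) auto
  have "c \<in> X" using \<delta>(3) by (force simp: X_def)
  then have "X \<noteq> {}" by blast
  have "continuous_on X (\<lambda>t. norm (F (cis t)))"
    by (intro continuous_intros continuous_on_subset[OF cont]) auto
  from continuous_attains_sup[OF X \<open>X \<noteq> {}\<close> this]
  obtain t0 where t0: "t0 \<in> X" "\<And>t. t \<in> X \<Longrightarrow> norm (F (cis t)) \<le> norm (F (cis t0))" by blast
  have "norm (F (cis t0)) < 1"
  proof (rule less)
    have "cis t0 \<noteq> \<kappa> k" if k: "k \<in> I" for k
    proof
      assume "cis t0 = \<kappa> k"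
      then have "cis t0 = cis (\<theta> k)" using \<theta>(3)[OF k] by simp
      then obtain m :: int where m: "t0 = \<theta> k + 2 * pi * of_int m" by (rule cis_eq_cis_imp)
      \<comment> \<open>Strict because \<open>\<theta> k\<close> lies in the open period; equal
        points on the circle must then have equal parameters.\<close>
      have "\<bar>t0 - \<theta> k\<bar> < 2 * pi" using t0(1) \<theta>(1,2)[OF k] by (auto simp: X_def)
      then have "2 * pi * \<bar>of_int m\<bar> < 2 * pi * 1" using m by (simp add: abs_mult)
      then have "\<bar>of_int m\<bar> < (1::real)" 
        by (rule mult_left_less_imp_less) simp
      then have "m = 0" by linarith
      then show False using m t0(1) k \<delta>(1) by (auto simp: X_def)
    qed
    then show "cis t0 \<in> sphere 0 1 - \<kappa> ` I" by auto
  qed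
  \<comment> \<open>The maximum with 1 / 2 makes \<open>q\<close> positive even if the symbol
    vanishes on all of \<open>X\<close>.\<close>
  define q where "q = max (1 / 2) (norm (F (cis t0)))"
  have q: "0 < q" "q < 1" using \<open>norm (F (cis t0)) < 1\<close> by (auto simp: q_def)
  have "norm (integral {c..c + 2 * pi} (\<lambda>t. F (cis t) ^ n * cis (- of_int l * t))
       - (\<Sum>k\<in>I. \<kappa> k powi (- l) * integral {-\<delta>..\<delta>} (\<lambda>\<xi>. F (\<kappa> k * cis \<xi>) ^ n * cis (- of_int l * \<xi>))))
     \<le> 2 * pi * q ^ n" for n and l :: int
  proof -
    let ?f = "\<lambda>t. F (cis t) ^ n * cis (- of_int l * t)"
    let ?J = "\<lambda>k. {\<theta> k - \<delta>..\<theta> k + \<delta>}"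
    have contf: "continuous_on A ?f" for A
      by (intro continuous_intros continuous_on_subset[OF cont]) auto
    have arc: "integral (?J k) ?f = \<kappa> k powi (- l) * integral {-\<delta>..\<delta>} (\<lambda>\<xi>. F (\<kappa> k * cis \<xi>) ^ n * cis (- of_int l * \<xi>))"
      if "k \<in> I" for k
    proof -
      have "integral (?J k) ?f = integral {\<theta> k - \<delta> - \<theta> k..\<theta> k + \<delta> - \<theta> k} (\<lambda>\<xi>. ?f (\<xi> + \<theta> k))"
        by (rule integral_shift_real_ivl[symmetric])
      also have "\<dots> = integral {-\<delta>..\<delta>} (\<lambda>\<xi>. \<kappa> k powi (- l) * (F (\<kappa> k * cis \<xi>) ^ n * cis (- of_int l * \<xi>)))"
      proof -
        have "?f (\<xi> + \<theta> k) = \<kappa> k powi (- l) * (F (\<kappa> k * cis \<xi>) ^ n * cis (- of_int l * \<xi>))" for \<xi>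
        proof -
          have "cis (- of_int l * (\<xi> + \<theta> k)) = cis (of_int (- l) * \<theta> k) * cis (- of_int l * \<xi>)"
            by (simp add: cis_mult algebra_simps)
          moreover have "cis (\<xi> + \<theta> k) = \<kappa> k * cis \<xi>" by (simp add: \<theta>(3)[OF that] cis_mult add.commute)
          ultimately show ?thesis by (simp only: \<theta>(3)[OF that] cis_power_int mult_ac)
        qed
        then show ?thesis by simp
      qed
      finally show ?thesis by simp
    qed
    have int: "(?f has_integral integral {c..c + 2 * pi} ?f) {c..c + 2 * pi}"
      by (intro integrable_integral integrable_continuous_real contf)
    have un: "(?f has_integral (\<Sum>k\<in>I. integral (?J k) ?f)) (\<Union>k\<in>I. ?J k)"
    proof (rule has_integral_UN[OF I])
      show "(?f has_integral integral (?J k) ?f) (?J k)" for k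
        by (intro integrable_integral integrable_continuous_real contf)
      have "?J j \<inter> ?J k = {}" if "j \<in> I" "k \<in> I" "j \<noteq> k" for j k
        using \<delta>(5)[OF that] \<delta>(1) by auto
      then show "pairwise (\<lambda>j k. negligible (?J j \<inter> ?J k)) I"
        by (auto simp: pairwise_def)
    qed
    have J: "(\<Union>k\<in>I. ?J k) \<subseteq> {c..c + 2 * pi}" using \<delta>(3,4) by fastforce
    let ?Y = "{c..c + 2 * pi} - (\<Union>k\<in>I. ?J k)"
    have "(?f has_integral (integral {c..c + 2 * pi} ?f - (\<Sum>k\<in>I. integral (?J k) ?f))) ?Y"
      by (rule has_integral_setdiff[OF int un]) (use J in \<open>simp add: Diff_eq_empty_iff[THEN iffD2]\<close>)
    then have "((\<lambda>t. if t \<in> ?Y then ?f t else 0) has_integral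
        (integral {c..c + 2 * pi} ?f - (\<Sum>k\<in>I. integral (?J k) ?f))) (cbox c (c + 2 * pi))"
      by (subst has_integral_restrict) auto
    then have "norm (integral {c..c + 2 * pi} ?f - (\<Sum>k\<in>I. integral (?J k) ?f)) \<le> q ^ n * measure lborel (cbox c (c + 2 * pi))"
    proof (rule has_integral_bound[rotated])
      fix t
      show "norm (if t \<in> ?Y then ?f t else 0) \<le> q ^ n"
      proof (cases "t \<in> ?Y")
        case True
        then have "t \<in> X" unfolding X_def by auto
        then have "norm (F (cis t)) \<le> q" using t0(2)[of t] by (auto simp: q_def)
        then show ?thesis using True by (simp add: norm_mult norm_power power_mono)
      qed (use q in auto)
    qed (use q in auto)
    also have "measure lborel (cbox c (c + 2 * pi)) = 2 * pi" by simp
    also have "(\<Sum>k\<in>I. integral (?J k) ?f) = (\<Sum>k\<in>I. \<kappa> k powi (- l) * integral {-\<delta>..\<delta>}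
        (\<lambda>\<xi>. F (\<kappa> k * cis \<xi>) ^ n * cis (- of_int l * \<xi>)))"
      by (intro sum.cong refl arc)
    finally show ?thesis by (simp only: mult.commute[of "q ^ n"])
  qed
  with \<delta>(1,2) q show ?thesis by (rule that)
qed

section \<open>The error in \<open>\<ell>\<^sup>1\<close>\<close>

text \<open>Summability and bound travel together because \<open>infsum\<close> of a family that is
  not summable is 0, so the inequality alone would carry no information.\<close>

definition sum_le :: "(int \<Rightarrow> real) \<Rightarrow> real \<Rightarrow> bool" where
  "sum_le f c \<longleftrightarrow> f summable_on UNIV \<and> infsum f UNIV \<le> c"

lemma sum_le_add: "sum_le f c \<Longrightarrow> sum_le g d \<Longrightarrow> sum_le (\<lambda>l. f l + g l) (c + d)"
  by (auto simp: sum_le_def infsum_add intro!: summable_on_add)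

lemma sum_le_cmult: "sum_le f c \<Longrightarrow> a \<ge> 0 \<Longrightarrow> sum_le (\<lambda>l. a * f l) (a * c)"
  by (auto simp: sum_le_def infsum_cmult_right' intro!: summable_on_cmult_right mult_left_mono)

lemma sum_le_sum:
  assumes "finite I" "\<And>k. k \<in> I \<Longrightarrow> sum_le (f k) (c k)"
  shows "sum_le (\<lambda>l. \<Sum>k\<in>I. f k l) (\<Sum>k\<in>I. c k)"
  using assms
proof (induction I)
  case empty
  then show ?case by (simp add: sum_le_def)
next
  case (insert k I)
  then show ?case using sum_le_add[of "f k" "c k" "\<lambda>l. \<Sum>k\<in>I. f k l"] by simp
qed

lemma sum_le_square_window:
  assumes "c \<ge> 0"
  shows "sum_le (\<lambda>l. if \<bar>l\<bar> \<le> int n ^ 2 then c else 0) ((2 * real n ^ 2 + 1) * c)"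
proof -
  have "((\<lambda>l. if \<bar>l\<bar> \<le> int n ^ 2 then c else 0) has_sum (\<Sum>l\<in>{- (int n ^ 2)..int n ^ 2}. c)) UNIV"
    by (rule has_sum_finite_neutralI[of "{- (int n ^ 2)..int n ^ 2}"]) (auto simp: abs_le_iff)
  moreover have "real (nat (1 + int n ^ 2 * 2)) = 2 * real n ^ 2 + 1"
    by (simp add: nat_add_distrib nat_mult_distrib nat_power_eq)
  ultimately show ?thesis
    by (auto simp: sum_le_def has_sum_iff algebra_simps)
qed

lemma sum_le_exp:
  assumes "N \<ge> 1"
  shows "sum_le (\<lambda>l. exp (- \<bar>of_int l - y\<bar> / N)) (12 * N)"
  using exp_abs_int_has_sum[OF assms] by (simp add: sum_le_def)

lemma sum_le_norm_bound:
  fixes E :: "int \<Rightarrow> complex"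
  assumes "sum_le g c" and le: "\<And>l. norm (E l) \<le> g l"
  shows "E abs_summable_on UNIV" and "(\<Sum>\<^sub>\<infinity>l. norm (E l)) \<le> c"
proof -
  have g: "g summable_on UNIV" "infsum g UNIV \<le> c" using assms(1) by (auto simp: sum_le_def)
  show s: "E abs_summable_on UNIV" by (rule summable_on_comparison_test[OF g(1)]) (use le in auto)
  have "(\<Sum>\<^sub>\<infinity>l. norm (E l)) \<le> infsum g UNIV" by (rule infsum_mono[OF s g(1) le])
  then show "(\<Sum>\<^sub>\<infinity>l. norm (E l)) \<le> c" using g(2) by simp
qed

lemma conv_diff_left:
  assumes "f abs_summable_on UNIV" "g abs_summable_on UNIV" and u: "\<And>l. norm (u l) \<le> U"
  shows "((\<lambda>l. f l - g l) \<star> u) l = (f \<star> u) l - (g \<star> u) l"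
proof -
  note s = abs_summable_summable[OF bounded_imp_conv_summable(1)[OF _ u, of _ l]]
  have "((\<lambda>l'. f (l - l') * u l' + (- 1) * (g (l - l') * u l')) has_sum (f \<star> u) l + (- 1) * (g \<star> u) l) UNIV"
    unfolding conv_def
    by (intro has_sum_add has_sum_cmult_right has_sum_infsum s assms)
  from infsumI[OF this] show ?thesis by (simp add: conv_def left_diff_distrib)
qed

text \<open>Summability is part of the conclusion because the induction step needs it for the
  partial sum.\<close>

lemma conv_sum_left:
  assumes "finite I" and "\<And>k. k \<in> I \<Longrightarrow> f k abs_summable_on UNIV" and u: "\<And>l. norm (u l) \<le> U"
  shows "(\<lambda>l. \<Sum>k\<in>I. f k l) abs_summable_on UNIV \<and> ((\<lambda>l. \<Sum>k\<in>I. f k l) \<star> u) l = (\<Sum>k\<in>I. (f k \<star> u) l)"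
  using assms(1,2)
proof (induction I)
  case empty
  then show ?case by (simp add: conv_def)
next
  case (insert k I)
  let ?g = "\<lambda>l. \<Sum>k\<in>I. f k l"
  have g: "?g abs_summable_on UNIV" and f: "f k abs_summable_on UNIV" using insert by auto
  have "(\<lambda>l. f k l + ?g l) abs_summable_on UNIV"
    by (rule summable_on_comparison_test[OF summable_on_add[OF f g]]) (auto intro: norm_triangle_ineq)
  moreover have "((\<lambda>l'. f k (l - l') * u l' + ?g (l - l') * u l') has_sum (f k \<star> u) l + (?g \<star> u) l) UNIV"
    unfolding conv_def
    by (rule has_sum_add[OF has_sum_infsum[OF abs_summable_summable[OF bounded_imp_conv_summable(1)[OF f u]]]
      has_sum_infsum[OF abs_summable_summable[OF bounded_imp_conv_summable(1)[OF g u]]]])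
  then have "((\<lambda>l. f k l + ?g l) \<star> u) l = (f k \<star> u) l + (?g \<star> u) l"
    by (auto simp: conv_def ring_distribs dest: infsumI)
  ultimately show ?case using insert by simp
qed

section \<open>Consequences of the two assumptions\<close>

lemma assumption_A1_D:
  assumes "assumption_A1 a"
  obtains \<epsilon> where "\<epsilon> > 0" "a abs_summable_on UNIV"
    "\<And>\<zeta>. 1 - \<epsilon> < norm \<zeta> \<Longrightarrow> norm \<zeta> < 1 + \<epsilon> \<Longrightarrow> (\<lambda>l. a l * \<zeta> powi l) abs_summable_on UNIV"
    "symbol a holomorphic_on {\<zeta>. 1 - \<epsilon> < norm \<zeta> \<and> norm \<zeta> < 1 + \<epsilon>}"
proof -
  from assms obtain \<epsilon> where \<epsilon>: "\<epsilon> > 0"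
    "\<And>\<zeta>. 1 - \<epsilon> < norm \<zeta> \<Longrightarrow> norm \<zeta> < 1 + \<epsilon> \<Longrightarrow> (\<lambda>l. a l * \<zeta> powi l) summable_on UNIV"
    "symbol a holomorphic_on {\<zeta>. 1 - \<epsilon> < norm \<zeta> \<and> norm \<zeta> < 1 + \<epsilon>}"
    unfolding assumption_A1_def by blast
  have "a abs_summable_on UNIV"
    using \<epsilon>(1) \<epsilon>(2)[of 1] by (simp add: summable_on_iff_abs_summable_on_complex)
  moreover have "(\<lambda>l. a l * \<zeta> powi l) abs_summable_on UNIV" if "1 - \<epsilon> < norm \<zeta>" "norm \<zeta> < 1 + \<epsilon>" for \<zeta>
    using \<epsilon>(2)[OF that] by (simp only: summable_on_iff_abs_summable_on_complex)
  ultimately show ?thesis using \<epsilon>(1,3) that by blast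
qed

text \<open>Both exp \<eta> and exp (- \<eta>) lie in the annulus of convergence. Whatever the sign
  of \<open>l\<close>, one of the two weights equals exp (\<eta> * |l|), so beyond the window the
  sum of the two weighted norms gains the factor exp (\<eta> * n^2).\<close>

lemma conv_pow_weighted_bound:
  assumes "assumption_A1 a"
  obtains \<eta> A where "\<eta> > 0" "A > 1"
    "\<And>n. n \<ge> 1 \<Longrightarrow> \<exists>w. sum_le w (2 * A ^ n) \<and> (\<forall>l. 0 \<le> w l) \<and>
       (\<forall>l. int n ^ 2 < \<bar>l\<bar> \<longrightarrow> norm (conv_pow a n l) \<le> exp (- \<eta> * real n ^ 2) * w l)"
proof -
  obtain \<epsilon> where \<epsilon>: "\<epsilon> > 0"
    "\<And>\<zeta>. 1 - \<epsilon> < norm \<zeta> \<Longrightarrow> norm \<zeta> < 1 + \<epsilon> \<Longrightarrow> (\<lambda>l. a l * \<zeta> powi l) abs_summable_on UNIV"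
    using assumption_A1_D[OF assms] by metis
  have "((\<lambda>\<eta>. exp \<eta>) \<longlongrightarrow> exp 0) (at_right (0::real))" "((\<lambda>\<eta>. exp (- \<eta>)) \<longlongrightarrow> exp (- 0)) (at_right (0::real))"
    by (intro tendsto_intros)+
  then have "\<forall>\<^sub>F \<eta> in at_right (0::real). exp \<eta> < 1 + \<epsilon>" "\<forall>\<^sub>F \<eta> in at_right (0::real). 1 - \<epsilon> < exp (- \<eta>)"
    using \<epsilon>(1) by (auto dest: order_tendstoD(2)[of _ _ _ "1 + \<epsilon>"] order_tendstoD(1)[of _ _ _ "1 - \<epsilon>"])
  then have "\<forall>\<^sub>F \<eta> in at_right (0::real). exp \<eta> < 1 + \<epsilon> \<and> 1 - \<epsilon> < exp (- \<eta>) \<and> \<eta> > 0"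
    using eventually_at_right_less[of 0] by eventually_elim simp
  from eventually_happens'[OF trivial_limit_at_right_real this]
  obtain \<eta> where \<eta>: "exp \<eta> < 1 + \<epsilon>" "1 - \<epsilon> < exp (- \<eta>)" "\<eta> > (0::real)" by blast
  define r s where "r = complex_of_real (exp \<eta>)" and "s = complex_of_real (exp (- \<eta>))"
  have nr: "norm (r powi l) = exp (\<eta> * of_int l)" and ns: "norm (s powi l) = exp (- \<eta> * of_int l)" for l
    by (simp_all add: r_def s_def norm_power_int powr_real_of_int'[symmetric] powr_def mult.commute)
  have e: "exp (- \<eta>) < 1" "1 < exp \<eta>" using \<eta>(3) by auto
  have rs: "(\<lambda>l. a l * r powi l) abs_summable_on UNIV" "(\<lambda>l. a l * s powi l) abs_summable_on UNIV"
    using \<eta> e \<epsilon>(1) by (auto intro!: \<epsilon>(2) simp: r_def s_def simp del: exp_less_one_iff one_less_exp_iff)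
  have r0: "r \<noteq> 0" "s \<noteq> 0" by (simp_all add: r_def s_def)
  let ?R = "\<Sum>\<^sub>\<infinity>l. norm (a l * r powi l)" and ?S = "\<Sum>\<^sub>\<infinity>l. norm (a l * s powi l)"
  \<comment> \<open>The sum dominates both weighted norms; the summand 2 guarantees
    \<open>A > 1\<close>.\<close>
  define A where "A = 2 + ?R + ?S"
  have RS: "?R \<ge> 0" "?S \<ge> 0" by (intro infsum_nonneg; simp)+
  have "\<exists>w. sum_le w (2 * A ^ n) \<and> (\<forall>l. 0 \<le> w l) \<and>
       (\<forall>l. int n ^ 2 < \<bar>l\<bar> \<longrightarrow> norm (conv_pow a n l) \<le> exp (- \<eta> * real n ^ 2) * w l)" if n: "n \<ge> 1" for n
  proof -
    let ?b = "conv_pow a n"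
    let ?w = "\<lambda>l. norm (?b l * r powi l) + norm (?b l * s powi l)"
    have "?R ^ n \<le> A ^ n" "?S ^ n \<le> A ^ n" using RS by (auto simp: A_def intro!: power_mono)
    then have "sum_le (\<lambda>l. norm (?b l * r powi l)) (A ^ n)" "sum_le (\<lambda>l. norm (?b l * s powi l)) (A ^ n)"
      using conv_pow_weighted(1,2)[OF r0(1) rs(1) n] conv_pow_weighted(1,2)[OF r0(2) rs(2) n]
      by (auto simp: sum_le_def)
    from sum_le_add[OF this] have "sum_le ?w (2 * A ^ n)" by simp
    moreover have "norm (?b l) \<le> exp (- \<eta> * real n ^ 2) * ?w l" if l: "int n ^ 2 < \<bar>l\<bar>" for l
    proof -
      have "real_of_int (int n ^ 2) \<le> real_of_int \<bar>l\<bar>" using l by (intro of_int_le_iff[THEN iffD2]) simp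
      then have "exp (\<eta> * real n ^ 2) \<le> exp (\<eta> * \<bar>real_of_int l\<bar>)" using \<eta>(3) by simp
      also have "\<dots> \<le> norm (r powi l) + norm (s powi l)"
        unfolding nr ns using exp_ge_zero[of "\<eta> * of_int l"] exp_ge_zero[of "- \<eta> * of_int l"]
        by (cases "l \<ge> 0") (simp_all del: exp_ge_zero)
      finally have "norm (?b l) * exp (\<eta> * real n ^ 2) \<le> norm (?b l) * (norm (r powi l) + norm (s powi l))"
        by (intro mult_left_mono) auto
      then show ?thesis by (simp add: norm_mult exp_minus field_simps)
    qed
    ultimately show ?thesis by (intro exI[of _ ?w]) auto
  qed
  then show ?thesis using \<eta>(3) RS by (intro that[of \<eta> A]) (auto simp: A_def)
qed

lemma assumption_A2_D:
  assumes "assumption_A2 a K \<kappa> \<alpha> \<beta> \<mu>"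
  shows "K \<ge> 1" "inj_on \<kappa> {1..K}" "\<kappa> ` {1..K} \<subseteq> sphere 0 1"
    "\<And>k. k \<in> {1..K} \<Longrightarrow> norm (symbol a (\<kappa> k)) = 1" "\<And>k. k \<in> {1..K} \<Longrightarrow> norm (\<kappa> k) = 1"
    "\<And>z. z \<in> sphere 0 1 - \<kappa> ` {1..K} \<Longrightarrow> norm (symbol a z) < 1"
    "\<And>k. k \<in> {1..K} \<Longrightarrow> gauss (\<beta> k) (\<mu> k)"
    "\<And>k. k \<in> {1..K} \<Longrightarrow> \<exists>R \<in> O[at 0](\<lambda>\<xi>. \<xi> ^ (2 * \<mu> k + 1)). \<forall>\<^sub>F \<xi> in at 0.
           symbol a (\<kappa> k * exp (\<i> * \<xi>)) =
             symbol a (\<kappa> k) * exp (\<i> * \<alpha> k * \<xi> - \<beta> k * \<xi> ^ (2 * \<mu> k) + R \<xi>)"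
proof -
  note A = assms[unfolded assumption_A2_def]
  show "K \<ge> 1" "inj_on \<kappa> {1..K}" "\<kappa> ` {1..K} \<subseteq> sphere 0 1" using A by blast+
  show "norm (symbol a (\<kappa> k)) = 1" if "k \<in> {1..K}" for k using A that by blast
  show "norm (\<kappa> k) = 1" if "k \<in> {1..K}" for k
  proof -
    have "\<kappa> k \<in> sphere 0 1" using A that by blast
    then show ?thesis by simp
  qed
  show "norm (symbol a z) < 1" if "z \<in> sphere 0 1 - \<kappa> ` {1..K}" for z using A that by blast
  show "gauss (\<beta> k) (\<mu> k)" if "k \<in> {1..K}" for k using A that unfolding gauss_def by blast
  show "\<exists>R \<in> O[at 0](\<lambda>\<xi>. \<xi> ^ (2 * \<mu> k + 1)). \<forall>\<^sub>F \<xi> in at 0.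
           symbol a (\<kappa> k * exp (\<i> * \<xi>)) =
             symbol a (\<kappa> k) * exp (\<i> * \<alpha> k * \<xi> - \<beta> k * \<xi> ^ (2 * \<mu> k) + R \<xi>)" if "k \<in> {1..K}" for k
    using A that by blast
qed

text \<open>Supplies the data of \<open>local_kernel\<close>: the symbol is holomorphic and nonzero
  at the maximum point, so its cumulant series converges, and the factor of degree
  \<open>2 * \<mu> k\<close> splits off.\<close>

lemma local_expansion:
  fixes a :: "int \<Rightarrow> complex" and \<alpha> :: "nat \<Rightarrow> real"
  assumes A1: "assumption_A1 a" and A2: "assumption_A2 a K \<kappa> \<alpha> \<beta> \<mu>" and k: "k \<in> {1..K}"
  shows "\<exists>\<delta>0>0. \<forall>\<delta>. 0 < \<delta> \<and> \<delta> \<le> \<delta>0 \<longrightarrow> (\<exists>C>0. \<forall>\<^sub>F n in sequentially. \<forall>l.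
     norm (\<kappa> k powi (- l) / (2 * pi) * integral {-\<delta>..\<delta>} (\<lambda>\<xi>. symbol a (\<kappa> k * cis \<xi>) ^ n * cis (- of_int l * \<xi>))
        - (\<Sum>m\<le>M. H_seq (symbol a) (\<kappa> k) (\<alpha> k) (\<beta> k) (\<mu> k) m n l))
     \<le> C * (exp (- \<bar>real_of_int l - \<alpha> k * real n\<bar> / real n powr (1 / (2 * real (\<mu> k))))
           / (real n powr (1 / (2 * real (\<mu> k)))) ^ (M + 2)
         + exp (- \<delta> * real n powr (1 / (2 * real (\<mu> k))))))"
proof -
  interpret gauss "\<beta> k" "\<mu> k" by (rule assumption_A2_D(7)[OF A2 k])
  obtain \<epsilon> where \<epsilon>: "\<epsilon> > 0" "symbol a holomorphic_on {\<zeta>. 1 - \<epsilon> < norm \<zeta> \<and> norm \<zeta> < 1 + \<epsilon>}"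
    using assumption_A1_D[OF A1] by metis
  let ?U = "{\<zeta>::complex. 1 - \<epsilon> < norm \<zeta> \<and> norm \<zeta> < 1 + \<epsilon>}"
  have U: "open ?U"
    by (intro open_Collect_conj open_Collect_less continuous_intros)
  have \<kappa>U: "\<kappa> k \<in> ?U" using assumption_A2_D(5)[OF A2 k] \<epsilon>(1) by simp
  have nz: "symbol a (\<kappa> k) \<noteq> 0" using assumption_A2_D(4)[OF A2 k] by auto
  obtain R where R: "R \<in> O[at 0](\<lambda>\<xi>. \<xi> ^ (2 * \<mu> k + 1))" "\<forall>\<^sub>F \<xi> in at 0.
           symbol a (\<kappa> k * exp (\<i> * \<xi>)) =
             symbol a (\<kappa> k) * exp (\<i> * \<alpha> k * \<xi> - \<beta> k * \<xi> ^ (2 * \<mu> k) + R \<xi>)"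
    using assumption_A2_D(8)[OF A2 k] by blast
  define \<gamma> where "\<gamma> = cumulants (symbol a) (\<kappa> k) (\<alpha> k) (\<beta> k) (\<mu> k)"
  note ce = cumulants_expansion[OF \<mu> \<epsilon>(2) U \<kappa>U nz R, folded \<gamma>_def]
  from ce(2) obtain r where r: "r > 0" and r2: "\<forall>\<xi>. norm \<xi> < r \<longrightarrow>
        summable (\<lambda>\<nu>. \<gamma> \<nu> / fact \<nu> * (\<i> * \<xi>) ^ \<nu>) \<and>
        symbol a (\<kappa> k * exp (\<i> * \<xi>)) =
          symbol a (\<kappa> k) * exp (\<i> * \<alpha> k * \<xi> - \<beta> k * \<xi> ^ (2 * \<mu> k) + (\<Sum>\<nu>. \<gamma> \<nu> / fact \<nu> * (\<i> * \<xi>) ^ \<nu>))"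
    by (elim exE conjE)
  have sm: "summable (\<lambda>\<nu>. \<gamma> \<nu> / fact \<nu> * (\<i> * \<xi>) ^ \<nu>)" if "norm \<xi> < r" for \<xi>
    using r2 that by blast
  obtain S where S: "S holomorphic_on ball 0 r"
    "S has_fps_expansion Abs_fps (\<lambda>\<nu>. \<gamma> (2 * \<mu> k + \<nu>) / fact (2 * \<mu> k + \<nu>))" "S 0 = 0"
    and S_eq: "\<And>\<xi>. norm \<xi> < r \<Longrightarrow> (\<Sum>\<nu>. \<gamma> \<nu> / fact \<nu> * (\<i> * \<xi>) ^ \<nu>) = (\<i> * \<xi>) ^ (2 * \<mu> k) * S (\<i> * \<xi>)"
    by (rule cumulants_factor[OF ce(1) r sm], assumption) (rule that)
  show ?thesis
  proof (rule local_kernel[where \<kappa> = "\<kappa> k" and F = "symbol a" and \<alpha> = "\<alpha> k", OF assumption_A2_D(5,4)[OF A2 k], folded \<gamma>_def, OF _ r S])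
    show "\<gamma> (2 * \<mu> k) = 0" using ce(1) by simp
    fix \<xi> :: complex assume \<xi>: "norm \<xi> < r"
    show "symbol a (\<kappa> k * exp (\<i> * \<xi>)) = symbol a (\<kappa> k) *
        exp (\<i> * \<alpha> k * \<xi> - \<beta> k * \<xi> ^ (2 * \<mu> k) + (\<i> * \<xi>) ^ (2 * \<mu> k) * S (\<i> * \<xi>))"
      using r2 \<xi> S_eq[OF \<xi>] by simp
  qed
qed

section \<open>Summation of the pointwise errors\<close>

lemma l1_error_bound:
  fixes a :: "int \<Rightarrow> complex" and \<kappa> \<beta> :: "nat \<Rightarrow> complex" and \<alpha> :: "nat \<Rightarrow> real"
    and \<mu> :: "nat \<Rightarrow> nat" and K M :: nat
  assumes A1: "assumption_A1 a" and A2: "assumption_A2 a K \<kappa> \<alpha> \<beta> \<mu>"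
  defines "E \<equiv> \<lambda>n l. conv_pow a n l - (\<Sum>k=1..K. \<Sum>m\<le>M. H_seq (symbol a) (\<kappa> k) (\<alpha> k) (\<beta> k) (\<mu> k) m n l)"
    and "\<sigma> \<equiv> (real M + 1) / (2 * real (Max (\<mu> ` {1..K})))"
  shows "(\<lambda>n. \<Sum>\<^sub>\<infinity>l. norm (E n l)) \<in> O(\<lambda>n. real n powr (- \<sigma>))"
proof -
  let ?I = "{1..K}"
  define N where "N = (\<lambda>k n. real n powr (1 / (2 * real (\<mu> k))))"
  define e where "e = (\<lambda>k n l. exp (- \<bar>real_of_int l - \<alpha> k * real n\<bar> / N k n))"
  \<comment> \<open>Half the decay rate: outside the window one half of the exponent pays for
    smallness in \<open>n\<close>, the other half keeps the sum over \<open>l\<close>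
    finite.\<close>
  define e2 where "e2 = (\<lambda>k n l. exp (- \<bar>real_of_int l - \<alpha> k * real n\<bar> / (2 * N k n)))"
  define H where "H = (\<lambda>k m n l. H_seq (symbol a) (\<kappa> k) (\<alpha> k) (\<beta> k) (\<mu> k) m n l)"
  define arc where "arc = (\<lambda>\<delta> k n l. \<kappa> k powi (- l) * integral {-\<delta>..\<delta>} (\<lambda>\<xi>. symbol a (\<kappa> k * cis \<xi>) ^ n * cis (- of_int l * \<xi>)))"
  have E: "E n l = conv_pow a n l - (\<Sum>k\<in>?I. \<Sum>m\<le>M. H k m n l)" for n l
    by (simp add: E_def H_def)
  have \<mu>1: "\<mu> k \<ge> 1" if "k \<in> ?I" for k
    using assumption_A2_D(7)[OF A2 that] by (simp add: gauss_def)
  have N1: "N k n \<ge> 1" if "n \<ge> 1" for k n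
    unfolding N_def using that by (intro ge_one_powr_ge_zero) auto
  have \<sigma>: "\<sigma> > 0"
  proof -
    have "\<mu> 1 \<le> Max (\<mu> ` ?I)" using assumption_A2_D(1)[OF A2] by (intro Max_ge) auto
    moreover have "\<mu> 1 \<ge> 1" by (rule \<mu>1) (use assumption_A2_D(1)[OF A2] in simp)
    ultimately have "Max (\<mu> ` ?I) > 0" by linarith
    then show ?thesis by (simp add: \<sigma>_def)
  qed
  obtain \<epsilon> where aS: "a abs_summable_on UNIV" and \<epsilon>: "\<epsilon> > 0"
    and hol: "symbol a holomorphic_on {\<zeta>. 1 - \<epsilon> < norm \<zeta> \<and> norm \<zeta> < 1 + \<epsilon>}"
    using assumption_A1_D[OF A1] by metis
  have cont: "continuous_on UNIV (\<lambda>t. symbol a (cis t))"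
    by (rule continuous_on_compose2[OF holomorphic_on_imp_continuous_on[OF hol]])
      (use \<epsilon> in \<open>auto intro!: continuous_intros\<close>)
  obtain \<eta> A where \<eta>: "\<eta> > 0" "A > 1"
    "\<And>n. n \<ge> 1 \<Longrightarrow> \<exists>w. sum_le w (2 * A ^ n) \<and> (\<forall>l. 0 \<le> w l) \<and>
       (\<forall>l. int n ^ 2 < \<bar>l\<bar> \<longrightarrow> norm (conv_pow a n l) \<le> exp (- \<eta> * real n ^ 2) * w l)"
    using conv_pow_weighted_bound[OF A1] by blast
  have "\<forall>k\<in>?I. \<exists>\<delta>0>0. \<forall>\<delta>. 0 < \<delta> \<and> \<delta> \<le> \<delta>0 \<longrightarrow> (\<exists>C>0. \<forall>\<^sub>F n in sequentially. \<forall>l.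
     norm (arc \<delta> k n l / (2 * pi) - (\<Sum>m\<le>M. H k m n l)) \<le> C * (e k n l / N k n ^ (M + 2) + exp (- \<delta> * N k n)))"
    using local_expansion[OF A1 A2, of _ M] by (simp add: arc_def H_def e_def N_def)
  from bchoice[OF this] obtain \<delta>0 where \<delta>0': "\<forall>k\<in>?I. \<delta>0 k > 0 \<and> (\<forall>\<delta>. 0 < \<delta> \<and> \<delta> \<le> \<delta>0 k \<longrightarrow> (\<exists>C>0. \<forall>\<^sub>F n in sequentially. \<forall>l.
     norm (arc \<delta> k n l / (2 * pi) - (\<Sum>m\<le>M. H k m n l)) \<le> C * (e k n l / N k n ^ (M + 2) + exp (- \<delta> * N k n))))" ..
  have \<delta>0: "\<delta>0 k > 0" if "k \<in> ?I" for k using \<delta>0' that by blast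
  obtain \<delta> q c where \<delta>: "0 < \<delta>" "\<And>k. k \<in> ?I \<Longrightarrow> \<delta> \<le> \<delta>0 k" and q: "0 < q" "q < 1"
    and split: "\<And>n l. norm (integral {c..c + 2 * pi} (\<lambda>t. symbol a (cis t) ^ n * cis (- of_int l * t))
       - (\<Sum>k\<in>?I. arc \<delta> k n l)) \<le> 2 * pi * q ^ n"
    unfolding arc_def
    by (rule circle_split[OF cont _ assumption_A2_D(2,3,6)[OF A2] \<delta>0]) (auto simp: assumption_A2_D)
  have "\<forall>k\<in>?I. \<exists>C>0. \<forall>\<^sub>F n in sequentially. \<forall>l.
     norm (arc \<delta> k n l / (2 * pi) - (\<Sum>m\<le>M. H k m n l)) \<le> C * (e k n l / N k n ^ (M + 2) + exp (- \<delta> * N k n))"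
  proof
    fix k assume k: "k \<in> ?I"
    show "\<exists>C>0. \<forall>\<^sub>F n in sequentially. \<forall>l.
     norm (arc \<delta> k n l / (2 * pi) - (\<Sum>m\<le>M. H k m n l)) \<le> C * (e k n l / N k n ^ (M + 2) + exp (- \<delta> * N k n))"
      by (rule \<delta>0'[rule_format, OF k, THEN conjunct2, rule_format]) (use \<delta> k in simp)
  qed
  from bchoice[OF this] obtain C where C': "\<forall>k\<in>?I. C k > 0 \<and> (\<forall>\<^sub>F n in sequentially. \<forall>l.
     norm (arc \<delta> k n l / (2 * pi) - (\<Sum>m\<le>M. H k m n l)) \<le> C k * (e k n l / N k n ^ (M + 2) + exp (- \<delta> * N k n)))" ..
  have C: "C k > 0" "\<forall>\<^sub>F n in sequentially. \<forall>l.
     norm (arc \<delta> k n l / (2 * pi) - (\<Sum>m\<le>M. H k m n l)) \<le> C k * (e k n l / N k n ^ (M + 2) + exp (- \<delta> * N k n))"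
    if "k \<in> ?I" for k using C' that by blast+
  have "\<forall>k\<in>?I. \<exists>D. \<forall>n\<ge>1. \<forall>l. norm (\<Sum>m\<le>M. H k m n l) \<le> D * e k n l"
  proof
    fix k assume k: "k \<in> ?I"
    interpret gauss "\<beta> k" "\<mu> k" by (rule assumption_A2_D(7)[OF A2 k])
    have "\<forall>m. \<exists>D. \<forall>n\<ge>1. \<forall>l. norm (H k m n l) \<le> D * e k n l"
      using H_seq_decay[where \<kappa> = "\<kappa> k" and F = "symbol a", OF assumption_A2_D(5,4)[OF A2 k]] unfolding H_def e_def N_def by blast
    from choice[OF this] obtain D where "\<forall>m. \<forall>n\<ge>1. \<forall>l. norm (H k m n l) \<le> D m * e k n l" ..
    then have D: "norm (H k m n l) \<le> D m * e k n l" if "n \<ge> 1" for m n l using that by blast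
    then have "norm (\<Sum>m\<le>M. H k m n l) \<le> (\<Sum>m\<le>M. D m) * e k n l" if "n \<ge> 1" for n l
      unfolding sum_distrib_right using that by (intro sum_norm_le) auto
    then show "\<exists>D. \<forall>n\<ge>1. \<forall>l. norm (\<Sum>m\<le>M. H k m n l) \<le> D * e k n l" by blast
  qed
  from bchoice[OF this] obtain D where D': "\<forall>k\<in>?I. \<forall>n\<ge>1. \<forall>l. norm (\<Sum>m\<le>M. H k m n l) \<le> D k * e k n l" ..
  have D: "norm (\<Sum>m\<le>M. H k m n l) \<le> D k * e k n l" if "k \<in> ?I" "n \<ge> 1" for k n l
    using D' that by blast
  have D0: "D k \<ge> 0" if k: "k \<in> ?I" for k
  proof -
    have "0 \<le> D k * e k 1 0" using order_trans[OF norm_ge_zero D[OF k, of 1 0]] by simp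
    then show ?thesis by (simp add: e_def zero_le_mult_iff)
  qed
  have global: "norm (E n l) \<le> q ^ n + (\<Sum>k\<in>?I. norm (arc \<delta> k n l / (2 * pi) - (\<Sum>m\<le>M. H k m n l)))" if n: "n \<ge> 1" for n l
  proof -
    have "conv_pow a n abs_summable_on UNIV"
      using conv_pow_weighted(1)[of 1 a n] aS n by simp
    moreover have sym: "symbol (conv_pow a n) (cis t) = symbol a (cis t) ^ n" for t
      by (rule conv_pow_weighted(3)[OF _ symbol_norm_le(2)[OF aS] n]) auto
    ultimately have "((\<lambda>t. symbol a (cis t) ^ n * cis (- of_int l * t)) has_integral 2 * pi * conv_pow a n l) {c..c + 2 * pi}"
      using fourier_coefficient[of "conv_pow a n" l c] cont unfolding sym by (simp add: continuous_on_power)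
    from integral_unique[OF this] split[of n l]
    have "norm (2 * pi * conv_pow a n l - (\<Sum>k\<in>?I. arc \<delta> k n l)) \<le> 2 * pi * q ^ n" by simp
    moreover have "2 * pi * conv_pow a n l - (\<Sum>k\<in>?I. arc \<delta> k n l)
       = 2 * pi * (conv_pow a n l - (\<Sum>k\<in>?I. arc \<delta> k n l / (2 * pi)))"
      by (simp add: right_diff_distrib sum_distrib_left)
    ultimately have "2 * pi * norm (conv_pow a n l - (\<Sum>k\<in>?I. arc \<delta> k n l / (2 * pi))) \<le> 2 * pi * q ^ n"
      by (simp add: norm_mult)
    then have 1: "norm (conv_pow a n l - (\<Sum>k\<in>?I. arc \<delta> k n l / (2 * pi))) \<le> q ^ n"
      using pi_gt_zero by simp
    have "E n l = (conv_pow a n l - (\<Sum>k\<in>?I. arc \<delta> k n l / (2 * pi)))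
       + (\<Sum>k\<in>?I. arc \<delta> k n l / (2 * pi) - (\<Sum>m\<le>M. H k m n l))"
      unfolding E by (simp add: sum_subtractf)
    also have "norm \<dots> \<le> q ^ n + (\<Sum>k\<in>?I. norm (arc \<delta> k n l / (2 * pi) - (\<Sum>m\<le>M. H k m n l)))"
      by (intro order_trans[OF norm_triangle_ineq] add_mono 1 norm_sum)
    finally show ?thesis .
  qed
  \<comment> \<open>The four summands are the Taylor errors summed over all \<open>l\<close>, the
    errors uniform in \<open>l\<close> times the number of window points, the tail of the
    convolution power, and the tails of the profiles. Only the first is not superpolynomially
    small.\<close>
  define B where "B = (\<lambda>n. (\<Sum>k\<in>?I. C k / N k n ^ (M + 2) * (12 * N k n))
     + (2 * real n ^ 2 + 1) * (q ^ n + (\<Sum>k\<in>?I. C k * exp (- \<delta> * N k n)))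
     + exp (- \<eta> * real n ^ 2) * (2 * A ^ n)
     + (\<Sum>k\<in>?I. D k * exp (- real n / 4) * (12 * (2 * N k n))))"
  have ev: "\<forall>\<^sub>F n in sequentially. (\<Sum>\<^sub>\<infinity>l. norm (E n l)) \<le> B n"
  proof -
    have "\<forall>\<^sub>F n in sequentially. \<forall>k\<in>?I. \<forall>l.
       norm (arc \<delta> k n l / (2 * pi) - (\<Sum>m\<le>M. H k m n l)) \<le> C k * (e k n l / N k n ^ (M + 2) + exp (- \<delta> * N k n))"
      using C(2) by (intro eventually_ball_finite) auto
    \<comment> \<open>From here on each centre \<open>\<alpha> k * real n\<close> has absolute value
      at most n^2 / 2, so a point outside the window is at distance at least n^2 / 2 from
      it.\<close>
    moreover have "\<forall>\<^sub>F n in sequentially. \<forall>k\<in>?I. real n \<ge> 2 * \<bar>\<alpha> k\<bar>"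
      using filterlim_real_sequentially
      by (intro eventually_ball_finite ballI) (auto simp: filterlim_at_top)
    ultimately show ?thesis using eventually_ge_at_top[of 1]
    proof eventually_elim
      case (elim n)
      then have n: "n \<ge> 1" by simp
      obtain w where w: "sum_le w (2 * A ^ n)" "\<And>l. 0 \<le> w l"
        "\<And>l. int n ^ 2 < \<bar>l\<bar> \<Longrightarrow> norm (conv_pow a n l) \<le> exp (- \<eta> * real n ^ 2) * w l"
        using \<eta>(3)[OF n] by blast
      define c0 where "c0 = q ^ n + (\<Sum>k\<in>?I. C k * exp (- \<delta> * N k n))"
      have c0: "c0 \<ge> 0"
        unfolding c0_def using q C(1) by (intro add_nonneg_nonneg sum_nonneg mult_nonneg_nonneg) (auto intro: less_imp_le)
      define g where "g = (\<lambda>l. (\<Sum>k\<in>?I. C k / N k n ^ (M + 2) * e k n l)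
         + (if \<bar>l\<bar> \<le> int n ^ 2 then c0 else 0) + exp (- \<eta> * real n ^ 2) * w l
         + (\<Sum>k\<in>?I. D k * exp (- real n / 4) * e2 k n l))"
      have N0: "N k n > 0" for k using N1[OF n, of k] by linarith
      have "sum_le g (B n)"
        unfolding g_def B_def c0_def[symmetric]
      proof (intro sum_le_add sum_le_sum sum_le_cmult sum_le_square_window c0 w(1))
        show "sum_le (e k n) (12 * N k n)" for k
          unfolding e_def by (rule sum_le_exp[OF N1[OF n]])
        show "sum_le (e2 k n) (12 * (2 * N k n))" for k
          unfolding e2_def by (rule sum_le_exp) (use N1[OF n, of k] in linarith)
        show "0 \<le> C k / N k n ^ (M + 2)" if "k \<in> ?I" for k
          using C(1)[OF that] N0[of k] by (intro divide_nonneg_nonneg) auto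
        show "0 \<le> D k * exp (- real n / 4)" if "k \<in> ?I" for k
          using D0[OF that] by simp
      qed auto
      moreover have "norm (E n l) \<le> g l" for l
      proof -
        have parts: "0 \<le> (\<Sum>k\<in>?I. C k / N k n ^ (M + 2) * e k n l)"
          "0 \<le> exp (- \<eta> * real n ^ 2) * w l" "0 \<le> (\<Sum>k\<in>?I. D k * exp (- real n / 4) * e2 k n l)"
          using C(1) D0 N0 w(2) by (auto simp: e_def e2_def intro!: sum_nonneg mult_nonneg_nonneg divide_nonneg_nonneg
            zero_le_power less_imp_le[OF C(1)] less_imp_le[OF N0])
        show ?thesis
        proof (cases "\<bar>l\<bar> \<le> int n ^ 2")
          case True
          have "norm (E n l) \<le> q ^ n + (\<Sum>k\<in>?I. C k * (e k n l / N k n ^ (M + 2) + exp (- \<delta> * N k n)))"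
            using elim by (intro order_trans[OF global[OF n]] add_left_mono sum_mono) auto
          also have "\<dots> = (\<Sum>k\<in>?I. C k / N k n ^ (M + 2) * e k n l) + c0"
            by (simp add: c0_def ring_distribs sum.distrib)
          finally show ?thesis using True parts by (simp add: g_def)
        next
          case False
          have "norm (\<Sum>k\<in>?I. \<Sum>m\<le>M. H k m n l) \<le> (\<Sum>k\<in>?I. D k * exp (- real n / 4) * e2 k n l)"
          proof (rule sum_norm_le)
            fix k assume k: "k \<in> ?I"
            have "int n ^ 2 \<le> \<bar>l\<bar>" using False by simp
            then have "real_of_int (int n ^ 2) \<le> real_of_int \<bar>l\<bar>" by (rule of_int_le_iff[THEN iffD2])
            then have l: "real n ^ 2 \<le> \<bar>real_of_int l\<bar>" by simp
            have "\<bar>\<alpha> k * real n\<bar> \<le> real n / 2 * real n"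
              unfolding abs_mult using bspec[OF elim(2) k] by (intro mult_mono) auto
            then have x: "real n ^ 2 / 2 \<le> \<bar>real_of_int l - \<alpha> k * real n\<bar>"
              using l unfolding power2_eq_square by linarith
            \<comment> \<open>Since the width is at most \<open>n\<close>, a distance of n^2 / 2
              divided by \<open>2 * N k n\<close> is at least n / 4.\<close>
            have "N k n \<le> real n powr 1"
              unfolding N_def using n \<mu>1[OF k] by (intro powr_mono) auto
            then have "real n / 4 * (2 * N k n) \<le> real n / 4 * (2 * real n)" using n by (intro mult_left_mono) auto
            also have "\<dots> \<le> \<bar>real_of_int l - \<alpha> k * real n\<bar>" using x by (simp add: power2_eq_square)
            finally have "real n / 4 \<le> \<bar>real_of_int l - \<alpha> k * real n\<bar> / (2 * N k n)"
              using N0[of k] by (simp add: pos_le_divide_eq)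
            moreover have "\<bar>real_of_int l - \<alpha> k * real n\<bar> / N k n
              = \<bar>real_of_int l - \<alpha> k * real n\<bar> / (2 * N k n) + \<bar>real_of_int l - \<alpha> k * real n\<bar> / (2 * N k n)"
              by simp
            ultimately have "- \<bar>real_of_int l - \<alpha> k * real n\<bar> / N k n
              \<le> - real n / 4 + - \<bar>real_of_int l - \<alpha> k * real n\<bar> / (2 * N k n)" by simp
            then have "e k n l \<le> exp (- real n / 4) * e2 k n l"
              unfolding e_def e2_def by (simp only: exp_le_cancel_iff flip: exp_add)
            then have "D k * e k n l \<le> D k * exp (- real n / 4) * e2 k n l"
              using D0[OF k] by (simp add: mult.assoc mult_left_mono)
            with D[OF k n, of l] show "norm (\<Sum>m\<le>M. H k m n l) \<le> D k * exp (- real n / 4) * e2 k n l" by linarith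
          qed
          moreover have "norm (E n l) \<le> norm (conv_pow a n l) + norm (\<Sum>k\<in>?I. \<Sum>m\<le>M. H k m n l)"
            unfolding E by (rule norm_triangle_ineq4)
          moreover have "norm (conv_pow a n l) \<le> exp (- \<eta> * real n ^ 2) * w l"
            using False by (intro w(3)) simp
          ultimately show ?thesis using False parts by (simp add: g_def)
        qed
      qed
      ultimately show ?case by (rule sum_le_norm_bound(2))
    qed
  qed
  have "B \<in> O(\<lambda>n. real n powr (- \<sigma>))"
  proof -
    have 1: "(\<lambda>n. C k / N k n ^ (M + 2) * (12 * N k n)) \<in> O(\<lambda>n. real n powr (- \<sigma>))" if k: "k \<in> ?I" for k
    proof (rule bigoI)
      show "\<forall>\<^sub>F n in sequentially. norm (C k / N k n ^ (M + 2) * (12 * N k n)) \<le> (12 * C k) * norm (real n powr (- \<sigma>))"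
        using eventually_ge_at_top[of 1]
      proof eventually_elim
        case (elim n)
        \<comment> \<open>The point with the largest \<open>\<mu> k\<close> has the smallest width
          and so the slowest rate, which is why the maximum enters \<open>\<sigma>\<close>.\<close>
        have "\<mu> k \<le> Max (\<mu> ` ?I)" using k by (intro Max_ge) auto
        then have "\<sigma> \<le> (real M + 1) / (2 * real (\<mu> k))"
          unfolding \<sigma>_def using \<mu>1[OF k] by (intro divide_left_mono) auto
        then have "real n powr \<sigma> \<le> N k n ^ (M + 1)"
          unfolding N_def powr_div_eq_power[OF elim, symmetric] using elim by (intro powr_mono) auto
        then have "inverse (N k n ^ (M + 1)) \<le> inverse (real n powr \<sigma>)"
          using elim by (intro le_imp_inverse_le) auto
        then have "12 * C k * inverse (N k n ^ (M + 1)) \<le> 12 * C k * inverse (real n powr \<sigma>)"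
          using C(1)[OF k] by (intro mult_left_mono) auto
        moreover have "C k / N k n ^ (M + 2) * (12 * N k n) = 12 * C k * inverse (N k n ^ (M + 1))"
          using N1[OF elim, of k] by (simp add: field_simps)
        ultimately show ?case
          using C(1)[OF k] N1[OF elim, of k] by (simp add: powr_minus)
      qed
    qed
    have 2: "(\<lambda>n. (2 * real n ^ 2 + 1) * q ^ n) \<in> O(\<lambda>n. real n powr (- \<sigma>))"
      using q \<sigma> by real_asymp
    have 3: "(\<lambda>n. (2 * real n ^ 2 + 1) * (C k * exp (- \<delta> * N k n))) \<in> O(\<lambda>n. real n powr (- \<sigma>))" if k: "k \<in> ?I" for k
    proof -
      define s where "s = 1 / (2 * real (\<mu> k))"
      have s: "s > 0" using \<mu>1[OF k] by (simp add: s_def)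
      have "(\<lambda>n. exp (- \<delta> * real n powr s) * (2 * real n ^ 2 + 1)) \<in> O(\<lambda>n. real n powr (- \<sigma>))"
        using \<delta>(1) s \<sigma> by real_asymp
      then have "(\<lambda>n. C k * (exp (- \<delta> * real n powr s) * (2 * real n ^ 2 + 1))) \<in> O(\<lambda>n. real n powr (- \<sigma>))" by simp
      then show ?thesis by (simp add: N_def s_def mult_ac)
    qed
    have 4: "(\<lambda>n. exp (- \<eta> * real n ^ 2) * (2 * A ^ n)) \<in> O(\<lambda>n. real n powr (- \<sigma>))"
      using \<eta>(1,2) \<sigma> by real_asymp
    have 5: "(\<lambda>n. D k * exp (- real n / 4) * (12 * (2 * N k n))) \<in> O(\<lambda>n. real n powr (- \<sigma>))" if k: "k \<in> ?I" for k
    proof -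
      define s where "s = 1 / (2 * real (\<mu> k))"
      have s: "s > 0" using \<mu>1[OF k] by (simp add: s_def)
      have "(\<lambda>n. exp (- real n / 4) * real n powr s) \<in> O(\<lambda>n. real n powr (- \<sigma>))"
        using s \<sigma> by real_asymp
      then have "(\<lambda>n. (24 * D k) * (exp (- real n / 4) * real n powr s)) \<in> O(\<lambda>n. real n powr (- \<sigma>))" by simp
      then show ?thesis by (simp add: N_def s_def mult_ac)
    qed
    show ?thesis
      unfolding B_def distrib_left sum_distrib_left
      by (intro sum_in_bigo big_sum_in_bigo 1 2 3 4 5)
  qed
  moreover have "(\<lambda>n. \<Sum>\<^sub>\<infinity>l. norm (E n l)) \<in> O(B)"
  proof (rule bigoI[where c = 1])
    show "\<forall>\<^sub>F n in sequentially. norm (\<Sum>\<^sub>\<infinity>l. norm (E n l)) \<le> 1 * norm (B n)"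
      using ev
    proof eventually_elim
      case (elim n)
      moreover have "0 \<le> (\<Sum>\<^sub>\<infinity>l. norm (E n l))" by (rule infsum_nonneg) auto
      ultimately show ?case by simp
    qed
  qed
  ultimately show ?thesis by (rule landau_o.big_trans[rotated])
qed

section \<open>From the l^1 estimate to l^p\<close>

lemma lp_norm_nonneg:
  assumes "u \<in> lp p"
  shows "0 \<le> lp_norm p u"
proof (cases "p = \<infinity>")
  case True
  then have "bdd_above (range (\<lambda>l. norm (u l)))"
    using assms by (auto simp: lp_def bounded_iff bdd_above_def)
  then have "norm (u 0) \<le> (SUP l. norm (u l))" by (intro cSUP_upper) auto
  then show ?thesis using True order_trans[OF norm_ge_zero] by (auto simp: lp_norm_def)
qed (simp add: lp_norm_def)

theorem corollary1:
  fixes a :: "int \<Rightarrow> complex" and K :: nat and \<kappa> :: "nat \<Rightarrow> complex"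
    and \<alpha> :: "nat \<Rightarrow> real" and \<beta> :: "nat \<Rightarrow> complex" and \<mu> :: "nat \<Rightarrow> nat" and M :: nat
  assumes "assumption_A1 a" and "assumption_A2 a K \<kappa> \<alpha> \<beta> \<mu>"
  shows "\<exists>C>0. \<forall>p u n. 1 \<le> p \<and> u \<in> lp p \<and> n \<ge> 1 \<longrightarrow>
    (let v = (\<lambda>l. (conv_pow a n \<star> u) l
           - (\<Sum>k=1..K. (H_seq0 (symbol a) (\<kappa> k) (\<alpha> k) (\<beta> k) (\<mu> k) n \<star> u) l)
           - (\<Sum>m=1..M. \<Sum>k=1..K. (H_seq (symbol a) (\<kappa> k) (\<alpha> k) (\<beta> k) (\<mu> k) m n \<star> u) l))
     in v \<in> lp p \<and>
        lp_norm p v \<le> C * lp_norm p u / real n powr ((real M + 1) / (2 * real (Max (\<mu> ` {1..K})))))"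
proof -
  define H where "H = (\<lambda>k m n. H_seq (symbol a) (\<kappa> k) (\<alpha> k) (\<beta> k) (\<mu> k) m n)"
  define E where "E = (\<lambda>n l. conv_pow a n l - (\<Sum>k=1..K. \<Sum>m\<le>M. H k m n l))"
  define \<sigma> where "\<sigma> = (real M + 1) / (2 * real (Max (\<mu> ` {1..K})))"
  obtain \<epsilon> where aS: "a abs_summable_on UNIV" using assumption_A1_D[OF assms(1)] by metis
  have conv_s: "conv_pow a n abs_summable_on UNIV" if "n \<ge> 1" for n
    using conv_pow_weighted(1)[of 1 a n] aS that by simp
  have H_s: "H k m n abs_summable_on UNIV" if k: "k \<in> {1..K}" and n: "n \<ge> 1" for k m n
  proof -
    interpret gauss "\<beta> k" "\<mu> k" by (rule assumption_A2_D(7)[OF assms(2) k])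
    obtain D where D: "\<And>l. norm (H k m n l)
     \<le> D * exp (- \<bar>real_of_int l - \<alpha> k * real n\<bar> / real n powr (1 / (2 * real (\<mu> k))))"
      using H_seq_decay[where \<kappa> = "\<kappa> k" and F = "symbol a", OF assumption_A2_D(5,4)[OF assms(2) k]] n unfolding H_def by blast
    show ?thesis
      by (rule summable_on_comparison_test[OF summable_on_cmult_right[OF exp_abs_int_has_sum(1)[OF root_ge_1[OF n]]]])
        (use D in auto)
  qed
  have lin: "(\<lambda>l. (conv_pow a n \<star> u) l
           - (\<Sum>k=1..K. (H_seq0 (symbol a) (\<kappa> k) (\<alpha> k) (\<beta> k) (\<mu> k) n \<star> u) l)
           - (\<Sum>m=1..M. \<Sum>k=1..K. (H_seq (symbol a) (\<kappa> k) (\<alpha> k) (\<beta> k) (\<mu> k) m n \<star> u) l)) = E n \<star> u"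
    and E_s: "E n abs_summable_on UNIV" if n: "n \<ge> 1" and u: "\<And>l. norm (u l) \<le> U" for n u U
  proof -
    have Hk: "(\<lambda>l. \<Sum>m\<le>M. H k m n l) abs_summable_on UNIV"
      "((\<lambda>l. \<Sum>m\<le>M. H k m n l) \<star> u) l = (\<Sum>m\<le>M. (H k m n \<star> u) l)" if "k \<in> {1..K}" for k l
      using conv_sum_left[OF _ H_s[OF that n] u, of "{..M}"] by auto
    have HK: "(\<lambda>l. \<Sum>k=1..K. \<Sum>m\<le>M. H k m n l) abs_summable_on UNIV"
      "((\<lambda>l. \<Sum>k=1..K. \<Sum>m\<le>M. H k m n l) \<star> u) l = (\<Sum>k=1..K. ((\<lambda>l. \<Sum>m\<le>M. H k m n l) \<star> u) l)" for l
      using conv_sum_left[of "{1..K}" "\<lambda>k l. \<Sum>m\<le>M. H k m n l", OF _ Hk(1) u] by auto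
    show "E n abs_summable_on UNIV"
      unfolding E_def
      by (rule summable_on_comparison_test[OF summable_on_add[OF conv_s[OF n] HK(1)]])
        (auto intro: norm_triangle_ineq4)
    show "(\<lambda>l. (conv_pow a n \<star> u) l
           - (\<Sum>k=1..K. (H_seq0 (symbol a) (\<kappa> k) (\<alpha> k) (\<beta> k) (\<mu> k) n \<star> u) l)
           - (\<Sum>m=1..M. \<Sum>k=1..K. (H_seq (symbol a) (\<kappa> k) (\<alpha> k) (\<beta> k) (\<mu> k) m n \<star> u) l)) = E n \<star> u"
    proof
      fix l
      have "(E n \<star> u) l = (conv_pow a n \<star> u) l - ((\<lambda>l. \<Sum>k=1..K. \<Sum>m\<le>M. H k m n l) \<star> u) l"
        unfolding E_def by (rule conv_diff_left[OF conv_s[OF n] HK(1) u])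
      also have "((\<lambda>l. \<Sum>k=1..K. \<Sum>m\<le>M. H k m n l) \<star> u) l = (\<Sum>k=1..K. \<Sum>m\<le>M. (H k m n \<star> u) l)"
        unfolding HK(2) by (intro sum.cong refl Hk(2))
      also have "(\<Sum>k=1..K. \<Sum>m\<le>M. (H k m n \<star> u) l) = (\<Sum>m\<le>M. \<Sum>k=1..K. (H k m n \<star> u) l)"
        by (rule sum.swap)
      also have "\<dots> = (\<Sum>k=1..K. (H k 0 n \<star> u) l) + (\<Sum>m=1..M. \<Sum>k=1..K. (H k m n \<star> u) l)"
        by (simp add: atMost_atLeast0 sum.atLeast_Suc_atMost)
      finally show "(conv_pow a n \<star> u) l
           - (\<Sum>k=1..K. (H_seq0 (symbol a) (\<kappa> k) (\<alpha> k) (\<beta> k) (\<mu> k) n \<star> u) l)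
           - (\<Sum>m=1..M. \<Sum>k=1..K. (H_seq (symbol a) (\<kappa> k) (\<alpha> k) (\<beta> k) (\<mu> k) m n \<star> u) l) = (E n \<star> u) l"
        by (simp add: H_def H_seq0_eq)
    qed
  qed
  have "(\<lambda>n. \<Sum>\<^sub>\<infinity>l. norm (E n l)) \<in> O(\<lambda>n. real n powr (- \<sigma>))"
    unfolding E_def H_def \<sigma>_def by (rule l1_error_bound[OF assms])
  then obtain C1 where C1: "C1 > 0" "\<forall>\<^sub>F n in sequentially. norm (\<Sum>\<^sub>\<infinity>l. norm (E n l)) \<le> C1 * norm (real n powr (- \<sigma>))"
    by (elim landau_o.bigE)
  then obtain n0 where n0: "\<And>n. n \<ge> n0 \<Longrightarrow> (\<Sum>\<^sub>\<infinity>l. norm (E n l)) \<le> C1 * real n powr (- \<sigma>)"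
    unfolding eventually_sequentially by fastforce
  \<comment> \<open>The asymptotic estimate only covers \<open>n \<ge> n0\<close>; the finitely many
    earlier indices are included by adding their rescaled errors.\<close>
  define C where "C = C1 + (\<Sum>n<n0. (\<Sum>\<^sub>\<infinity>l. norm (E n l)) * real n powr \<sigma>)"
  have nonneg: "0 \<le> (\<Sum>\<^sub>\<infinity>l. norm (E n l)) * real n powr \<sigma>" for n
    by (intro mult_nonneg_nonneg infsum_nonneg) auto
  have C: "C > 0" unfolding C_def using C1(1) nonneg by (intro add_pos_nonneg sum_nonneg) auto
  have bound: "(\<Sum>\<^sub>\<infinity>l. norm (E n l)) \<le> C / real n powr \<sigma>" if n: "n \<ge> 1" for n
  proof -
    have "(\<Sum>\<^sub>\<infinity>l. norm (E n l)) * real n powr \<sigma> \<le> C"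
    proof (cases "n \<ge> n0")
      case True
      have "(\<Sum>\<^sub>\<infinity>l. norm (E n l)) * real n powr \<sigma> \<le> C1 * real n powr (- \<sigma>) * real n powr \<sigma>"
        by (intro mult_right_mono n0 True) auto
      also have "\<dots> = C1" using n by (simp add: powr_minus)
      also have "C1 \<le> C" unfolding C_def using nonneg by (simp add: sum_nonneg)
      finally show ?thesis .
    next
      case False
      then have "(\<Sum>\<^sub>\<infinity>l. norm (E n l)) * real n powr \<sigma> \<le> (\<Sum>n<n0. (\<Sum>\<^sub>\<infinity>l. norm (E n l)) * real n powr \<sigma>)"
        using nonneg by (intro member_le_sum) auto
      then show ?thesis unfolding C_def using C1(1) by linarith
    qed
    then show ?thesis using n by (simp add: pos_le_divide_eq)
  qed
  have "lp_norm p (E n \<star> u) \<le> C * lp_norm p u / real n powr \<sigma> \<and> E n \<star> u \<in> lp p \<and>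
     (\<lambda>l. (conv_pow a n \<star> u) l
           - (\<Sum>k=1..K. (H_seq0 (symbol a) (\<kappa> k) (\<alpha> k) (\<beta> k) (\<mu> k) n \<star> u) l)
           - (\<Sum>m=1..M. \<Sum>k=1..K. (H_seq (symbol a) (\<kappa> k) (\<alpha> k) (\<beta> k) (\<mu> k) m n \<star> u) l)) = E n \<star> u"
    if p: "1 \<le> p" and u: "u \<in> lp p" and n: "n \<ge> 1" for p u n
  proof -
    obtain U where U: "\<And>l. norm (u l) \<le> U" by (rule lp_bounded[OF p u]) blast
    have "lp_norm p (E n \<star> u) \<le> (\<Sum>\<^sub>\<infinity>l. norm (E n l)) * lp_norm p u"
      by (rule young_lp(2)[OF E_s[OF n U] p u])
    also have "\<dots> \<le> C / real n powr \<sigma> * lp_norm p u"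
      by (intro mult_right_mono bound n lp_norm_nonneg[OF u])
    finally show ?thesis using young_lp(1)[OF E_s[OF n U] p u] lin[OF n U] by simp
  qed
  then show ?thesis
    using C unfolding Let_def \<sigma>_def by (intro exI[of _ C]) auto
qed

end
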